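(* Let $G$ be a connected real Lie group with Lie algebra $\mathfrak{g}$. Suppose $G$ is also a complex manifold, with left-invariant complex structure, and let $F:T^{1,0}G\to[0,+\infty)$ be a left-invariant strongly pseudoconvex complex Finsler metric on $G$. Then: (1) $F$ is a Kähler-Finsler metric if and only if $$g_v(w,[u,\bar v]^{1,0})-g_v([v,w]^{1,0},u)-g_v(v,[u,\bar w]^{1,0})-\bar{\mathcal{S}}_v(u,[v,\bar w]^{1,0})-\mathcal{C}^+_v(w,u,\mathcal{N}(v))+\mathcal{C}^-_v(w,u,[v,\bar v]^{1,0})=0$$ for all $v\in\mathfrak{g}^{1,0}\setminus\{0\}$ and all $u,w\in\mathfrak{g}^{1,0}$. (2) $F$ is a weakly Kähler-Finsler metric if and only if $$g_v(w,[v,\bar v]^{1,0})-g_v([v,w]^{1,0},v)-g_v(v,[v,\bar w]^{1,0})-\mathcal{S}_v(\mathcal{N}(v),w)=0$$ for all $v\in\mathfrak{g}^{1,0}\setminus\{0\}$ and all $w\in\mathfrak{g}^{1,0}$.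
   Context: Summation over repeated indices is used. **Complex Finsler metrics.** A complex Finsler metric on a complex manifold $M$ of complex dimension $n$ is a continuous $F:T^{1,0}M\to[0,+\infty)$, smooth off the zero section, with $F(\lambda v)=|\lambda|F(v)$ for $\lambda\in\mathbb{C}$. It is strongly pseudoconvex if the Levi matrix $(\partial^2F^2/\partial v^i\partial\bar v^j)$ in linear fiber coordinates is positive definite at every $v\ne0$. Let $\tilde M=T^{1,0}M\setminus\{\text{zero section}\}$ and $\pi:\tilde M\to M$. **Complex Chern-Rund connection.** Let $\{e_i\}$ be a smooth local frame of $T^{1,0}M$ (pulled back to a frame of $\pi^*T^{1,0}M$), $\{\varphi^i\}$ its dual coframe of $(1,0)$-forms (pulled back to $\tilde M$), and $v^i$ the fiber coordinates given by $v=v^ie_i$. Put $$g_{i\bar\jmath}=\frac{\partial^2F^2}{\partial v^i\partial\bar v^j},\quad g_{ij}=\frac{\partial^2F^2}{\partial v^i\partial v^j},\quad C_{i\bar\jmath l}=\frac{\partial^3F^2}{\partial v^i\partial\bar v^j\partial v^l},\quad C_{i\bar\jmath\bar l}=\frac{\partial^3F^2}{\partial v^i\partial\bar v^j\partial\bar v^l}.$$ There are unique horizontal $1$-forms $\omega^i_j=\Gamma^i_{jk}\varphi^k+\Gamma^i_{j\bar k}\bar\varphi^k$ on $\tilde M$ such that (a) $d\varphi^i=\varphi^j\wedge\omega^i_j+\tau^i$ with the $(1,1)$-component of $\tau^i$ zero, and (b) $dg_{i\bar\jmath}=g_{l\bar\jmath}\omega^l_i+g_{i\bar l}\overline{\omega^l_j}+C_{i\bar\jmath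 l}\boldsymbol{\varphi}^{n+l}+C_{i\bar\jmath\bar l}\overline{\boldsymbol{\varphi}^{n+l}}$, where $\boldsymbol{\varphi}^{n+i}=dv^i+v^j\omega^i_j$. Write $\tau^i=T^i_{jk}\varphi^j\wedge\varphi^k$ with $T^i_{jk}=-T^i_{kj}$. $F$ is a Kähler-Finsler metric if $T^j_{ik}=0$ for all $i,j,k$ on $\tilde M$; it is a weakly Kähler-Finsler metric if $g_{j\bar l}T^j_{ik}v^i\bar v^l=0$ for all $k$ on $\tilde M$. **Lie group setting.** $\mathfrak{g}$ is identified with the left-invariant vector fields on $G$; the left-invariant complex structure induces $I$ on $\mathfrak{g}$, and $\mathfrak{g}^{\mathbb{C}}=\mathfrak{g}\otimes\mathbb{C}=\mathfrak{g}^{1,0}\oplus\mathfrak{g}^{0,1}$ is the decomposition into the $\pm\sqrt{-1}$-eigenspaces of $I$; $\mathfrak{g}^{1,0}\cong T^{1,0}_eG$. The bar denotes conjugation $\mathfrak{g}^{1,0}\leftrightarrow\mathfrak{g}^{0,1}$, and $x^{1,0}$ is the $\mathfrak{g}^{1,0}$-component of $x\in\mathfrak{g}^{\mathbb{C}}$. $F$ is left-invariant if $F((L_g)_*v)=F(v)$ for all $g\in G$; then $F$ is determined by its restriction to $\mathfrak{g}^{1,0}$. Fix a basis of $\mathfrak{g}^{1,0}$ (extended to a left-invariant frame $\{e_i\}$), so that $g_{i\bar\jmath},g_{ij},C_{i\bar\jmath l},C_{i\bar\jmath\bar l}$ are functions of $v\in\mathfrak{g}^{1,0}\setminus\{0\}$.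 For $u,w,x\in\mathfrak{g}^{1,0}$: $$g_v(u,w)=g_{i\bar\jmath}u^i\bar w^j,\quad \mathcal{S}_v(u,w)=g_{ij}u^iw^j,\quad \bar{\mathcal{S}}_v(u,w)=\overline{\mathcal{S}_v(u,w)},$$ $$\mathcal{C}^+_v(w,u,x)=C_{i\bar\jmath l}w^i\bar u^jx^l,\quad \mathcal{C}^-_v(w,u,x)=C_{i\bar\jmath\bar l}w^i\bar u^j\bar x^l.$$ The connection operator $\mathcal{N}:\mathfrak{g}^{1,0}\to\mathfrak{g}^{1,0}$ (depending on $v$) is the complex-linear map defined by $$g_v(\mathcal{N}(w),u)=g_v(v,[u,\bar w]^{1,0})+\bar{\mathcal{S}}_v(u,[v,\bar w]^{1,0}),\qquad u,w\in\mathfrak{g}^{1,0}.$$ *)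

theory Defs
  imports "HOL-Analysis.Analysis" "HOL-Algebra.Group"
begin

section \<open>Calculus on open subsets of complex coordinate space\<close>

primrec Ck_on :: "nat \<Rightarrow> 'a::real_normed_vector set \<Rightarrow> ('a \<Rightarrow> 'b::real_normed_vector) \<Rightarrow> bool" where
  "Ck_on 0 S f \<longleftrightarrow> continuous_on S f"
| "Ck_on (Suc k) S f \<longleftrightarrow>
     (\<forall>x\<in>S. f differentiable (at x)) \<and> (\<forall>h. Ck_on k S (\<lambda>x. frechet_derivative f (at x) h))"

text \<open>Real smoothness; only used for open \<open>S\<close>.\<close>

definition smooth_on :: "'a::real_normed_vector set \<Rightarrow> ('a \<Rightarrow> 'b::real_normed_vector) \<Rightarrow> bool" where
  "smooth_on S f \<longleftrightarrow> (\<forall>k. Ck_on k S f)"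

definition holomorphic_map_on ::
  "(complex^'n) set \<Rightarrow> (complex^'n \<Rightarrow> complex^'n) \<Rightarrow> bool" where
  "holomorphic_map_on S h \<longleftrightarrow> smooth_on S h \<and>
     (\<forall>x\<in>S. \<forall>a z. frechet_derivative h (at x) (a *s z) = a *s frechet_derivative h (at x) z)"

text \<open>The Wirtinger derivatives \<open>\<partial>/\<partial>z\<^sup>i\<close> and \<open>\<partial>/\<partial>\<bar>z\<^sup>i\<close>.\<close>

definition wirt :: "'n::finite \<Rightarrow> (complex^'n \<Rightarrow> complex) \<Rightarrow> complex^'n \<Rightarrow> complex" where
  "wirt i f x =
     (frechet_derivative f (at x) (axis i 1) - \<i> * frechet_derivative f (at x) (axis i \<i>)) / 2"

definition wirtb :: "'n::finite \<Rightarrow> (complex^'n \<Rightarrow> complex) \<Rightarrow> complex^'n \<Rightarrow> complex" where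
  "wirtb i f x =
     (frechet_derivative f (at x) (axis i 1) + \<i> * frechet_derivative f (at x) (axis i \<i>)) / 2"

text \<open>A pair \<open>(a, b)\<close> stands for the complexified tangent vector
  \<open>a\<^sup>i \<partial>/\<partial>z\<^sup>i + b\<^sup>i \<partial>/\<partial>\<bar>z\<^sup>i\<close> of the coordinate space.\<close>

type_synonym 'n cvec = "(complex, 'n) vec \<times> (complex, 'n) vec"

definition dderiv :: "(complex^'n \<Rightarrow> complex) \<Rightarrow> complex^'n \<Rightarrow> 'n::finite cvec \<Rightarrow> complex" where
  "dderiv f x Z = (\<Sum>i\<in>UNIV. fst Z $ i * wirt i f x + snd Z $ i * wirtb i f x)"

text \<open>The complexified differential of a real-differentiable map: its components are the
  derivatives of \<open>z\<^sup>i \<circ> h\<close> and \<open>\<bar>z\<^sup>i \<circ> h\<close> along the vector. No holomorphy is presupposed.\<close>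

definition push :: "(complex^'n \<Rightarrow> complex^'n) \<Rightarrow> complex^'n \<Rightarrow> 'n::finite cvec \<Rightarrow> 'n cvec" where
  "push h x Z = (\<chi> i. dderiv (\<lambda>y. h y $ i) x Z, \<chi> i. dderiv (\<lambda>y. cnj (h y $ i)) x Z)"

definition vcnj :: "complex^'n \<Rightarrow> complex^'n" where
  "vcnj a = (\<chi> i. cnj (a $ i))"

definition pcnj :: "'n::finite cvec \<Rightarrow> 'n cvec" where
  "pcnj Z = (vcnj (snd Z), vcnj (fst Z))"


section \<open>Complex manifolds and their complexified tangent bundle\<close>

text \<open>A chart is a domain together with a coordinate map, the values of which outside the
  domain are irrelevant.\<close>

type_synonym ('a, 'n) chart = "'a set \<times> ('a \<Rightarrow> (complex, 'n) vec)"

definition chart_inv :: "('a, 'n::finite) chart \<Rightarrow> complex^'n \<Rightarrow> 'a" where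
  "chart_inv c = inv_into (fst c) (snd c)"

definition complex_manifold :: "'a topology \<Rightarrow> ('a, 'n::finite) chart set \<Rightarrow> bool" where
  "complex_manifold X A \<longleftrightarrow>
     Hausdorff_space X \<and> second_countable X \<and>
     (\<Union>c\<in>A. fst c) = topspace X \<and>
     (\<forall>c\<in>A. openin X (fst c) \<and> open (snd c ` fst c) \<and>
        homeomorphic_map (subtopology X (fst c)) (top_of_set (snd c ` fst c)) (snd c)) \<and>
     (\<forall>c\<in>A. \<forall>d\<in>A. holomorphic_map_on (snd c ` (fst c \<inter> fst d)) (snd d \<circ> chart_inv c))"

definition charts_at :: "('a, 'n::finite) chart set \<Rightarrow> 'a \<Rightarrow> ('a, 'n) chart set" where
  "charts_at A p = {c \<in> A. p \<in> fst c}"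

definition chart_at :: "('a, 'n::finite) chart set \<Rightarrow> 'a \<Rightarrow> ('a, 'n) chart" where
  "chart_at A p = (SOME c. c \<in> charts_at A p)"

text \<open>A complexified tangent vector at \<open>p\<close> is given by its components in all the charts around
  \<open>p\<close>, related by the transformation law; it is \<open>0\<close> on the other charts, so that equality and
  the linear operations are those of functions.\<close>

type_synonym ('a, 'n) tvec = "('a, 'n) chart \<Rightarrow> 'n cvec"

definition ctangent :: "('a, 'n::finite) chart set \<Rightarrow> 'a \<Rightarrow> ('a, 'n) tvec set" where
  "ctangent A p = {Z.
     (\<forall>c. c \<notin> charts_at A p \<longrightarrow> Z c = 0) \<and>
     (\<forall>c\<in>charts_at A p. \<forall>d\<in>charts_at A p. Z d = push (snd d \<circ> chart_inv c) (snd c p) (Z c))}"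

text \<open>The tangent vector at \<open>p\<close> with components \<open>Z\<close> in the chart \<open>c\<close>.\<close>

definition tvec_of ::
  "('a, 'n::finite) chart set \<Rightarrow> ('a, 'n) chart \<Rightarrow> 'a \<Rightarrow> 'n cvec \<Rightarrow> ('a, 'n) tvec" where
  "tvec_of A c p Z =
     (\<lambda>d. if d \<in> charts_at A p then push (snd d \<circ> chart_inv c) (snd c p) Z else 0)"

definition tadd :: "('a, 'n::finite) tvec \<Rightarrow> ('a, 'n) tvec \<Rightarrow> ('a, 'n) tvec" where
  "tadd Y Z = (\<lambda>c. Y c + Z c)"

definition tscale :: "complex \<Rightarrow> ('a, 'n::finite) tvec \<Rightarrow> ('a, 'n) tvec" where
  "tscale a Z = (\<lambda>c. (a *s fst (Z c), a *s snd (Z c)))"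

definition tlin :: "complex^'n \<Rightarrow> ('n \<Rightarrow> ('a, 'n::finite) tvec) \<Rightarrow> ('a, 'n) tvec" where
  "tlin \<xi> E = (\<lambda>c. (\<Sum>i\<in>UNIV. \<xi> $ i *s fst (E i c), \<Sum>i\<in>UNIV. \<xi> $ i *s snd (E i c)))"

definition tconj :: "('a, 'n::finite) tvec \<Rightarrow> ('a, 'n) tvec" where
  "tconj Z = (\<lambda>c. pcnj (Z c))"

text \<open>The complex structure, extended complex linearly: \<open>I \<partial>/\<partial>z\<^sup>i = \<i> \<partial>/\<partial>z\<^sup>i\<close> and
  \<open>I \<partial>/\<partial>\<bar>z\<^sup>i = - \<i> \<partial>/\<partial>\<bar>z\<^sup>i\<close>.\<close>

definition cplx_str :: "('a, 'n::finite) tvec \<Rightarrow> ('a, 'n) tvec" where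
  "cplx_str Z = (\<lambda>c. (\<i> *s fst (Z c), (- \<i>) *s snd (Z c)))"

definition T10 :: "('a, 'n::finite) chart set \<Rightarrow> 'a \<Rightarrow> ('a, 'n) tvec set" where
  "T10 A p = {Z \<in> ctangent A p. cplx_str Z = tscale \<i> Z}"

text \<open>The components in the eigenspaces of \<open>cplx_str\<close> for \<open>\<i>\<close> and \<open>- \<i>\<close>.\<close>

definition part10 :: "('a, 'n::finite) tvec \<Rightarrow> ('a, 'n) tvec" where
  "part10 Z = (\<lambda>c. (fst (Z c), 0))"

definition part01 :: "('a, 'n::finite) tvec \<Rightarrow> ('a, 'n) tvec" where
  "part01 Z = (\<lambda>c. (0, snd (Z c)))"

text \<open>The differential \<open>df\<^sub>p\<close> of a map \<open>f\<close>; the result does not depend on the chosen chart.\<close>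

definition tmap ::
  "('a, 'n::finite) chart set \<Rightarrow> ('a \<Rightarrow> 'a) \<Rightarrow> 'a \<Rightarrow> ('a, 'n) tvec \<Rightarrow> ('a, 'n) tvec" where
  "tmap A f p Z = (\<lambda>d.
     if d \<in> charts_at A (f p)
     then let c = chart_at A p in push (\<lambda>x. snd d (f (chart_inv c x))) (snd c p) (Z c)
     else 0)"

type_synonym ('a, 'n) field = "'a \<Rightarrow> ('a, 'n) tvec"

definition smooth_field ::
  "('a, 'n::finite) chart set \<Rightarrow> 'a set \<Rightarrow> ('a, 'n) field \<Rightarrow> bool" where
  "smooth_field A U Z \<longleftrightarrow>
     (\<forall>c\<in>A. smooth_on (snd c ` (U \<inter> fst c)) (\<lambda>x. Z (chart_inv c x) c))"

text \<open>The Lie bracket, complex bilinear on complexified fields: \<open>[Y, Z] f = Y (Z f) - Z (Y f)\<close>.\<close>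

definition bracket ::
  "('a, 'n::finite) chart set \<Rightarrow> ('a, 'n) field \<Rightarrow> ('a, 'n) field \<Rightarrow> ('a, 'n) field" where
  "bracket A Y Z = (\<lambda>p c.
     if c \<in> charts_at A p then
       (\<chi> i. dderiv (\<lambda>x. fst (Z (chart_inv c x) c) $ i) (snd c p) (Y p c)
            - dderiv (\<lambda>x. fst (Y (chart_inv c x) c) $ i) (snd c p) (Z p c),
        \<chi> i. dderiv (\<lambda>x. snd (Z (chart_inv c x) c) $ i) (snd c p) (Y p c)
            - dderiv (\<lambda>x. snd (Y (chart_inv c x) c) $ i) (snd c p) (Z p c))
     else 0)"

text \<open>The exterior derivative \<open>d\<alpha>(Y, Z) = Y(\<alpha>(Z)) - Z(\<alpha>(Y))\<close> of a complex 1-form \<open>\<alpha>\<close> at \<open>p\<close>, with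
  \<open>Y\<close> and \<open>Z\<close> extended to fields with constant components in a chart. The convention for
  products is \<open>(\<alpha> \<and> \<beta>)(Y, Z) = \<alpha>(Y) \<beta>(Z) - \<alpha>(Z) \<beta>(Y)\<close>.\<close>

definition ext_deriv ::
  "('a, 'n::finite) chart set \<Rightarrow> ('a \<Rightarrow> ('a, 'n) tvec \<Rightarrow> complex) \<Rightarrow>
   'a \<Rightarrow> ('a, 'n) tvec \<Rightarrow> ('a, 'n) tvec \<Rightarrow> complex" where
  "ext_deriv A \<alpha> p Y Z = (let c = chart_at A p in
       dderiv (\<lambda>x. \<alpha> (chart_inv c x) (tvec_of A c (chart_inv c x) (Z c))) (snd c p) (Y c)
     - dderiv (\<lambda>x. \<alpha> (chart_inv c x) (tvec_of A c (chart_inv c x) (Y c))) (snd c p) (Z c))"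


section \<open>Frames and complex Finsler metrics\<close>

definition local_frame ::
  "'a topology \<Rightarrow> ('a, 'n::finite) chart set \<Rightarrow> 'a set \<Rightarrow> ('n \<Rightarrow> ('a, 'n) field) \<Rightarrow> bool" where
  "local_frame X A U e \<longleftrightarrow>
     openin X U \<and> (\<forall>i. smooth_field A U (e i)) \<and>
     (\<forall>p\<in>U. (\<forall>i. e i p \<in> T10 A p) \<and> (\<forall>Z\<in>T10 A p. \<exists>!\<xi>. Z = tlin \<xi> (\<lambda>i. e i p)))"

text \<open>The dual coframe \<open>\<phi>\<^sup>i\<close> of (1,0)-forms, on complexified tangent vectors.\<close>

definition coframe ::
  "('n \<Rightarrow> ('a, 'n::finite) field) \<Rightarrow> 'n \<Rightarrow> 'a \<Rightarrow> ('a, 'n) tvec \<Rightarrow> complex" where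
  "coframe e i p Z = (THE \<xi>. part10 Z = tlin \<xi> (\<lambda>j. e j p)) $ i"

definition coord_frame ::
  "('a, 'n::finite) chart set \<Rightarrow> ('a, 'n) chart \<Rightarrow> 'n \<Rightarrow> ('a, 'n) field" where
  "coord_frame A c i p = tvec_of A c p (axis i 1, 0)"

text \<open>A metric is a function \<open>F p Z\<close> of a point \<open>p\<close> and a vector \<open>Z \<in> T10 A p\<close>. In terms of a
  frame \<open>e\<close>, the points of the bundle are described by \<open>p\<close> and the fibre coordinates \<open>v\<close>.\<close>

definition fsq ::
  "('a \<Rightarrow> ('a, 'n) tvec \<Rightarrow> real) \<Rightarrow> ('n \<Rightarrow> ('a, 'n::finite) field) \<Rightarrow> 'a \<Rightarrow> complex^'n \<Rightarrow> complex" where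
  "fsq F e p v = complex_of_real ((F p (tlin v (\<lambda>i. e i p)))\<^sup>2)"

text \<open>\<open>g\<^bsub>i\<bar>j\<^esub>\<close>, \<open>g\<^bsub>ij\<^esub>\<close>, \<open>C\<^bsub>i\<bar>jl\<^esub>\<close> and \<open>C\<^bsub>i\<bar>j\<bar>l\<^esub>\<close>, in this order.\<close>

definition g_mix ::
  "('a \<Rightarrow> ('a, 'n) tvec \<Rightarrow> real) \<Rightarrow> ('n \<Rightarrow> ('a, 'n::finite) field) \<Rightarrow>
   'n \<Rightarrow> 'n \<Rightarrow> 'a \<Rightarrow> complex^'n \<Rightarrow> complex" where
  "g_mix F e i j p = wirt i (wirtb j (fsq F e p))"

definition g_hol ::
  "('a \<Rightarrow> ('a, 'n) tvec \<Rightarrow> real) \<Rightarrow> ('n \<Rightarrow> ('a, 'n::finite) field) \<Rightarrow>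
   'n \<Rightarrow> 'n \<Rightarrow> 'a \<Rightarrow> complex^'n \<Rightarrow> complex" where
  "g_hol F e i j p = wirt i (wirt j (fsq F e p))"

definition C_hol ::
  "('a \<Rightarrow> ('a, 'n) tvec \<Rightarrow> real) \<Rightarrow> ('n \<Rightarrow> ('a, 'n::finite) field) \<Rightarrow>
   'n \<Rightarrow> 'n \<Rightarrow> 'n \<Rightarrow> 'a \<Rightarrow> complex^'n \<Rightarrow> complex" where
  "C_hol F e i j l p = wirt i (wirtb j (wirt l (fsq F e p)))"

definition C_bar ::
  "('a \<Rightarrow> ('a, 'n) tvec \<Rightarrow> real) \<Rightarrow> ('n \<Rightarrow> ('a, 'n::finite) field) \<Rightarrow>
   'n \<Rightarrow> 'n \<Rightarrow> 'n \<Rightarrow> 'a \<Rightarrow> complex^'n \<Rightarrow> complex" where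
  "C_bar F e i j l p = wirt i (wirtb j (wirtb l (fsq F e p)))"

definition complex_finsler_metric ::
  "'a topology \<Rightarrow> ('a, 'n::finite) chart set \<Rightarrow> ('a \<Rightarrow> ('a, 'n) tvec \<Rightarrow> real) \<Rightarrow> bool" where
  "complex_finsler_metric X A F \<longleftrightarrow>
     (\<forall>p\<in>topspace X. \<forall>Z\<in>T10 A p. 0 \<le> F p Z) \<and>
     (\<forall>p\<in>topspace X. \<forall>Z\<in>T10 A p. \<forall>a. F p (tscale a Z) = cmod a * F p Z) \<and>
     (\<forall>c\<in>A.
        let Fc = (\<lambda>(x, v). F (chart_inv c x) (tlin v (\<lambda>i. coord_frame A c i (chart_inv c x))))
        in continuous_on ((snd c ` fst c) \<times> UNIV) Fc \<and>
           smooth_on ((snd c ` fst c) \<times> (- {0})) Fc)"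

definition positive_definite :: "('n::finite \<Rightarrow> 'n \<Rightarrow> complex) \<Rightarrow> bool" where
  "positive_definite h \<longleftrightarrow> (\<forall>\<xi>::complex^'n. \<xi> \<noteq> 0 \<longrightarrow>
     (\<Sum>i\<in>UNIV. \<Sum>j\<in>UNIV. h i j * \<xi> $ i * cnj (\<xi> $ j)) \<in> \<real> \<and>
     0 < Re (\<Sum>i\<in>UNIV. \<Sum>j\<in>UNIV. h i j * \<xi> $ i * cnj (\<xi> $ j)))"

definition strongly_pseudoconvex ::
  "('a, 'n::finite) chart set \<Rightarrow> ('a \<Rightarrow> ('a, 'n) tvec \<Rightarrow> real) \<Rightarrow> bool" where
  "strongly_pseudoconvex A F \<longleftrightarrow>
     (\<forall>c\<in>A. \<forall>p\<in>fst c. \<forall>v. v \<noteq> 0 \<longrightarrow>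
        positive_definite (\<lambda>i j. g_mix F (coord_frame A c) i j p v))"


section \<open>The complex Chern-Rund connection and Kaehler-Finsler metrics\<close>

text \<open>Over the domain of a frame, forms on the bundle without its zero section are evaluated at
  \<open>(p, v)\<close> with \<open>v \<noteq> 0\<close>, on complexified tangent vectors \<open>(Z, W)\<close> with \<open>Z\<close> in the base and
  \<open>W\<close> in the fibre coordinates. The conjugate of a form \<open>\<alpha>\<close> is \<open>Z \<mapsto> cnj (\<alpha> (tconj Z))\<close>.
  \<open>\<Gamma> i j k\<close> and \<open>\<Gamma>b i j k\<close> are the coefficients \<open>\<Gamma>\<^sup>i\<^bsub>jk\<^esub>\<close> and \<open>\<Gamma>\<^sup>i\<^bsub>j\<bar>k\<^esub>\<close> of \<open>\<omega>\<^sup>i\<^sub>j\<close>.\<close>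

type_synonym ('a, 'n) coeffs = "'n \<Rightarrow> 'n \<Rightarrow> 'n \<Rightarrow> 'a \<Rightarrow> (complex, 'n) vec \<Rightarrow> complex"

definition conn_form ::
  "('n \<Rightarrow> ('a, 'n::finite) field) \<Rightarrow> ('a, 'n) coeffs \<Rightarrow> ('a, 'n) coeffs \<Rightarrow>
   'n \<Rightarrow> 'n \<Rightarrow> 'a \<Rightarrow> complex^'n \<Rightarrow> ('a, 'n) tvec \<Rightarrow> complex" where
  "conn_form e \<Gamma> \<Gamma>b i j p v Z =
     (\<Sum>k\<in>UNIV. \<Gamma> i j k p v * coframe e k p Z + \<Gamma>b i j k p v * cnj (coframe e k p (tconj Z)))"

text \<open>\<open>\<phi>\<^bsup>n+i\<^esup> = dv\<^sup>i + v\<^sup>j \<omega>\<^sup>i\<^sub>j\<close>\<close>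

definition vert_form ::
  "('n \<Rightarrow> ('a, 'n::finite) field) \<Rightarrow> ('a, 'n) coeffs \<Rightarrow> ('a, 'n) coeffs \<Rightarrow>
   'n \<Rightarrow> 'a \<Rightarrow> complex^'n \<Rightarrow> ('a, 'n) tvec \<Rightarrow> 'n cvec \<Rightarrow> complex" where
  "vert_form e \<Gamma> \<Gamma>b i p v Z W = fst W $ i + (\<Sum>j\<in>UNIV. v $ j * conn_form e \<Gamma> \<Gamma>b i j p v Z)"

text \<open>The differential of a function on the bundle, in base and fibre coordinates.\<close>

definition total_diff ::
  "('a, 'n::finite) chart set \<Rightarrow> ('a \<Rightarrow> complex^'n \<Rightarrow> complex) \<Rightarrow>
   'a \<Rightarrow> complex^'n \<Rightarrow> ('a, 'n) tvec \<Rightarrow> 'n cvec \<Rightarrow> complex" where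
  "total_diff A f p v Z W = (let c = chart_at A p in
     dderiv (\<lambda>x. f (chart_inv c x) v) (snd c p) (Z c) + dderiv (f p) v W)"

text \<open>\<open>\<tau>\<^sup>i = d\<phi>\<^sup>i - \<phi>\<^sup>j \<and> \<omega>\<^sup>i\<^sub>j\<close>\<close>

definition torsion_form ::
  "('a, 'n::finite) chart set \<Rightarrow> ('n \<Rightarrow> ('a, 'n) field) \<Rightarrow> ('a, 'n) coeffs \<Rightarrow> ('a, 'n) coeffs \<Rightarrow>
   'n \<Rightarrow> 'a \<Rightarrow> complex^'n \<Rightarrow> ('a, 'n) tvec \<Rightarrow> ('a, 'n) tvec \<Rightarrow> complex" where
  "torsion_form A e \<Gamma> \<Gamma>b i p v Y Z =
     ext_deriv A (coframe e i) p Y Z -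
     (\<Sum>j\<in>UNIV. coframe e j p Y * conn_form e \<Gamma> \<Gamma>b i j p v Z
              - coframe e j p Z * conn_form e \<Gamma> \<Gamma>b i j p v Y)"

text \<open>The (1,1)-component of a 2-form.\<close>

definition component11 ::
  "(('a, 'n::finite) tvec \<Rightarrow> ('a, 'n) tvec \<Rightarrow> complex) \<Rightarrow>
   ('a, 'n) tvec \<Rightarrow> ('a, 'n) tvec \<Rightarrow> complex" where
  "component11 \<beta> Y Z = \<beta> (part10 Y) (part01 Z) + \<beta> (part01 Y) (part10 Z)"

definition chern_rund_connection ::
  "('a, 'n::finite) chart set \<Rightarrow> ('a \<Rightarrow> ('a, 'n) tvec \<Rightarrow> real) \<Rightarrow>
   'a set \<Rightarrow> ('n \<Rightarrow> ('a, 'n) field) \<Rightarrow> ('a, 'n) coeffs \<Rightarrow> ('a, 'n) coeffs \<Rightarrow> bool" where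
  "chern_rund_connection A F U e \<Gamma> \<Gamma>b \<longleftrightarrow> (\<forall>p\<in>U. \<forall>v. v \<noteq> 0 \<longrightarrow>
     (\<forall>i. \<forall>Y\<in>ctangent A p. \<forall>Z\<in>ctangent A p.
        component11 (torsion_form A e \<Gamma> \<Gamma>b i p v) Y Z = 0) \<and>
     (\<forall>i j. \<forall>Z\<in>ctangent A p. \<forall>W.
        total_diff A (g_mix F e i j) p v Z W =
          (\<Sum>l\<in>UNIV. g_mix F e l j p v * conn_form e \<Gamma> \<Gamma>b l i p v Z
                   + g_mix F e i l p v * cnj (conn_form e \<Gamma> \<Gamma>b l j p v (tconj Z))
                   + C_hol F e i j l p v * vert_form e \<Gamma> \<Gamma>b l p v Z W
                   + C_bar F e i j l p v * cnj (vert_form e \<Gamma> \<Gamma>b l p v (tconj Z) (pcnj W)))))"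

text \<open>\<open>\<tau>\<^sup>i = T\<^sup>i\<^bsub>jk\<^esub> \<phi>\<^sup>j \<and> \<phi>\<^sup>k\<close> with \<open>T\<^sup>i\<^bsub>jk\<^esub> = - T\<^sup>i\<^bsub>kj\<^esub>\<close>\<close>

definition torsion_coeffs ::
  "('a, 'n::finite) chart set \<Rightarrow> 'a set \<Rightarrow> ('n \<Rightarrow> ('a, 'n) field) \<Rightarrow>
   ('a, 'n) coeffs \<Rightarrow> ('a, 'n) coeffs \<Rightarrow> ('a, 'n) coeffs \<Rightarrow> bool" where
  "torsion_coeffs A U e \<Gamma> \<Gamma>b T \<longleftrightarrow> (\<forall>p\<in>U. \<forall>v. v \<noteq> 0 \<longrightarrow>
     (\<forall>i j k. T i j k p v = - T i k j p v) \<and>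
     (\<forall>i. \<forall>Y\<in>ctangent A p. \<forall>Z\<in>ctangent A p.
        torsion_form A e \<Gamma> \<Gamma>b i p v Y Z =
          (\<Sum>j\<in>UNIV. \<Sum>k\<in>UNIV. T i j k p v *
             (coframe e j p Y * coframe e k p Z - coframe e j p Z * coframe e k p Y))))"

text \<open>The connection forms and the torsion coefficients of a frame are unique at all \<open>(p, v)\<close>
  with \<open>p \<in> U\<close> and \<open>v \<noteq> 0\<close>, so that the existential quantifiers below only name them.\<close>

definition kaehler_finsler ::
  "'a topology \<Rightarrow> ('a, 'n::finite) chart set \<Rightarrow> ('a \<Rightarrow> ('a, 'n) tvec \<Rightarrow> real) \<Rightarrow> bool" where
  "kaehler_finsler X A F \<longleftrightarrow> (\<forall>U e. local_frame X A U e \<longrightarrow>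
     (\<exists>\<Gamma> \<Gamma>b T. chern_rund_connection A F U e \<Gamma> \<Gamma>b \<and> torsion_coeffs A U e \<Gamma> \<Gamma>b T \<and>
        (\<forall>p\<in>U. \<forall>v. v \<noteq> 0 \<longrightarrow> (\<forall>i j k. T j i k p v = 0))))"

definition weakly_kaehler_finsler ::
  "'a topology \<Rightarrow> ('a, 'n::finite) chart set \<Rightarrow> ('a \<Rightarrow> ('a, 'n) tvec \<Rightarrow> real) \<Rightarrow> bool" where
  "weakly_kaehler_finsler X A F \<longleftrightarrow> (\<forall>U e. local_frame X A U e \<longrightarrow>
     (\<exists>\<Gamma> \<Gamma>b T. chern_rund_connection A F U e \<Gamma> \<Gamma>b \<and> torsion_coeffs A U e \<Gamma> \<Gamma>b T \<and>
        (\<forall>p\<in>U. \<forall>v. v \<noteq> 0 \<longrightarrow> (\<forall>k.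
           (\<Sum>i\<in>UNIV. \<Sum>j\<in>UNIV. \<Sum>l\<in>UNIV.
              g_mix F e j l p v * T j i k p v * v $ i * cnj (v $ l)) = 0))))"


section \<open>Lie groups with a left-invariant complex structure\<close>

text \<open>The smooth structure of the real Lie group is the one underlying the complex atlas \<open>A\<close>; the
  group operations are only required to be real smooth.\<close>

definition lie_group ::
  "('a, 'm) monoid_scheme \<Rightarrow> 'a topology \<Rightarrow> ('a, 'n::finite) chart set \<Rightarrow> bool" where
  "lie_group G X A \<longleftrightarrow>
     group G \<and> carrier G = topspace X \<and> complex_manifold X A \<and>
     (\<forall>a\<in>A. \<forall>b\<in>A. \<forall>c\<in>A.
        let S = {(x, y). x \<in> snd a ` fst a \<and> y \<in> snd b ` fst b \<and>
                         chart_inv a x \<otimes>\<^bsub>G\<^esub> chart_inv b y \<in> fst c}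
        in open S \<and> smooth_on S (\<lambda>(x, y). snd c (chart_inv a x \<otimes>\<^bsub>G\<^esub> chart_inv b y))) \<and>
     (\<forall>a\<in>A. \<forall>c\<in>A.
        let S = {x \<in> snd a ` fst a. inv\<^bsub>G\<^esub> (chart_inv a x) \<in> fst c}
        in open S \<and> smooth_on S (\<lambda>x. snd c (inv\<^bsub>G\<^esub> (chart_inv a x))))"

definition left_invariant_structure ::
  "('a, 'm) monoid_scheme \<Rightarrow> ('a, 'n::finite) chart set \<Rightarrow> bool" where
  "left_invariant_structure G A \<longleftrightarrow>
     (\<forall>g\<in>carrier G. \<forall>p\<in>carrier G. \<forall>Z\<in>ctangent A p.
        tmap A (\<lambda>q. g \<otimes>\<^bsub>G\<^esub> q) p (cplx_str Z) = cplx_str (tmap A (\<lambda>q. g \<otimes>\<^bsub>G\<^esub> q) p Z))"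

definition left_invariant_metric ::
  "('a, 'm) monoid_scheme \<Rightarrow> ('a, 'n::finite) chart set \<Rightarrow> ('a \<Rightarrow> ('a, 'n) tvec \<Rightarrow> real) \<Rightarrow> bool" where
  "left_invariant_metric G A F \<longleftrightarrow>
     (\<forall>g\<in>carrier G. \<forall>p\<in>carrier G. \<forall>Z\<in>T10 A p.
        F (g \<otimes>\<^bsub>G\<^esub> p) (tmap A (\<lambda>q. g \<otimes>\<^bsub>G\<^esub> q) p Z) = F p Z)"

text \<open>\<open>\<gg>\<close>, \<open>\<gg> \<otimes> \<complex>\<close> and \<open>\<gg>\<^bsup>1,0\<^esup>\<close>. Real tangent vectors are the complexified ones fixed by
  conjugation, and fields are \<open>0\<close> outside the group, so that equality is that of functions.\<close>

definition lie_algebra ::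
  "('a, 'm) monoid_scheme \<Rightarrow> ('a, 'n::finite) chart set \<Rightarrow> ('a, 'n) field set" where
  "lie_algebra G A = {Z.
     (\<forall>p. p \<notin> carrier G \<longrightarrow> Z p = (\<lambda>c. 0)) \<and>
     (\<forall>p\<in>carrier G. Z p \<in> ctangent A p \<and> tconj (Z p) = Z p) \<and>
     smooth_field A (carrier G) Z \<and>
     (\<forall>g\<in>carrier G. \<forall>p\<in>carrier G. Z (g \<otimes>\<^bsub>G\<^esub> p) = tmap A (\<lambda>q. g \<otimes>\<^bsub>G\<^esub> q) p (Z p))}"

definition lie_algebra_C ::
  "('a, 'm) monoid_scheme \<Rightarrow> ('a, 'n::finite) chart set \<Rightarrow> ('a, 'n) field set" where
  "lie_algebra_C G A =
     {\<lambda>p. tadd (Y p) (tscale \<i> (Z p)) | Y Z. Y \<in> lie_algebra G A \<and> Z \<in> lie_algebra G A}"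

definition g10 ::
  "('a, 'm) monoid_scheme \<Rightarrow> ('a, 'n::finite) chart set \<Rightarrow> ('a, 'n) field set" where
  "g10 G A = {Z \<in> lie_algebra_C G A. \<forall>p. cplx_str (Z p) = tscale \<i> (Z p)}"

definition zero_field :: "('a, 'n::finite) field" where
  "zero_field = (\<lambda>p c. 0)"

definition fconj :: "('a, 'n::finite) field \<Rightarrow> ('a, 'n) field" where
  "fconj Z = (\<lambda>p. tconj (Z p))"

definition fpart10 :: "('a, 'n::finite) field \<Rightarrow> ('a, 'n) field" where
  "fpart10 Z = (\<lambda>p. part10 (Z p))"

definition g10_basis ::
  "('a, 'm) monoid_scheme \<Rightarrow> ('a, 'n::finite) chart set \<Rightarrow> ('n \<Rightarrow> ('a, 'n) field) \<Rightarrow> bool" where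
  "g10_basis G A e \<longleftrightarrow>
     (\<forall>i. e i \<in> g10 G A) \<and> (\<forall>Z\<in>g10 G A. \<exists>!\<xi>. Z = (\<lambda>p. tlin \<xi> (\<lambda>i. e i p)))"

definition fcoord :: "('n \<Rightarrow> ('a, 'n::finite) field) \<Rightarrow> ('a, 'n) field \<Rightarrow> complex^'n" where
  "fcoord e Z = (THE \<xi>. Z = (\<lambda>p. tlin \<xi> (\<lambda>i. e i p)))"

text \<open>In the following, \<open>e\<close> is a basis of \<open>\<gg>\<^bsup>1,0\<^esup>\<close>, and \<open>v, u, w, x\<close> are elements of \<open>\<gg>\<^bsup>1,0\<^esup>\<close>.\<close>

definition metric_g ::
  "('a, 'm) monoid_scheme \<Rightarrow> ('a \<Rightarrow> ('a, 'n::finite) tvec \<Rightarrow> real) \<Rightarrow> ('n \<Rightarrow> ('a, 'n) field) \<Rightarrow>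
   ('a, 'n) field \<Rightarrow> ('a, 'n) field \<Rightarrow> ('a, 'n) field \<Rightarrow> complex" where
  "metric_g G F e v u w =
     (\<Sum>i\<in>UNIV. \<Sum>j\<in>UNIV.
        g_mix F e i j \<one>\<^bsub>G\<^esub> (fcoord e v) * fcoord e u $ i * cnj (fcoord e w $ j))"

definition form_S ::
  "('a, 'm) monoid_scheme \<Rightarrow> ('a \<Rightarrow> ('a, 'n::finite) tvec \<Rightarrow> real) \<Rightarrow> ('n \<Rightarrow> ('a, 'n) field) \<Rightarrow>
   ('a, 'n) field \<Rightarrow> ('a, 'n) field \<Rightarrow> ('a, 'n) field \<Rightarrow> complex" where
  "form_S G F e v u w =
     (\<Sum>i\<in>UNIV. \<Sum>j\<in>UNIV.
        g_hol F e i j \<one>\<^bsub>G\<^esub> (fcoord e v) * fcoord e u $ i * fcoord e w $ j)"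

definition form_Sbar ::
  "('a, 'm) monoid_scheme \<Rightarrow> ('a \<Rightarrow> ('a, 'n::finite) tvec \<Rightarrow> real) \<Rightarrow> ('n \<Rightarrow> ('a, 'n) field) \<Rightarrow>
   ('a, 'n) field \<Rightarrow> ('a, 'n) field \<Rightarrow> ('a, 'n) field \<Rightarrow> complex" where
  "form_Sbar G F e v u w = cnj (form_S G F e v u w)"

definition cartan_plus ::
  "('a, 'm) monoid_scheme \<Rightarrow> ('a \<Rightarrow> ('a, 'n::finite) tvec \<Rightarrow> real) \<Rightarrow> ('n \<Rightarrow> ('a, 'n) field) \<Rightarrow>
   ('a, 'n) field \<Rightarrow> ('a, 'n) field \<Rightarrow> ('a, 'n) field \<Rightarrow> ('a, 'n) field \<Rightarrow> complex" where
  "cartan_plus G F e v w u x =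
     (\<Sum>i\<in>UNIV. \<Sum>j\<in>UNIV. \<Sum>l\<in>UNIV.
        C_hol F e i j l \<one>\<^bsub>G\<^esub> (fcoord e v) * fcoord e w $ i * cnj (fcoord e u $ j) * fcoord e x $ l)"

definition cartan_minus ::
  "('a, 'm) monoid_scheme \<Rightarrow> ('a \<Rightarrow> ('a, 'n::finite) tvec \<Rightarrow> real) \<Rightarrow> ('n \<Rightarrow> ('a, 'n) field) \<Rightarrow>
   ('a, 'n) field \<Rightarrow> ('a, 'n) field \<Rightarrow> ('a, 'n) field \<Rightarrow> ('a, 'n) field \<Rightarrow> complex" where
  "cartan_minus G F e v w u x =
     (\<Sum>i\<in>UNIV. \<Sum>j\<in>UNIV. \<Sum>l\<in>UNIV.
        C_bar F e i j l \<one>\<^bsub>G\<^esub> (fcoord e v) *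
        fcoord e w $ i * cnj (fcoord e u $ j) * cnj (fcoord e x $ l))"

text \<open>\<open>[x, \<bar>y]\<^bsup>1,0\<^esup>\<close>\<close>

definition mixed_bracket ::
  "('a, 'n::finite) chart set \<Rightarrow> ('a, 'n) field \<Rightarrow> ('a, 'n) field \<Rightarrow> ('a, 'n) field" where
  "mixed_bracket A x y = fpart10 (bracket A x (fconj y))"

definition connection_op ::
  "('a, 'm) monoid_scheme \<Rightarrow> ('a, 'n::finite) chart set \<Rightarrow> ('a \<Rightarrow> ('a, 'n) tvec \<Rightarrow> real) \<Rightarrow>
   ('n \<Rightarrow> ('a, 'n) field) \<Rightarrow> ('a, 'n) field \<Rightarrow> ('a, 'n) field \<Rightarrow> ('a, 'n) field" where
  "connection_op G A F e v w = (THE x. x \<in> g10 G A \<and> (\<forall>u\<in>g10 G A.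
     metric_g G F e v x u =
       metric_g G F e v v (mixed_bracket A u w) + form_Sbar G F e v u (mixed_bracket A v w)))"

end

theory Submission
  imports Defs
begin

text \<open>In a left-invariant frame \<open>e\<close> the function \<open>F\<^sup>2\<close> of the fibre coordinates does not depend on the
  base point, and \<open>[e\<^sub>i, e\<^sub>j] = c\<^sub>i\<^sub>j\<^sup>k e\<^sub>k\<close> and \<open>[e\<^sub>i, \<bar>e\<^sub>j]\<^bsup>1,0\<^esup> = B\<^sub>i\<^sub>j\<^sup>k e\<^sub>k\<close> have constant coefficients. The
  (1,1)-part of the structure equation gives \<open>\<Gamma>\<^sup>i\<^bsub>j\<bar>k\<^esub> = - B\<^sub>j\<^sub>k\<^sup>i\<close>; the metric equation, contracted with
  \<open>v\<close> by means of Euler's identities, gives \<open>v\<^sup>j \<Gamma>\<^sup>i\<^bsub>jk\<^esub> = N\<^sup>i\<^sub>k\<close> for the connection operator \<open>N\<close>, and then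
  \<open>\<Gamma>\<^sup>i\<^bsub>jk\<^esub> = \<partial>N\<^sup>i\<^sub>k/\<partial>v\<^sup>j\<close>. Hence \<open>2 T\<^sup>i\<^bsub>jk\<^esub> = - c\<^sub>j\<^sub>k\<^sup>i - \<Gamma>\<^sup>i\<^bsub>jk\<^esub> + \<Gamma>\<^sup>i\<^bsub>kj\<^esub>\<close>, and the left-hand side of the first
  condition is \<open>- 2 g\<^sub>v(T(w, v), u)\<close>, that of the second is the same expression for \<open>u = v\<close>. The
  second case is then immediate; in the first, \<open>T(w, v) = 0\<close> for all \<open>v\<close> and \<open>w\<close> implies \<open>T = 0\<close>, as
  \<open>\<Gamma>\<close> is a derivative of \<open>N\<close>. The conditions on \<open>T\<close> carry over to all other frames because the torsion
  transforms as a tensor.\<close>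

section \<open>Smooth functions\<close>

text \<open>The two directions need different information. The definitions ask for some connection
  in every local frame, so sufficiency exhibits coefficients in an arbitrary frame, while necessity
  needs uniqueness only at the identity and in the left-invariant frame, where the metric
  coefficients are constant along the base. Why the derivative of N is the connection: differentiate
  the equation defining \<open>N v w\<close> in \<open>v\<close> along \<open>x\<close>. By Euler's
  identities the derivative of g_v(v, .) is g_v(x, .), the conjugated S-term turns into a C^- term,
  and the derivative of g itself, moved to the right, is the C^+ term; the outcome is the metric
  equation for \<Gamma>(x, w). Conversely, that equation contains its unknown twice, as \<Gamma>(x,
  w) and inside the C^+ term as \<Gamma>(v, w); for x = v this term vanishes, which breaks the
  circle. Regularity shapes the preliminaries: F^2 is smooth only off the zero section, smoothness
  and positivity are given in coordinate frames, and the torsion argument differentiates N_v(v)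
  twice. Hence Cramer's rule for N, the comparison of derivatives on open sets, and the transfer of
  the tensors along linear changes of the fibre coordinate.\<close>

lemma Ck_on_cong:
  assumes "open S" "\<And>x. x \<in> S \<Longrightarrow> f x = g x" "Ck_on k S f"
  shows "Ck_on k S g"
  using assms(2,3)
proof (induction k arbitrary: f g)
  case 0
  then show ?case using continuous_on_cong[of S S f g] by simp
next
  case (Suc k)
  have e: "frechet_derivative g (at x) = frechet_derivative f (at x)" if "x \<in> S" for x
    using Suc.prems that assms(1) by (metis Ck_on.simps(2) frechet_derivative_transform_within_open)
  have "g differentiable (at x)" if x: "x \<in> S" for x
  proof -
    obtain D where "(f has_derivative D) (at x)"
      using Suc.prems x by (auto simp: differentiable_def)
    then have "(g has_derivative D) (at x)"
      using Suc.prems x assms(1) by (intro has_derivative_transform_within_open[of f D x UNIV S g]) auto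
    then show ?thesis by (auto simp: differentiable_def)
  qed
  moreover have "Ck_on k S (\<lambda>x. frechet_derivative g (at x) h)" for h
  proof (rule Suc.IH)
    show "frechet_derivative f (at x) h = frechet_derivative g (at x) h" if "x \<in> S" for x
      by (simp only: e[OF that])
    show "Ck_on k S (\<lambda>x. frechet_derivative f (at x) h)"
      using Suc.prems(2) by (simp only: Ck_on.simps)
  qed
  ultimately show ?case by (simp only: Ck_on.simps) blast
qed

lemma Ck_on_continuous:
  assumes "Ck_on k S f"
  shows "continuous_on S f"
proof (cases k)
  case 0
  then show ?thesis using assms by simp
next
  case (Suc m)
  then have "continuous (at x) f" if "x \<in> S" for x
    using assms that differentiable_imp_continuous_within by (metis Ck_on.simps(2))
  then show ?thesis by (simp add: continuous_at_imp_continuous_on)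
qed

lemma Ck_on_Suc_imp: "Ck_on (Suc k) S f \<Longrightarrow> Ck_on k S f"
proof (induction k arbitrary: f)
  case 0 show ?case using Ck_on_continuous[OF 0] by simp
qed auto

lemma Ck_on_subset: "Ck_on k S f \<Longrightarrow> T \<subseteq> S \<Longrightarrow> Ck_on k T f"
  by (induction k arbitrary: f) (auto intro: continuous_on_subset)

lemma Ck_on_const: "Ck_on k S (\<lambda>x. c)"
  by (induction k arbitrary: c) auto

lemma frechet_derivative_works': "f differentiable (at x) \<Longrightarrow> (f has_derivative frechet_derivative f (at x)) (at x)"
  using frechet_derivative_works by blast

text \<open>Allows any explicit derivative \<open>D\<close> in place of
  \<open>frechet_derivative\<close>, so that the inductions below can quote the usual
  differentiation rules.\<close>

lemma Ck_on_SucI: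
  assumes "open S" "\<And>x. x \<in> S \<Longrightarrow> (f has_derivative D x) (at x)" "\<And>h. Ck_on k S (\<lambda>x. D x h)"
  shows "Ck_on (Suc k) S f"
proof -
  have "Ck_on k S (\<lambda>x. frechet_derivative f (at x) h)" for h
  proof (rule Ck_on_cong[OF assms(1) _ assms(3)])
    show "D x h = frechet_derivative f (at x) h" if "x \<in> S" for x
      by (simp only: frechet_derivative_at[OF assms(2)[OF that], symmetric])
  qed
  moreover have "f differentiable (at x)" if "x \<in> S" for x
    using assms(2)[OF that] by (rule differentiableI)
  ultimately show ?thesis by (simp only: Ck_on.simps) blast
qed

lemma Ck_on_SucD:
  assumes "Ck_on (Suc k) S f"
  shows "x \<in> S \<Longrightarrow> (f has_derivative frechet_derivative f (at x)) (at x)"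
    and "Ck_on k S (\<lambda>x. frechet_derivative f (at x) h)"
  using assms frechet_derivative_works by auto

lemma Ck_on_add:
  assumes "open S" "Ck_on k S f" "Ck_on k S g"
  shows "Ck_on k S (\<lambda>x. f x + g x)"
  using assms(2,3)
proof (induction k arbitrary: f g)
  case 0 then show ?case by (simp add: continuous_on_add)
next
  case (Suc k)
  show ?case
    by (rule Ck_on_SucI[OF assms(1) has_derivative_add[OF Ck_on_SucD(1) Ck_on_SucD(1)]])
       (rule Suc.prems Suc.IH Ck_on_SucD(2) | assumption)+
qed

lemma Ck_on_sum:
  assumes "open S" "finite I" "\<And>i. i \<in> I \<Longrightarrow> Ck_on k S (f i)"
  shows "Ck_on k S (\<lambda>x. \<Sum>i\<in>I. f i x)"
  using assms(2,3) by (induction I) (auto intro: Ck_on_const Ck_on_add assms(1))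

lemma Ck_on_mult:
  fixes f g :: "'a::real_normed_vector \<Rightarrow> 'b::real_normed_algebra"
  assumes "open S" "Ck_on k S f" "Ck_on k S g"
  shows "Ck_on k S (\<lambda>x. f x * g x)"
  using assms(2,3)
proof (induction k arbitrary: f g)
  case 0 then show ?case by (simp add: continuous_on_mult)
next
  case (Suc k)
  show ?case
    by (rule Ck_on_SucI[OF assms(1) has_derivative_mult[OF Ck_on_SucD(1) Ck_on_SucD(1)]])
       (rule Suc.prems Ck_on_add[OF assms(1)] Suc.IH Ck_on_SucD(2) Ck_on_Suc_imp | assumption)+
qed

text \<open>The derivative of 1/f contains 1/f again, but only to order \<open>k\<close>; this is
  the induction hypothesis, applied to \<open>f\<close> demoted by one order.\<close>

lemma Ck_on_inverse:
  fixes f :: "'a::real_normed_vector \<Rightarrow> 'b::real_normed_field"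
  assumes "open S" "\<And>x. x \<in> S \<Longrightarrow> f x \<noteq> 0" "Ck_on k S f"
  shows "Ck_on k S (\<lambda>x. inverse (f x))"
  using assms(3)
proof (induction k)
  case 0 then show ?case using assms(2) by (simp add: Limits.continuous_on_inverse)
next
  case (Suc k)
  have i: "Ck_on k S (\<lambda>x. inverse (f x))" by (rule Suc.IH[OF Ck_on_Suc_imp[OF Suc.prems]])
  show ?case
  proof (rule Ck_on_SucI[OF assms(1) Deriv.has_derivative_inverse[OF assms(2) Ck_on_SucD(1)[OF Suc.prems]]])
    show "Ck_on k S (\<lambda>x. - (inverse (f x) * frechet_derivative f (at x) h * inverse (f x)))" for h
      using Ck_on_mult[OF assms(1) Ck_on_const[of k S "- 1"]
          Ck_on_mult[OF assms(1) Ck_on_mult[OF assms(1) i Ck_on_SucD(2)[OF Suc.prems, of h]] i]]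
      by simp
  qed
qed

lemma Ck_on_linear:
  assumes "open S" "bounded_linear L" "Ck_on k S f"
  shows "Ck_on k S (\<lambda>x. L (f x))"
  using assms(3)
proof (induction k arbitrary: f)
  case 0 then show ?case
    using bounded_linear.continuous_on[OF assms(2)] by simp
next
  case (Suc k)
  show ?case
    by (rule Ck_on_SucI[OF assms(1) bounded_linear.has_derivative[OF assms(2) Ck_on_SucD(1)[OF Suc.prems]]])
       (rule Suc.IH Ck_on_SucD(2)[OF Suc.prems] | assumption)+
qed

text \<open>For an affine inner map each directional derivative is again a function of
  \<open>a + L y\<close>, so the induction stays within the same statement. It serves for freezing
  one variable of a product and for linear changes of the fibre coordinate.\<close>

lemma Ck_on_affine:
  assumes "open S" "bounded_linear L" "open T" "\<And>y. y \<in> T \<Longrightarrow> a + L y \<in> S" "Ck_on k S f"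
  shows "Ck_on k T (\<lambda>y. f (a + L y))"
  using assms(5)
proof (induction k arbitrary: f)
  case 0
  have "continuous_on T (\<lambda>y. a + L y)"
    using linear_continuous_on[OF assms(2)] by (intro continuous_on_add continuous_on_const)
  then show ?case using 0 assms(4) by (auto intro: continuous_on_compose2)
next
  case (Suc k)
  have d: "((\<lambda>y. f (a + L y)) has_derivative (\<lambda>h. frechet_derivative f (at (a + L y)) (L h))) (at y)"
    if y: "y \<in> T" for y
  proof -
    have "((\<lambda>y. a + L y) has_derivative L) (at y)"
      using has_derivative_add[OF has_derivative_const bounded_linear_imp_has_derivative[OF assms(2)]]
      by simp
    from diff_chain_at[OF this Ck_on_SucD(1)[OF Suc.prems assms(4)[OF y]]]
    show ?thesis by (simp add: o_def)
  qed
  show ?case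
    by (rule Ck_on_SucI[OF assms(3) d]) (rule Suc.IH Ck_on_SucD(2)[OF Suc.prems] | assumption)+
qed

lemma smooth_on_differentiable: "smooth_on S f \<Longrightarrow> x \<in> S \<Longrightarrow> f differentiable (at x)"
  unfolding smooth_on_def by (metis Ck_on.simps(2))

lemma smooth_on_frechet: "smooth_on S f \<Longrightarrow> smooth_on S (\<lambda>x. frechet_derivative f (at x) h)"
  unfolding smooth_on_def by (metis Ck_on.simps(2))

lemma smooth_on_continuous: "smooth_on S f \<Longrightarrow> continuous_on S f"
  unfolding smooth_on_def using Ck_on_continuous by blast

lemma smooth_on_cong:
  "open S \<Longrightarrow> (\<And>x. x \<in> S \<Longrightarrow> f x = g x) \<Longrightarrow> smooth_on S f \<Longrightarrow> smooth_on S g"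
  unfolding smooth_on_def using Ck_on_cong by blast

lemma smooth_on_subset: "smooth_on S f \<Longrightarrow> T \<subseteq> S \<Longrightarrow> smooth_on T f"
  unfolding smooth_on_def using Ck_on_subset by blast

lemma smooth_on_const: "smooth_on S (\<lambda>x. c)"
  unfolding smooth_on_def using Ck_on_const by blast

lemma smooth_on_add: "open S \<Longrightarrow> smooth_on S f \<Longrightarrow> smooth_on S g \<Longrightarrow> smooth_on S (\<lambda>x. f x + g x)"
  unfolding smooth_on_def using Ck_on_add by blast

lemma smooth_on_sum:
  "open S \<Longrightarrow> finite I \<Longrightarrow> (\<And>i. i \<in> I \<Longrightarrow> smooth_on S (f i)) \<Longrightarrow> smooth_on S (\<lambda>x. \<Sum>i\<in>I. f i x)"
  unfolding smooth_on_def using Ck_on_sum by blast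

lemma smooth_on_mult:
  fixes f g :: "'a::real_normed_vector \<Rightarrow> 'b::real_normed_algebra"
  shows "open S \<Longrightarrow> smooth_on S f \<Longrightarrow> smooth_on S g \<Longrightarrow> smooth_on S (\<lambda>x. f x * g x)"
  unfolding smooth_on_def using Ck_on_mult by blast

lemma smooth_on_cmult:
  fixes f :: "'a::real_normed_vector \<Rightarrow> 'b::real_normed_algebra"
  shows "open S \<Longrightarrow> smooth_on S f \<Longrightarrow> smooth_on S (\<lambda>x. c * f x)"
  by (intro smooth_on_mult smooth_on_const)

lemma smooth_on_prod:
  fixes f :: "'i \<Rightarrow> 'a::real_normed_vector \<Rightarrow> 'b::{real_normed_algebra,comm_ring_1}"
  assumes "open S" "finite I" "\<And>i. i \<in> I \<Longrightarrow> smooth_on S (f i)"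
  shows "smooth_on S (\<lambda>x. \<Prod>i\<in>I. f i x)"
  using assms(2,3) by (induction I) (auto intro: smooth_on_const smooth_on_mult assms(1))

lemma smooth_on_inverse:
  fixes f :: "'a::real_normed_vector \<Rightarrow> 'b::real_normed_field"
  shows "open S \<Longrightarrow> (\<And>x. x \<in> S \<Longrightarrow> f x \<noteq> 0) \<Longrightarrow> smooth_on S f \<Longrightarrow> smooth_on S (\<lambda>x. inverse (f x))"
  unfolding smooth_on_def using Ck_on_inverse by blast

lemma smooth_on_linear:
  "open S \<Longrightarrow> bounded_linear L \<Longrightarrow> smooth_on S f \<Longrightarrow> smooth_on S (\<lambda>x. L (f x))"
  unfolding smooth_on_def using Ck_on_linear by blast

lemma smooth_on_affine:
  "open S \<Longrightarrow> bounded_linear L \<Longrightarrow> open T \<Longrightarrow> (\<And>y. y \<in> T \<Longrightarrow> a + L y \<in> S) \<Longrightarrow> smooth_on S f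
    \<Longrightarrow> smooth_on T (\<lambda>y. f (a + L y))"
  unfolding smooth_on_def using Ck_on_affine by metis

lemma smooth_on_cnj: "open S \<Longrightarrow> smooth_on S h \<Longrightarrow> smooth_on S (\<lambda>x. cnj (h x))"
  by (rule smooth_on_linear[OF _ bounded_linear_cnj])

lemma matrix_inv_cancel:
  fixes M :: "complex^'n^'n"
  assumes "invertible M"
  shows "M ** matrix_inv M = mat 1" "matrix_inv M ** M = mat 1"
proof -
  have "M ** matrix_inv M = mat 1 \<and> matrix_inv M ** M = mat 1"
    using assms unfolding matrix_inv_def invertible_def by (rule someI_ex)
  then show "M ** matrix_inv M = mat 1" "matrix_inv M ** M = mat 1" by blast+
qed

lemma smooth_on_det:
  fixes M :: "'a::real_normed_vector \<Rightarrow> complex^'n^'n"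
  assumes "open S" "\<And>i j. smooth_on S (\<lambda>x. M x $ i $ j)"
  shows "smooth_on S (\<lambda>x. det (M x))"
  unfolding det_def
  by (intro smooth_on_sum smooth_on_cmult smooth_on_prod assms) (auto simp: finite_permutations)

text \<open>Cramer's rule: the solution is a quotient of determinants, which are polynomials in the
  entries. This gives the smoothness of the connection operator, of dual coframes and of
  change-of-frame matrices.\<close>

lemma smooth_on_solution:
  fixes M :: "'a::real_normed_vector \<Rightarrow> complex^'n^'n" and y b :: "'a \<Rightarrow> complex^'n"
  assumes "open S" "\<And>i j. smooth_on S (\<lambda>x. M x $ i $ j)" "\<And>i. smooth_on S (\<lambda>x. b x $ i)"
    and "\<And>x. x \<in> S \<Longrightarrow> det (M x) \<noteq> 0" "\<And>x. x \<in> S \<Longrightarrow> M x *v y x = b x"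
  shows "smooth_on S (\<lambda>x. y x $ k)"
proof (rule smooth_on_cong[OF assms(1)])
  show "smooth_on S (\<lambda>x. det (\<chi> i j. if j = k then b x $ i else M x $ i $ j) * inverse (det (M x)))"
  proof (intro smooth_on_mult smooth_on_inverse smooth_on_det assms(1,2,4))
    show "smooth_on S (\<lambda>x. (\<chi> i j. if j = k then b x $ i else M x $ i $ j) $ i $ j)" for i j
      by (cases "j = k") (simp_all add: assms(2,3))
  qed
  show "det (\<chi> i j. if j = k then b x $ i else M x $ i $ j) * inverse (det (M x)) = y x $ k"
    if "x \<in> S" for x
    using cramer[OF assms(4)[OF that], of "y x" "b x"] assms(5)[OF that] by (simp add: divide_inverse)
qed

section \<open>Symmetry of second derivatives\<close>

text \<open>The mean value theorem is applied twice: along \<open>h\<close> to the increment of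
  \<open>f\<close> in direction \<open>s *\<^sub>R k\<close>, then along \<open>k\<close> to the
  derivative in direction \<open>h\<close>. The left side is symmetric in \<open>h\<close> and
  \<open>k\<close>, the right side is not.\<close>

lemma second_difference:
  fixes f :: "'a::real_normed_vector \<Rightarrow> real"
  assumes "\<And>y. y \<in> ball x r \<Longrightarrow> f differentiable (at y)"
    and "\<And>y. y \<in> ball x r \<Longrightarrow> (\<lambda>z. frechet_derivative f (at z) h) differentiable (at y)"
    and s: "0 < s" "s * (norm h + norm k) < r"
  obtains \<tau> \<sigma> where "0 < \<tau>" "\<tau> < s" "0 < \<sigma>" "\<sigma> < s"
    "f (x + s *\<^sub>R h + s *\<^sub>R k) - f (x + s *\<^sub>R h) - f (x + s *\<^sub>R k) + f x
      = s\<^sup>2 * frechet_derivative (\<lambda>z. frechet_derivative f (at z) h) (at (x + \<tau> *\<^sub>R h + \<sigma> *\<^sub>R k)) k"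
proof -
  have inb: "x + a *\<^sub>R h + b *\<^sub>R k \<in> ball x r" if "0 \<le> a" "a \<le> s" "0 \<le> b" "b \<le> s" for a b
  proof -
    have "norm (a *\<^sub>R h + b *\<^sub>R k) \<le> a * norm h + b * norm k"
      using norm_triangle_ineq[of "a *\<^sub>R h" "b *\<^sub>R k"] that by simp
    also have "\<dots> \<le> s * norm h + s * norm k"
      using that by (intro add_mono mult_right_mono) auto
    also have "\<dots> < r" using s by (simp add: algebra_simps)
    finally show ?thesis using norm_minus_commute[of x "x + (a *\<^sub>R h + b *\<^sub>R k)"] by (simp add: dist_norm add.assoc)
  qed
  have dline: "((\<lambda>t. F (a + t *\<^sub>R d)) has_real_derivative frechet_derivative F (at (a + t *\<^sub>R d)) d) (at t)"
    if "F differentiable (at (a + t *\<^sub>R d))" for F :: "'a \<Rightarrow> real" and a d t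
  proof -
    have "((\<lambda>t. a + t *\<^sub>R d) has_derivative (\<lambda>t. t *\<^sub>R d)) (at t)"
      by (auto intro!: derivative_eq_intros)
    from diff_chain_at[OF this frechet_derivative_works'[OF that]]
    have "((\<lambda>t. F (a + t *\<^sub>R d)) has_derivative (\<lambda>u. frechet_derivative F (at (a + t *\<^sub>R d)) (u *\<^sub>R d))) (at t)"
      unfolding o_def .
    then show ?thesis
      using linear_frechet_derivative[OF that]
      by (simp add: has_field_derivative_def linear_cmul mult.commute[of _ "frechet_derivative F _ d"])
  qed
  define g where "g t = f (x + s *\<^sub>R k + t *\<^sub>R h) - f (x + t *\<^sub>R h)" for t
  have "DERIV g t :> frechet_derivative f (at (x + s *\<^sub>R k + t *\<^sub>R h)) h - frechet_derivative f (at (x + t *\<^sub>R h)) h"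
    if "0 \<le> t" "t \<le> s" for t
    unfolding g_def using inb[of t s] inb[of t 0] that s
    by (intro DERIV_diff dline[of f "x + s *\<^sub>R k" t h] dline[of f x t h] assms(1))
       (simp_all add: add.assoc add.commute[of "s *\<^sub>R k"])
  from MVT2[OF s(1) this] obtain \<tau> where \<tau>: "0 < \<tau>" "\<tau> < s"
    "g s - g 0 = s * (frechet_derivative f (at (x + s *\<^sub>R k + \<tau> *\<^sub>R h)) h - frechet_derivative f (at (x + \<tau> *\<^sub>R h)) h)"
    by auto
  define G where "G t = frechet_derivative f (at (x + \<tau> *\<^sub>R h + t *\<^sub>R k)) h" for t
  have "DERIV G t :> frechet_derivative (\<lambda>z. frechet_derivative f (at z) h) (at (x + \<tau> *\<^sub>R h + t *\<^sub>R k)) k"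
    if "0 \<le> t" "t \<le> s" for t
    unfolding G_def using inb[of \<tau> t] that \<tau>
    by (intro dline[of "\<lambda>z. frechet_derivative f (at z) h" "x + \<tau> *\<^sub>R h" t k] assms(2)) auto
  from MVT2[OF s(1) this] obtain \<sigma> where \<sigma>: "0 < \<sigma>" "\<sigma> < s"
    "G s - G 0 = s * frechet_derivative (\<lambda>z. frechet_derivative f (at z) h) (at (x + \<tau> *\<^sub>R h + \<sigma> *\<^sub>R k)) k"
    by auto
  have "g s - g 0 = s * (G s - G 0)"
    using \<tau>(3) by (simp add: G_def add.assoc add.commute[of "s *\<^sub>R k"])
  then have "f (x + s *\<^sub>R h + s *\<^sub>R k) - f (x + s *\<^sub>R h) - f (x + s *\<^sub>R k) + f x
      = s\<^sup>2 * frechet_derivative (\<lambda>z. frechet_derivative f (at z) h) (at (x + \<tau> *\<^sub>R h + \<sigma> *\<^sub>R k)) k"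
    using \<sigma>(3) by (simp add: g_def power2_eq_square add.assoc add.commute[of "s *\<^sub>R k"])
  with \<tau> \<sigma> that show ?thesis by blast
qed

text \<open>One second difference is evaluated in both orders. The intermediate points differ, but
  both lie near \<open>x\<close>, where continuity keeps each second derivative within half of the
  supposed gap.\<close>

lemma frechet_derivative_commute_real:
  fixes f :: "'a::real_normed_vector \<Rightarrow> real"
  assumes "open S" "smooth_on S f" "x \<in> S"
  shows "frechet_derivative (\<lambda>z. frechet_derivative f (at z) h) (at x) k
       = frechet_derivative (\<lambda>z. frechet_derivative f (at z) k) (at x) h"
proof (rule ccontr)
  define P where "P y = frechet_derivative (\<lambda>z. frechet_derivative f (at z) h) (at y) k" for y
  define Q where "Q y = frechet_derivative (\<lambda>z. frechet_derivative f (at z) k) (at y) h" for y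
  assume "\<not> ?thesis"
  then have ne: "P x \<noteq> Q x" by (simp add: P_def Q_def)
  define e where "e = \<bar>P x - Q x\<bar> / 2"
  have e: "e > 0" using ne by (simp add: e_def)
  have "continuous_on S P" "continuous_on S Q"
    unfolding P_def Q_def by (intro smooth_on_continuous smooth_on_frechet assms)+
  then have "continuous (at x) P" "continuous (at x) Q"
    using assms(1,3) continuous_on_eq_continuous_at by blast+
  then obtain d1 d2 where d: "d1 > 0" "\<And>y. dist y x < d1 \<Longrightarrow> \<bar>P y - P x\<bar> < e"
    "d2 > 0" "\<And>y. dist y x < d2 \<Longrightarrow> \<bar>Q y - Q x\<bar> < e"
    unfolding continuous_at_eps_delta dist_real_def using e by metis
  obtain d3 where d3: "d3 > 0" "ball x d3 \<subseteq> S"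
    using assms(1,3) open_contains_ball by blast
  define r where "r = min (min d1 d2) d3"
  have r: "r > 0" "ball x r \<subseteq> S" using d d3 by (auto simp: r_def)
  \<comment> \<open>The step is small enough to keep every intermediate point in the ball of radius
    \<open>r\<close>; the summand 1 covers the case that \<open>h\<close> and \<open>k\<close> both
    vanish.\<close>
  define s where "s = r / (norm h + norm k + 1) / 2"
  have nn: "norm h + norm k + 1 > 0" by (simp add: add_nonneg_pos)
  have s: "s > 0" using r nn by (simp add: s_def)
  have "s * (norm h + norm k + 1) = r / 2" unfolding s_def using nn by (metis less_irrefl nonzero_eq_divide_eq times_divide_eq_left)
  then have sr: "s * (norm h + norm k) < r" using s r by (simp add: algebra_simps)
  have sr': "s * (norm k + norm h) < r" using sr by (simp only: add.commute)
  have diff: "f differentiable (at y)" "(\<lambda>z. frechet_derivative f (at z) u) differentiable (at y)"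
    if "y \<in> ball x r" for y u
    using that r by (blast intro: smooth_on_differentiable smooth_on_frechet assms(2))+
  obtain \<tau> \<sigma> where 1: "0 < \<tau>" "\<tau> < s" "0 < \<sigma>" "\<sigma> < s"
    "f (x + s *\<^sub>R h + s *\<^sub>R k) - f (x + s *\<^sub>R h) - f (x + s *\<^sub>R k) + f x = s\<^sup>2 * P (x + \<tau> *\<^sub>R h + \<sigma> *\<^sub>R k)"
    unfolding P_def by (rule second_difference[OF diff s sr])
  obtain \<tau>' \<sigma>' where 2: "0 < \<tau>'" "\<tau>' < s" "0 < \<sigma>'" "\<sigma>' < s"
    "f (x + s *\<^sub>R k + s *\<^sub>R h) - f (x + s *\<^sub>R k) - f (x + s *\<^sub>R h) + f x = s\<^sup>2 * Q (x + \<tau>' *\<^sub>R k + \<sigma>' *\<^sub>R h)"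
    unfolding Q_def by (rule second_difference[OF diff s sr'])
  have "s\<^sup>2 * P (x + \<tau> *\<^sub>R h + \<sigma> *\<^sub>R k) = s\<^sup>2 * Q (x + \<tau>' *\<^sub>R k + \<sigma>' *\<^sub>R h)"
    using 1(5) 2(5) add.commute[of "s *\<^sub>R h" "s *\<^sub>R k"] by (simp only: add.assoc)
  then have PQ: "P (x + \<tau> *\<^sub>R h + \<sigma> *\<^sub>R k) = Q (x + \<tau>' *\<^sub>R k + \<sigma>' *\<^sub>R h)"
    using s by simp
  have inb: "dist (x + a *\<^sub>R u + b *\<^sub>R w) x < r"
    if "0 < a" "a < s" "0 < b" "b < s" "s * (norm u + norm w) < r" for a b u w
  proof -
    have "norm (a *\<^sub>R u + b *\<^sub>R w) \<le> a * norm u + b * norm w"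
      using norm_triangle_ineq[of "a *\<^sub>R u" "b *\<^sub>R w"] that by simp
    also have "\<dots> \<le> s * norm u + s * norm w"
      using that by (intro add_mono mult_right_mono) auto
    also have "\<dots> < r" using that by (simp add: algebra_simps)
    finally show ?thesis by (simp add: dist_norm add.assoc)
  qed
  have "\<bar>P (x + \<tau> *\<^sub>R h + \<sigma> *\<^sub>R k) - P x\<bar> < e"
    using inb[OF 1(1-4) sr] by (intro d(2)) (simp add: r_def)
  moreover have "\<bar>Q (x + \<tau>' *\<^sub>R k + \<sigma>' *\<^sub>R h) - Q x\<bar> < e"
    using inb[OF 2(1-4) sr'] by (intro d(4)) (simp add: r_def)
  ultimately have "\<bar>P x - Q x\<bar> < 2 * e" using PQ by linarith
  then show False by (simp add: e_def)
qed

lemma frechet_derivative_linear: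
  assumes "bounded_linear L" "f differentiable (at x)"
  shows "frechet_derivative (\<lambda>x. L (f x)) (at x) h = L (frechet_derivative f (at x) h)"
  using frechet_derivative_at[OF bounded_linear.has_derivative[OF assms(1) frechet_derivative_works'[OF assms(2)]]]
  by metis

text \<open>The mean value theorem is a statement about real functions, so real and imaginary parts
  are treated separately.\<close>

lemma frechet_derivative_commute:
  fixes f :: "'a::real_normed_vector \<Rightarrow> complex"
  assumes "open S" "smooth_on S f" "x \<in> S"
  shows "frechet_derivative (\<lambda>z. frechet_derivative f (at z) h) (at x) k
       = frechet_derivative (\<lambda>z. frechet_derivative f (at z) k) (at x) h"
proof -
  have *: "frechet_derivative (\<lambda>z. frechet_derivative (\<lambda>x. L (f x)) (at z) h) (at x) k
       = L (frechet_derivative (\<lambda>z. frechet_derivative f (at z) h) (at x) k)"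
    if L: "bounded_linear L" for L :: "complex \<Rightarrow> real" and h k
  proof -
    have "frechet_derivative (\<lambda>z. L (frechet_derivative f (at z) h)) (at x)
        = frechet_derivative (\<lambda>z. frechet_derivative (\<lambda>x. L (f x)) (at z) h) (at x)"
    proof (rule frechet_derivative_transform_within_open[of _ x S])
      show "(\<lambda>z. L (frechet_derivative f (at z) h)) differentiable at x"
        by (rule smooth_on_differentiable[OF smooth_on_linear[OF assms(1) L smooth_on_frechet[OF assms(2)]] assms(3)])
      show "L (frechet_derivative f (at z) h) = frechet_derivative (\<lambda>x. L (f x)) (at z) h" if "z \<in> S" for z
        by (rule frechet_derivative_linear[OF L smooth_on_differentiable[OF assms(2) that], symmetric])
    qed (use assms in auto)
    then show ?thesis
      using frechet_derivative_linear[OF L smooth_on_differentiable[OF smooth_on_frechet[OF assms(2)] assms(3)]]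
      by metis
  qed
  have "L (frechet_derivative (\<lambda>z. frechet_derivative f (at z) h) (at x) k)
       = L (frechet_derivative (\<lambda>z. frechet_derivative f (at z) k) (at x) h)"
    if L: "bounded_linear L" for L :: "complex \<Rightarrow> real"
    unfolding *[OF L, symmetric]
    by (rule frechet_derivative_commute_real[OF assms(1) smooth_on_linear[OF assms(1) L assms(2)] assms(3)])
  from this[OF bounded_linear_Re] this[OF bounded_linear_Im] show ?thesis
    by (simp add: complex_eq_iff)
qed

section \<open>Wirtinger calculus\<close>

lemma vcnj_nth [simp]: "vcnj a $ i = cnj (a $ i)"
  by (simp add: vcnj_def)

lemma vcnj_vcnj [simp]: "vcnj (vcnj a) = a"
  by (simp add: vec_eq_iff)

lemma vcnj_add: "vcnj (a + b) = vcnj a + vcnj b"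
  by (simp add: vec_eq_iff)

lemma vcnj_zero [simp]: "vcnj 0 = 0"
  by (simp add: vec_eq_iff)

lemma linear_expand:
  fixes D :: "complex^'n \<Rightarrow> complex"
  assumes "linear D"
  shows "D v = (\<Sum>i\<in>UNIV. of_real (Re (v $ i)) * D (axis i 1) + of_real (Im (v $ i)) * D (axis i \<i>))"
proof -
  have "v = (\<Sum>i\<in>UNIV. Re (v $ i) *\<^sub>R axis i 1 + Im (v $ i) *\<^sub>R axis i \<i>)"
  proof (subst vec_eq_iff, rule allI)
    fix k
    have "(\<Sum>i\<in>UNIV. Re (v $ i) *\<^sub>R axis i 1 + Im (v $ i) *\<^sub>R axis i \<i>) $ k
        = (\<Sum>i\<in>UNIV. if i = k then v $ i else 0)"
      unfolding sum_component by (intro sum.cong) (auto simp: axis_def complex_eq_iff)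
    then show "v $ k = (\<Sum>i\<in>UNIV. Re (v $ i) *\<^sub>R axis i 1 + Im (v $ i) *\<^sub>R axis i \<i>) $ k"
      by simp
  qed
  then have "D v = D (\<Sum>i\<in>UNIV. Re (v $ i) *\<^sub>R axis i 1 + Im (v $ i) *\<^sub>R axis i \<i>)"
    by (rule arg_cong)
  also have "\<dots> = (\<Sum>i\<in>UNIV. of_real (Re (v $ i)) * D (axis i 1) + of_real (Im (v $ i)) * D (axis i \<i>))"
    unfolding linear_sum[OF assms] linear_add[OF assms] linear_cmul[OF assms] scaleR_conv_of_real[where 'a=complex] ..
  finally show ?thesis .
qed

lemma dderiv_add_vec: "dderiv f x (Y + Z) = dderiv f x Y + dderiv f x Z"
  by (simp add: dderiv_def algebra_simps sum.distrib)

lemma dderiv_scale_vec: "dderiv f x (a *s p, a *s q) = a * dderiv f x (p, q)"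
  by (simp add: dderiv_def algebra_simps sum_distrib_left)

lemma dderiv_zero_vec [simp]: "dderiv f x 0 = 0"
  by (simp add: dderiv_def)

text \<open>The pair \<open>(v, vcnj v)\<close> is the real tangent vector \<open>v\<close> seen in
  the complexification.\<close>

lemma frechet_derivative_dderiv:
  fixes f :: "complex^'n \<Rightarrow> complex"
  assumes "f differentiable (at x)"
  shows "frechet_derivative f (at x) v = dderiv f x (v, vcnj v)"
proof -
  have "of_real (Re z) * a + of_real (Im z) * b = z * ((a - \<i> * b) / 2) + cnj z * ((a + \<i> * b) / 2)"
    for z a b :: complex
    by (cases z, cases a, cases b) (simp add: complex_eq_iff field_simps)
  then show ?thesis
    unfolding dderiv_def wirt_def wirtb_def linear_expand[OF linear_frechet_derivative[OF assms], of v]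
    by simp
qed

definition cre :: "'n::finite cvec \<Rightarrow> complex^'n" where
  "cre Z = (\<chi> i. (fst Z $ i + cnj (snd Z $ i)) / 2)"

definition cim :: "'n::finite cvec \<Rightarrow> complex^'n" where
  "cim Z = (\<chi> i. (fst Z $ i - cnj (snd Z $ i)) / (2 * \<i>))"

text \<open>The complexified vector \<open>Z\<close> is \<open>r + \<i> s\<close> for the real vectors \<open>r = cre Z\<close> and \<open>s = cim Z\<close>.\<close>

lemma dderiv_frechet:
  fixes f :: "complex^'n \<Rightarrow> complex"
  assumes "f differentiable (at x)"
  shows "dderiv f x Z = frechet_derivative f (at x) (cre Z) + \<i> * frechet_derivative f (at x) (cim Z)"
proof -
  have "Z = (cre Z, vcnj (cre Z)) + (\<i> *s cim Z, \<i> *s vcnj (cim Z))"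
    by (cases Z) (simp add: cre_def cim_def vec_eq_iff complex_eq_iff field_simps)
  then have "dderiv f x Z = dderiv f x (cre Z, vcnj (cre Z)) + \<i> * dderiv f x (cim Z, vcnj (cim Z))"
    by (metis dderiv_add_vec dderiv_scale_vec)
  then show ?thesis by (simp only: frechet_derivative_dderiv[OF assms])
qed

lemma wirt_eq_dderiv: "wirt i f x = dderiv f x (axis i 1, 0)"
proof -
  have "fst (axis i (1::complex), 0 :: complex^'a) $ j * wirt j f x = (if j = i then wirt i f x else 0)" for j
    by (auto simp: axis_def)
  then show ?thesis by (simp add: dderiv_def)
qed

lemma wirtb_eq_dderiv: "wirtb i f x = dderiv f x (0, axis i 1)"
proof -
  have "snd (0 :: complex^'a, axis i (1::complex)) $ j * wirtb j f x = (if j = i then wirtb i f x else 0)" for j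
    by (auto simp: axis_def)
  then show ?thesis by (simp add: dderiv_def)
qed

lemma dderiv_add:
  fixes f g :: "complex^'n \<Rightarrow> complex"
  assumes "f differentiable (at x)" "g differentiable (at x)"
  shows "dderiv (\<lambda>y. f y + g y) x Z = dderiv f x Z + dderiv g x Z"
proof -
  have "frechet_derivative (\<lambda>y. f y + g y) (at x)
      = (\<lambda>h. frechet_derivative f (at x) h + frechet_derivative g (at x) h)"
    by (rule frechet_derivative_at[symmetric], rule has_derivative_add; rule frechet_derivative_works'; fact)
  then show ?thesis
    by (simp add: dderiv_frechet assms differentiable_add algebra_simps)
qed

lemma dderiv_mult:
  fixes f g :: "complex^'n \<Rightarrow> complex"
  assumes "f differentiable (at x)" "g differentiable (at x)"
  shows "dderiv (\<lambda>y. f y * g y) x Z = dderiv f x Z * g x + f x * dderiv g x Z"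
proof -
  have "frechet_derivative (\<lambda>y. f y * g y) (at x)
      = (\<lambda>h. f x * frechet_derivative g (at x) h + frechet_derivative f (at x) h * g x)"
    by (rule frechet_derivative_at[symmetric], rule has_derivative_mult; rule frechet_derivative_works'; fact)
  then show ?thesis
    by (simp add: dderiv_frechet assms differentiable_mult algebra_simps)
qed

lemma dderiv_const [simp]: "dderiv (\<lambda>y. c) x Z = 0"
  by (simp add: dderiv_def wirt_def wirtb_def)

lemma dderiv_cmult:
  fixes f :: "complex^'n \<Rightarrow> complex"
  assumes "f differentiable (at x)"
  shows "dderiv (\<lambda>y. c * f y) x Z = c * dderiv f x Z"
  using dderiv_mult[OF differentiable_const assms, of c Z] by simp

lemma differentiable_sum':
  assumes "\<And>i. i \<in> I \<Longrightarrow> f i differentiable (at x)"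
  shows "(\<lambda>y. \<Sum>i\<in>I. f i y) differentiable (at x)"
  using assms by (induction I rule: infinite_finite_induct) auto

lemma dderiv_sum:
  fixes f :: "'i \<Rightarrow> complex^'n \<Rightarrow> complex"
  assumes "\<And>i. i \<in> I \<Longrightarrow> f i differentiable (at x)"
  shows "dderiv (\<lambda>y. \<Sum>i\<in>I. f i y) x Z = (\<Sum>i\<in>I. dderiv (f i) x Z)"
  using assms
proof (induction I rule: infinite_finite_induct)
  case (insert i I)
  then show ?case
    by (simp add: dderiv_add differentiable_sum')
qed auto

lemma differentiable_cnj:
  "f differentiable (at x) \<Longrightarrow> (\<lambda>y. cnj (f y)) differentiable (at x)"
  unfolding differentiable_def using bounded_linear.has_derivative[OF bounded_linear_cnj] by blast

lemma dderiv_cnj: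
  fixes f :: "complex^'n \<Rightarrow> complex"
  assumes "f differentiable (at x)"
  shows "dderiv (\<lambda>y. cnj (f y)) x Z = cnj (dderiv f x (pcnj Z))"
proof -
  have "cre (pcnj Z) = cre Z" "cim (pcnj Z) = - cim Z"
    by (simp_all add: cre_def cim_def pcnj_def vec_eq_iff add.commute minus_divide_left[symmetric])
       (simp add: field_simps)?
  then show ?thesis
    by (simp add: dderiv_frechet differentiable_cnj assms frechet_derivative_linear[OF bounded_linear_cnj assms]
        linear_neg[OF linear_frechet_derivative[OF assms]])
qed

lemma dderiv_cong_open:
  assumes "open S" "x \<in> S" "\<And>y. y \<in> S \<Longrightarrow> f y = g y" "f differentiable (at x)"
  shows "dderiv f x Z = dderiv g x Z"
proof -
  have "frechet_derivative f (at x) = frechet_derivative g (at x)"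
    by (rule frechet_derivative_transform_within_open[OF assms(4,1,2,3)])
  then show ?thesis by (simp add: dderiv_def wirt_def wirtb_def)
qed

section \<open>Complexified differentials and the chain rule\<close>

lemma differentiable_nth:
  fixes h :: "'a::real_normed_vector \<Rightarrow> complex^'n"
  shows "h differentiable (at x) \<Longrightarrow> (\<lambda>y. h y $ i) differentiable (at x)"
  unfolding differentiable_def using bounded_linear.has_derivative[OF bounded_linear_vec_nth] by blast

text \<open>\<open>push\<close> is the complexification of the real differential, hence acts
  separately on the two real vectors that make up \<open>Z\<close>. The ordinary chain rule thereby
  extends to complexified vectors.\<close>

lemma push_frechet:
  fixes h :: "complex^'n \<Rightarrow> complex^'n"
  assumes "h differentiable (at x)"
  shows "cre (push h x Z) = frechet_derivative h (at x) (cre Z)"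
    and "cim (push h x Z) = frechet_derivative h (at x) (cim Z)"
proof -
  have d: "(\<lambda>y. h y $ i) differentiable (at x)" for i by (rule differentiable_nth[OF assms])
  have f: "frechet_derivative (\<lambda>y. h y $ i) (at x) u = frechet_derivative h (at x) u $ i" for i u
    by (rule frechet_derivative_linear[OF bounded_linear_vec_nth assms])
  have fst: "fst (push h x Z) $ i = frechet_derivative h (at x) (cre Z) $ i + \<i> * frechet_derivative h (at x) (cim Z) $ i" for i
    by (simp add: push_def dderiv_frechet[OF d] f)
  have snd: "snd (push h x Z) $ i = cnj (frechet_derivative h (at x) (cre Z) $ i) + \<i> * cnj (frechet_derivative h (at x) (cim Z) $ i)" for i
    by (simp add: push_def dderiv_frechet[OF differentiable_cnj[OF d]] frechet_derivative_linear[OF bounded_linear_cnj d] f)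
  show "cre (push h x Z) = frechet_derivative h (at x) (cre Z)"
    unfolding cre_def[of "push h x Z"] by (simp add: fst snd vec_eq_iff)
  show "cim (push h x Z) = frechet_derivative h (at x) (cim Z)"
    unfolding cim_def[of "push h x Z"] by (simp add: fst snd vec_eq_iff)
qed

lemma dderiv_compose:
  fixes f :: "complex^'n \<Rightarrow> complex" and h :: "complex^'n \<Rightarrow> complex^'n"
  assumes h: "h differentiable (at x)" and f: "f differentiable (at (h x))"
  shows "dderiv (\<lambda>y. f (h y)) x Z = dderiv f (h x) (push h x Z)"
proof -
  have d: "((\<lambda>y. f (h y)) has_derivative (\<lambda>u. frechet_derivative f (at (h x)) (frechet_derivative h (at x) u))) (at x)"
    using diff_chain_at[OF frechet_derivative_works'[OF h] frechet_derivative_works'[OF f]]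
    by (simp add: o_def)
  then have "(\<lambda>y. f (h y)) differentiable (at x)" by (rule differentiableI)
  then show ?thesis
    unfolding dderiv_frechet[OF f] push_frechet[OF h]
    by (simp only: dderiv_frechet frechet_derivative_at[OF d, symmetric])
qed

lemma push_compose:
  fixes h k :: "complex^'n \<Rightarrow> complex^'n"
  assumes k: "k differentiable (at x)" and h: "h differentiable (at (k x))"
  shows "push (\<lambda>y. h (k y)) x Z = push h (k x) (push k x Z)"
  unfolding push_def[of "\<lambda>y. h (k y)"] push_def[of h]
  using dderiv_compose[OF k differentiable_nth[OF h]]
    dderiv_compose[OF k differentiable_cnj[OF differentiable_nth[OF h]]]
  by simp

lemma push_add: "push h x (Y + Z) = push h x Y + push h x Z"
  by (simp add: push_def dderiv_add_vec vec_eq_iff)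

lemma push_scale: "push h x (a *s p, a *s q) = (a *s fst (push h x (p, q)), a *s snd (push h x (p, q)))"
  by (simp add: push_def dderiv_scale_vec vec_eq_iff)

lemma push_zero [simp]: "push h x 0 = 0"
  by (simp add: push_def vec_eq_iff zero_prod_def[symmetric]) (simp add: zero_prod_def vec_eq_iff)

lemma push_pcnj:
  fixes h :: "complex^'n \<Rightarrow> complex^'n"
  assumes "h differentiable (at x)"
  shows "push h x (pcnj Z) = pcnj (push h x Z)"
proof -
  have d: "(\<lambda>y. h y $ i) differentiable (at x)" for i by (rule differentiable_nth[OF assms])
  have "pcnj (pcnj Z) = Z" by (simp add: pcnj_def)
  then show ?thesis
    unfolding push_def dderiv_cnj[OF d]
    by (simp add: pcnj_def[of "(_, _)"] vec_eq_iff)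
qed

lemma push_cong_open:
  assumes "open S" "x \<in> S" "\<And>y. y \<in> S \<Longrightarrow> f y = g y" "f differentiable (at x)"
  shows "push f x Z = push g x Z"
proof -
  have "dderiv (\<lambda>y. f y $ i) x Z = dderiv (\<lambda>y. g y $ i) x Z" for i
    by (rule dderiv_cong_open[OF assms(1,2) _ differentiable_nth[OF assms(4)]]) (simp add: assms(3))
  moreover have "dderiv (\<lambda>y. cnj (f y $ i)) x Z = dderiv (\<lambda>y. cnj (g y $ i)) x Z" for i
    by (rule dderiv_cong_open[OF assms(1,2) _ differentiable_cnj[OF differentiable_nth[OF assms(4)]]])
       (simp add: assms(3))
  ultimately show ?thesis by (simp add: push_def)
qed

lemma dderiv_nth: "dderiv (\<lambda>x. x $ k) x Z = fst Z $ k"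
proof -
  have d: "(\<lambda>x. x $ k) differentiable (at x)" by (rule differentiable_nth) simp
  have "frechet_derivative (\<lambda>x. x $ k) (at x) u = u $ k" for u :: "complex^'a"
    using frechet_derivative_linear[OF bounded_linear_vec_nth, of "\<lambda>x. x"] by simp
  then show ?thesis by (simp add: dderiv_frechet[OF d] cre_def cim_def field_simps)
qed

section \<open>Wirtinger derivatives: smoothness, symmetry, linear substitutions\<close>

lemma smooth_on_wirt:
  assumes "open S" "smooth_on S f"
  shows "smooth_on S (wirt i f)" "smooth_on S (wirtb i f)"
proof -
  have w: "wirt i f = (\<lambda>x. 1/2 * frechet_derivative f (at x) (axis i 1) + (- \<i>/2) * frechet_derivative f (at x) (axis i \<i>))"
    "wirtb i f = (\<lambda>x. 1/2 * frechet_derivative f (at x) (axis i 1) + (\<i>/2) * frechet_derivative f (at x) (axis i \<i>))"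
    by (simp_all add: fun_eq_iff wirt_def wirtb_def field_simps)
  note d = smooth_on_cmult[OF assms(1) smooth_on_frechet[OF assms(2)]]
  show "smooth_on S (wirt i f)" "smooth_on S (wirtb i f)"
    unfolding w by (rule smooth_on_add[OF assms(1) d d])+
qed

lemma frechet_derivative_combination:
  fixes f :: "complex^'n \<Rightarrow> complex"
  assumes "open S" "smooth_on S f" "x \<in> S"
  shows "frechet_derivative (\<lambda>y. \<alpha> * frechet_derivative f (at y) a + \<beta> * frechet_derivative f (at y) b) (at x) h
    = \<alpha> * frechet_derivative (\<lambda>y. frechet_derivative f (at y) a) (at x) h
    + \<beta> * frechet_derivative (\<lambda>y. frechet_derivative f (at y) b) (at x) h"
proof -
  have d: "((\<lambda>y. frechet_derivative f (at y) a) has_derivative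
      frechet_derivative (\<lambda>y. frechet_derivative f (at y) a) (at x)) (at x)" for a
    by (rule frechet_derivative_works'[OF smooth_on_differentiable[OF smooth_on_frechet[OF assms(2)] assms(3)]])
  show ?thesis
    unfolding frechet_derivative_at[OF has_derivative_add[OF has_derivative_mult_right[OF d] has_derivative_mult_right[OF d]],
        symmetric] ..
qed

text \<open>Wirtinger derivatives are combinations of real partial derivatives with constant
  coefficients, so the symmetry of the real Hessian \<open>H\<close> settles all three
  cases.\<close>

lemma wirt_commute:
  fixes f :: "complex^'n \<Rightarrow> complex"
  assumes "open S" "smooth_on S f" "x \<in> S"
  shows "wirt i (wirt j f) x = wirt j (wirt i f) x"
    and "wirt i (wirtb j f) x = wirtb j (wirt i f) x"
    and "wirtb i (wirtb j f) x = wirtb j (wirtb i f) x"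
proof -
  have w: "wirt i f = (\<lambda>x. (1/2) * frechet_derivative f (at x) (axis i 1) + (- \<i>/2) * frechet_derivative f (at x) (axis i \<i>))"
    "wirtb i f = (\<lambda>x. (1/2) * frechet_derivative f (at x) (axis i 1) + (\<i>/2) * frechet_derivative f (at x) (axis i \<i>))" for i
    by (simp_all add: fun_eq_iff wirt_def wirtb_def field_simps)
  define H where "H a b = frechet_derivative (\<lambda>y. frechet_derivative f (at y) a) (at x) b" for a b
  have H: "H a b = H b a" for a b unfolding H_def by (rule frechet_derivative_commute[OF assms])
  have e: "frechet_derivative (wirt j f) (at x) h = (1/2) * H (axis j 1) h + (- \<i>/2) * H (axis j \<i>) h"
    "frechet_derivative (wirtb j f) (at x) h = (1/2) * H (axis j 1) h + (\<i>/2) * H (axis j \<i>) h" for j h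
    unfolding w H_def by (rule frechet_derivative_combination[OF assms])+
  note Hs = H[of "axis j 1" "axis i 1"] H[of "axis j \<i>" "axis i 1"] H[of "axis j 1" "axis i \<i>"] H[of "axis j \<i>" "axis i \<i>"]
  show "wirt i (wirt j f) x = wirt j (wirt i f) x"
    unfolding wirt_def[of _ "wirt _ f"] e Hs by (simp add: field_simps)
  show "wirt i (wirtb j f) x = wirtb j (wirt i f) x"
    unfolding wirt_def[of _ "wirtb _ f"] wirtb_def[of _ "wirt _ f"] e Hs by (simp add: field_simps)
  show "wirtb i (wirtb j f) x = wirtb j (wirtb i f) x"
    unfolding wirtb_def[of _ "wirtb _ f"] e Hs by (simp add: field_simps)
qed

lemma wirt_cong_open:
  assumes "open S" "x \<in> S" "\<And>y. y \<in> S \<Longrightarrow> f y = g y" "f differentiable (at x)"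
  shows "wirt i f x = wirt i g x" "wirtb i f x = wirtb i g x"
  unfolding wirt_eq_dderiv wirtb_eq_dderiv by (rule dderiv_cong_open[OF assms], assumption)+

lemma wirt_cnj:
  assumes "f differentiable (at x)"
  shows "wirt i (\<lambda>y. cnj (f y)) x = cnj (wirtb i f x)" "wirtb i (\<lambda>y. cnj (f y)) x = cnj (wirt i f x)"
proof -
  have "vcnj (axis i 1) = axis i 1" by (auto simp: vec_eq_iff axis_def)
  then show "wirt i (\<lambda>y. cnj (f y)) x = cnj (wirtb i f x)" "wirtb i (\<lambda>y. cnj (f y)) x = cnj (wirt i f x)"
    unfolding wirt_eq_dderiv wirtb_eq_dderiv dderiv_cnj[OF assms] by (simp_all add: pcnj_def)
qed

lemma bounded_linear_matrix_vector: "bounded_linear ((*v) (M :: complex^'n^'m))"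
  by (rule linear_conv_bounded_linear[THEN iffD1]) (auto intro!: linearI simp: matrix_vector_right_distrib vec_eq_iff matrix_vector_mult_def scaleR_sum_right)

text \<open>A complex linear map preserves types, so the two kinds of derivative do not mix; barred
  derivatives pick up the conjugate matrix.\<close>

lemma wirt_matrix:
  fixes f :: "complex^'n \<Rightarrow> complex" and M :: "complex^'n^'n"
  assumes "f differentiable (at (M *v x))"
  shows "wirt i (\<lambda>y. f (M *v y)) x = (\<Sum>k\<in>UNIV. M $ k $ i * wirt k f (M *v x))"
    and "wirtb i (\<lambda>y. f (M *v y)) x = (\<Sum>k\<in>UNIV. cnj (M $ k $ i) * wirtb k f (M *v x))"
proof -
  have d: "((*v) M) differentiable (at x)"
    by (rule bounded_linear_imp_differentiable[OF bounded_linear_matrix_vector])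
  have n: "(\<lambda>y. y $ k) differentiable (at x)" for k and x :: "complex^'n" by (rule differentiable_nth) simp
  have c: "dderiv (\<lambda>y. (M *v y) $ k) x Z = (M *v fst Z) $ k" for k Z
    unfolding matrix_vector_mult_def
    by (simp add: dderiv_sum n dderiv_cmult dderiv_nth)
  have p: "push ((*v) M) x Z = (M *v fst Z, vcnj (M *v vcnj (snd Z)))" for Z
    by (simp add: push_def c dderiv_cnj[OF differentiable_nth[OF d]] vec_eq_iff pcnj_def)
  have c2: "dderiv (\<lambda>y. f (M *v y)) x Z = dderiv f (M *v x) (M *v fst Z, vcnj (M *v vcnj (snd Z)))" for Z
    by (simp only: dderiv_compose[OF d assms] p)
  have a: "vcnj (axis i 1) = axis i 1" by (auto simp: vec_eq_iff axis_def)
  have m: "(M *v axis i 1) $ k = M $ k $ i" for k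
    by (simp add: matrix_vector_mult_def axis_def if_distrib cong: if_cong)
  show "wirt i (\<lambda>y. f (M *v y)) x = (\<Sum>k\<in>UNIV. M $ k $ i * wirt k f (M *v x))"
    unfolding wirt_eq_dderiv[of i "\<lambda>y. f (M *v y)"] c2 by (simp add: dderiv_def m)
  show "wirtb i (\<lambda>y. f (M *v y)) x = (\<Sum>k\<in>UNIV. cnj (M $ k $ i) * wirtb k f (M *v x))"
    unfolding wirtb_eq_dderiv[of i "\<lambda>y. f (M *v y)"] c2 by (simp add: dderiv_def m a)
qed

section \<open>The fundamental tensors on a fibre\<close>

text \<open>For \<open>f\<close> = F^2 on one fibre, these four functions are g_v, S_v, C^+_v and
  C^-_v. They are kept as forms on vectors so that a change of frame becomes a substitution.
  \<open>levi\<close> is antilinear in its second vector, \<open>cart\<close> in the middle one,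
  \<open>cartb\<close> in the last two.\<close>

definition levi :: "(complex^'n \<Rightarrow> complex) \<Rightarrow> complex^'n \<Rightarrow> complex^'n \<Rightarrow> complex^'n::finite \<Rightarrow> complex" where
  "levi f v x y = (\<Sum>i\<in>UNIV. \<Sum>j\<in>UNIV. wirt i (wirtb j f) v * x $ i * cnj (y $ j))"

definition hess :: "(complex^'n \<Rightarrow> complex) \<Rightarrow> complex^'n \<Rightarrow> complex^'n \<Rightarrow> complex^'n::finite \<Rightarrow> complex" where
  "hess f v x y = (\<Sum>i\<in>UNIV. \<Sum>j\<in>UNIV. wirt i (wirt j f) v * x $ i * y $ j)"

definition cart ::
  "(complex^'n \<Rightarrow> complex) \<Rightarrow> complex^'n \<Rightarrow> complex^'n \<Rightarrow> complex^'n \<Rightarrow> complex^'n::finite \<Rightarrow> complex" where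
  "cart f v w u x = (\<Sum>i\<in>UNIV. \<Sum>j\<in>UNIV. \<Sum>l\<in>UNIV.
     wirt i (wirtb j (wirt l f)) v * w $ i * cnj (u $ j) * x $ l)"

definition cartb ::
  "(complex^'n \<Rightarrow> complex) \<Rightarrow> complex^'n \<Rightarrow> complex^'n \<Rightarrow> complex^'n \<Rightarrow> complex^'n::finite \<Rightarrow> complex" where
  "cartb f v w u x = (\<Sum>i\<in>UNIV. \<Sum>j\<in>UNIV. \<Sum>l\<in>UNIV.
     wirt i (wirtb j (wirtb l f)) v * w $ i * cnj (u $ j) * cnj (x $ l))"

lemma levi_add1: "levi f v (x + x') y = levi f v x y + levi f v x' y"
  and levi_add2: "levi f v x (y + y') = levi f v x y + levi f v x y'"
  and levi_scale1: "levi f v (a *s x) y = a * levi f v x y"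
  and levi_scale2: "levi f v x (a *s y) = cnj a * levi f v x y"
  by (simp_all add: levi_def algebra_simps sum.distrib sum_distrib_left)

lemma levi_minus1: "levi f v (- x) y = - levi f v x y"
  and levi_minus2: "levi f v x (- y) = - levi f v x y"
  using levi_scale1[of f v "-1" x y] levi_scale2[of f v x "-1" y] by simp_all

lemma levi_diff1: "levi f v (x - x') y = levi f v x y - levi f v x' y"
  and levi_diff2: "levi f v x (y - y') = levi f v x y - levi f v x y'"
  using levi_add1[of f v x "- x'" y] levi_add2[of f v x y "- y'"] by (simp_all add: levi_minus1 levi_minus2)

lemma cart_add3: "cart f v w u (x + x') = cart f v w u x + cart f v w u x'"
  and cart_scale3: "cart f v w u (a *s x) = a * cart f v w u x"
  and cartb_add3: "cartb f v w u (x + x') = cartb f v w u x + cartb f v w u x'"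
  and cartb_scale3: "cartb f v w u (a *s x) = cnj a * cartb f v w u x"
  by (simp_all add: cart_def cartb_def algebra_simps sum.distrib sum_distrib_left)

lemma cart_add1: "cart f v (x + x') u y = cart f v x u y + cart f v x' u y"
  and cart_scale1: "cart f v (a *s x) u y = a * cart f v x u y"
  and cart_add2: "cart f v x (u + u') y = cart f v x u y + cart f v x u' y"
  and cart_scale2: "cart f v x (a *s u) y = cnj a * cart f v x u y"
  and cartb_add1: "cartb f v (x + x') u y = cartb f v x u y + cartb f v x' u y"
  and cartb_scale1: "cartb f v (a *s x) u y = a * cartb f v x u y"
  and cartb_add2: "cartb f v x (u + u') y = cartb f v x u y + cartb f v x u' y"
  and cartb_scale2: "cartb f v x (a *s u) y = cnj a * cartb f v x u y"
  by (simp_all add: cart_def cartb_def algebra_simps sum.distrib sum_distrib_left)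

lemma cart_diff3: "cart f v w u (x - x') = cart f v w u x - cart f v w u x'"
  and cartb_diff3: "cartb f v w u (x - x') = cartb f v w u x - cartb f v w u x'"
  using cart_add3[of f v w u "x - x'" x'] cartb_add3[of f v w u "x - x'" x'] by simp_all

lemma hess_add1: "hess f v (x + x') y = hess f v x y + hess f v x' y"
  and hess_add2: "hess f v x (y + y') = hess f v x y + hess f v x y'"
  and hess_scale1: "hess f v (a *s x) y = a * hess f v x y"
  and hess_scale2: "hess f v x (a *s y) = a * hess f v x y"
  by (simp_all add: hess_def algebra_simps sum.distrib sum_distrib_left)

section \<open>Linear and antilinear functionals in the standard basis\<close>

lemma axis_sum:
  fixes h :: "'n::finite \<Rightarrow> complex"
  shows "(\<Sum>k\<in>UNIV. h k * axis i 1 $ k) = h i" "(\<Sum>k\<in>UNIV. axis i 1 $ k * h k) = h i"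
proof -
  have "h k * axis i 1 $ k = (if k = i then h k else 0)" "axis i 1 $ k * h k = (if k = i then h k else 0)" for k
    by (simp_all add: axis_def)
  then show "(\<Sum>k\<in>UNIV. h k * axis i 1 $ k) = h i" "(\<Sum>k\<in>UNIV. axis i 1 $ k * h k) = h i"
    by simp_all
qed

lemma cnj_axis: "cnj (axis i 1 $ k) = axis i 1 $ k"
  by (simp add: axis_def)

lemma linear_basis:
  fixes L :: "complex^'n \<Rightarrow> complex^'m"
  assumes "\<And>x y. L (x + y) = L x + L y" "\<And>a x. L (a *s x) = a *s L x"
  shows "L x = (\<Sum>i\<in>UNIV. x $ i *s L (axis i 1))"
proof -
  have z: "L 0 = 0" using assms(2)[of 0 0] by simp
  have L: "L (\<Sum>i\<in>I. h i) = (\<Sum>i\<in>I. L (h i))" if "finite I" for h :: "'n \<Rightarrow> complex^'n" and I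
    using that by (induction I rule: finite_induct) (auto simp: assms(1) z)
  have "L x = L (\<Sum>i\<in>UNIV. x $ i *s axis i 1)" by (simp only: basis_expansion)
  then show ?thesis by (simp only: L finite assms(2))
qed

lemma functional_basis:
  fixes L :: "complex^'n \<Rightarrow> complex"
  assumes "\<And>x y. L (x + y) = L x + L y" "\<And>a x. L (a *s x) = a * L x"
  shows "L x = (\<Sum>i\<in>UNIV. x $ i * L (axis i 1))"
proof -
  have z: "L 0 = 0" using assms(2)[of 0 0] by simp
  have L: "L (\<Sum>i\<in>I. h i) = (\<Sum>i\<in>I. L (h i))" if "finite I" for h :: "'n \<Rightarrow> complex^'n" and I
    using that by (induction I rule: finite_induct) (auto simp: assms(1) z)
  have "L x = L (\<Sum>i\<in>UNIV. x $ i *s axis i 1)" by (simp only: basis_expansion)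
  then show ?thesis by (simp only: L finite assms(2))
qed

lemma antifunctional_basis:
  fixes L :: "complex^'n \<Rightarrow> complex"
  assumes "\<And>x y. L (x + y) = L x + L y" "\<And>a x. L (a *s x) = cnj a * L x"
  shows "L x = (\<Sum>i\<in>UNIV. cnj (x $ i) * L (axis i 1))"
proof -
  have v: "vcnj (axis i 1) = axis i 1" for i :: 'n by (auto simp: vec_eq_iff axis_def)
  have s: "vcnj (a *s x) = cnj a *s vcnj x" for a and x :: "complex^'n" by (simp add: vec_eq_iff)
  from functional_basis[of "\<lambda>x. L (vcnj x)" "vcnj x"] show ?thesis
    by (simp add: vcnj_add assms v s)
qed

lemma differentiable_functional:
  fixes L :: "complex^'n \<Rightarrow> complex"
  assumes "\<And>x y. L (x + y) = L x + L y" "\<And>a x. L (a *s x) = a * L x"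
  shows "L differentiable (at v)"
proof -
  have "(\<lambda>x. \<Sum>i\<in>UNIV. x $ i * L (axis i 1)) differentiable (at v)"
    by (intro differentiable_sum' differentiable_mult differentiable_nth differentiable_const) simp
  moreover have "(\<lambda>x. \<Sum>i\<in>UNIV. x $ i * L (axis i 1)) = L"
    by (rule ext) (rule functional_basis[of L, OF assms, symmetric])
  ultimately show ?thesis by (simp only:)
qed

lemma dderiv_functional:
  fixes L :: "complex^'n \<Rightarrow> complex"
  assumes "\<And>x y. L (x + y) = L x + L y" "\<And>a x. L (a *s x) = a * L x"
  shows "dderiv L v Z = L (fst Z)"
proof -
  have n: "(\<lambda>x. x $ k) differentiable (at v)" for k by (rule differentiable_nth) simp
  have b: "(\<Sum>i\<in>UNIV. L (axis i 1) * x $ i) = L x" for x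
    unfolding functional_basis[of L x, OF assms] by (simp only: mult.commute)
  have "dderiv (\<lambda>x. \<Sum>i\<in>UNIV. L (axis i 1) * x $ i) v Z = (\<Sum>i\<in>UNIV. L (axis i 1) * fst Z $ i)"
    by (simp add: dderiv_sum dderiv_cmult n dderiv_nth)
  then show ?thesis by (simp only: b)
qed

lemma dderiv_cmult_right:
  fixes f :: "complex^'n \<Rightarrow> complex"
  assumes "f differentiable (at x)"
  shows "dderiv (\<lambda>y. f y * c) x Z = dderiv f x Z * c"
  using dderiv_mult[OF assms differentiable_const, of c Z] by simp

text \<open>Translates the contractions over \<open>l\<close> in the metric equation of the
  connection into values of the forms on basis vectors.\<close>

lemma index_sums:
  "(\<Sum>l\<in>UNIV. wirt l (wirtb j f) v * y $ l) = levi f v y (axis j 1)"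
  "(\<Sum>l\<in>UNIV. wirt i (wirtb l f) v * cnj (y $ l)) = levi f v (axis i 1) y"
  "(\<Sum>l\<in>UNIV. wirt i (wirtb j (wirt l f)) v * y $ l) = cart f v (axis i 1) (axis j 1) y"
  "(\<Sum>l\<in>UNIV. wirt i (wirtb j (wirtb l f)) v * cnj (y $ l)) = cartb f v (axis i 1) (axis j 1) y"
proof -
  have a: "(\<Sum>k\<in>UNIV. \<Sum>l\<in>UNIV. h k l * axis i 1 $ k * z l) = (\<Sum>l\<in>UNIV. h i l * z l)"
    for h :: "'a \<Rightarrow> 'a \<Rightarrow> complex" and i z
    by (subst sum.swap) (simp only: sum_distrib_right[symmetric] axis_sum)
  have b: "(\<Sum>k\<in>UNIV. \<Sum>m\<in>UNIV. \<Sum>l\<in>UNIV. h k m l * axis i 1 $ k * axis j 1 $ m * z l) = (\<Sum>l\<in>UNIV. h i j l * z l)"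
    for h :: "'a \<Rightarrow> 'a \<Rightarrow> 'a \<Rightarrow> complex" and i j z
  proof -
    have "(\<Sum>k\<in>UNIV. \<Sum>m\<in>UNIV. \<Sum>l\<in>UNIV. h k m l * axis i 1 $ k * axis j 1 $ m * z l)
        = (\<Sum>k\<in>UNIV. (\<Sum>m\<in>UNIV. (\<Sum>l\<in>UNIV. h k m l * z l) * axis j 1 $ m) * axis i 1 $ k)"
      by (simp add: sum_distrib_left sum_distrib_right mult_ac)
    then show ?thesis by (simp only: axis_sum)
  qed
  show "(\<Sum>l\<in>UNIV. wirt l (wirtb j f) v * y $ l) = levi f v y (axis j 1)"
    unfolding levi_def cnj_axis axis_sum ..
  show "(\<Sum>l\<in>UNIV. wirt i (wirtb l f) v * cnj (y $ l)) = levi f v (axis i 1) y"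
    unfolding levi_def a ..
  show "(\<Sum>l\<in>UNIV. wirt i (wirtb j (wirt l f)) v * y $ l) = cart f v (axis i 1) (axis j 1) y"
    unfolding cart_def cnj_axis b ..
  show "(\<Sum>l\<in>UNIV. wirt i (wirtb j (wirtb l f)) v * cnj (y $ l)) = cartb f v (axis i 1) (axis j 1) y"
    unfolding cartb_def cnj_axis b ..
qed

lemma differentiable_vec:
  fixes y :: "complex^'n \<Rightarrow> complex^'n"
  assumes "\<And>k. (\<lambda>x. y x $ k) differentiable (at x)"
  shows "y differentiable (at x)"
proof -
  have bl: "bounded_linear (\<lambda>z :: complex. z *s (axis k 1 :: complex^'n))" for k
    by (rule linear_conv_bounded_linear[THEN iffD1], rule linearI)
       (simp_all add: vec_eq_iff algebra_simps)
  have "(\<lambda>x. \<Sum>k\<in>UNIV. y x $ k *s axis k 1) differentiable (at x)"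
  proof (rule differentiable_sum')
    fix k
    have "((\<lambda>x. y x $ k *s axis k 1) has_derivative
        (\<lambda>h. frechet_derivative (\<lambda>x. y x $ k) (at x) h *s axis k 1)) (at x)"
      by (rule bounded_linear.has_derivative[OF bl frechet_derivative_works'[OF assms]])
    then show "(\<lambda>x. y x $ k *s axis k 1) differentiable (at x)" by (rule differentiableI)
  qed
  then show ?thesis by (simp only: basis_expansion)
qed

lemma open_nonzero: "open (- {0 :: complex^'n})"
  by (simp add: open_Compl)

lemma smooth_on_ident: "smooth_on S (\<lambda>x. x)"
proof -
  have "Ck_on k S (\<lambda>x. x)" for k
    by (cases k) (simp_all add: Ck_on_const)
  then show ?thesis by (simp add: smooth_on_def)
qed

lemma smooth_on_functional:
  fixes L :: "complex^'n \<Rightarrow> complex"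
  assumes "\<And>x y. L (x + y) = L x + L y" "\<And>a x. L (a *s x) = a * L x"
  shows "smooth_on (- {0}) L"
proof (rule smooth_on_cong[OF open_nonzero])
  have n: "smooth_on (- {0}) (\<lambda>x :: complex^'n. x $ i)" for i
    by (rule smooth_on_linear[OF open_nonzero bounded_linear_vec_nth smooth_on_ident])
  show "smooth_on (- {0}) (\<lambda>x. \<Sum>i\<in>UNIV. L (axis i 1) * x $ i)"
    by (intro smooth_on_sum smooth_on_cmult n open_nonzero) simp
  show "(\<Sum>i\<in>UNIV. L (axis i 1) * x $ i) = L x" for x
    unfolding functional_basis[of L x, OF assms] by (simp only: mult.commute)
qed

text \<open>Homogeneity is added only later, so that these results also apply to F^2 in a coordinate
  frame, from which regularity and positivity are transferred.\<close>

locale smooth_fibre =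
  fixes f :: "complex^'n::finite \<Rightarrow> complex"
  assumes smooth: "smooth_on (- {0}) f" and real: "cnj (f v) = f v"
begin

lemmas smooth_w = smooth_on_wirt[OF open_nonzero]

lemma differentiable_w:
  assumes "v \<noteq> 0"
  shows "f differentiable (at v)" "wirt i f differentiable (at v)" "wirtb i f differentiable (at v)"
    "wirt i (wirtb j f) differentiable (at v)" "wirt i (wirt j f) differentiable (at v)"
    "wirtb i (wirtb j f) differentiable (at v)"
  by (rule smooth_on_differentiable[of "- {0}"], (intro smooth smooth_w)?, simp add: assms)+

lemma wirt_commute1:
  assumes "v \<noteq> 0"
  shows "wirt i (wirt j f) v = wirt j (wirt i f) v" "wirt i (wirtb j f) v = wirtb j (wirt i f) v"
    "wirtb i (wirtb j f) v = wirtb j (wirtb i f) v"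
  by (rule wirt_commute[OF open_nonzero smooth]; use assms in simp)+

text \<open>The inner derivatives commute only off zero, so they are exchanged as functions on the
  open set of nonzero vectors before the outer derivative is taken.\<close>

lemma wirt_commute2:
  assumes "v \<noteq> 0"
  shows "wirt l (wirt i (wirtb j f)) v = wirt i (wirtb j (wirt l f)) v"
    and "wirtb l (wirt i (wirtb j f)) v = wirt i (wirtb j (wirtb l f)) v"
proof -
  have m: "v \<in> - {0}" using assms by simp
  have "wirt l (wirt i (wirtb j f)) v = wirt i (wirt l (wirtb j f)) v"
    by (rule wirt_commute[OF open_nonzero smooth_w(2)[OF smooth] m])
  also have "\<dots> = wirt i (wirtb j (wirt l f)) v"
    by (rule wirt_cong_open[OF open_nonzero m])
       (use wirt_commute1 assms differentiable_w in auto)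
  finally show "wirt l (wirt i (wirtb j f)) v = wirt i (wirtb j (wirt l f)) v" .
  have "wirtb l (wirt i (wirtb j f)) v = wirt i (wirtb l (wirtb j f)) v"
    by (rule wirt_commute(2)[OF open_nonzero smooth_w(2)[OF smooth] m, symmetric])
  also have "\<dots> = wirt i (wirtb j (wirtb l f)) v"
    by (rule wirt_cong_open[OF open_nonzero m])
       (use wirt_commute1 assms differentiable_w in auto)
  finally show "wirtb l (wirt i (wirtb j f)) v = wirt i (wirtb j (wirtb l f)) v" .
qed

lemma cart_index_sym:
  assumes "v \<noteq> 0"
  shows "wirt i (wirtb j (wirt l f)) v = wirt l (wirtb j (wirt i f)) v"
proof -
  have m: "v \<in> - {0}" using assms by simp
  have "wirt i (wirtb j (wirt l f)) v = wirt l (wirt i (wirtb j f)) v"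
    by (rule wirt_commute2(1)[OF assms, symmetric])
  also have "\<dots> = wirt l (wirtb j (wirt i f)) v"
    by (rule wirt_cong_open[OF open_nonzero m])
       (use wirt_commute1 assms differentiable_w in auto)
  finally show ?thesis .
qed

lemma cnj_w:
  assumes "v \<noteq> 0"
  shows "cnj (wirt i f v) = wirtb i f v" "cnj (wirtb i f v) = wirt i f v"
  using wirt_cnj[OF differentiable_w(1)[OF assms], of i] real by simp_all

lemma cnj_ww:
  assumes "v \<noteq> 0"
  shows "cnj (wirt i (wirtb j f) v) = wirt j (wirtb i f) v"
    "cnj (wirt i (wirt j f) v) = wirtb i (wirtb j f) v"
proof -
  have m: "v \<in> - {0}" using assms by simp
  have "wirtb i (\<lambda>v. cnj (wirtb j f v)) v = wirtb i (wirt j f) v"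
    "wirtb i (\<lambda>v. cnj (wirt j f v)) v = wirtb i (wirtb j f) v"
    by (rule wirt_cong_open(2)[OF open_nonzero m], simp add: cnj_w, rule differentiable_cnj, rule differentiable_w[OF assms])+
  then show "cnj (wirt i (wirtb j f) v) = wirt j (wirtb i f) v"
    "cnj (wirt i (wirt j f) v) = wirtb i (wirtb j f) v"
    using wirt_cnj(2)[OF differentiable_w(3)[OF assms], of i] wirt_cnj(2)[OF differentiable_w(2)[OF assms], of i]
      wirt_commute1(2)[OF assms]
    by simp_all
qed

lemma cnj_www:
  assumes "v \<noteq> 0"
  shows "cnj (wirt i (wirtb j (wirt l f)) v) = wirt j (wirtb i (wirtb l f)) v"
proof -
  have m: "v \<in> - {0}" using assms by simp
  have "cnj (wirt l (wirt i (wirtb j f)) v) = wirtb l (\<lambda>v. cnj (wirt i (wirtb j f) v)) v"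
    by (rule wirt_cnj(2)[OF differentiable_w(4)[OF assms], symmetric])
  also have "\<dots> = wirtb l (wirt j (wirtb i f)) v"
    by (rule wirt_cong_open(2)[OF open_nonzero m], simp add: cnj_ww, rule differentiable_cnj, rule differentiable_w[OF assms])
  finally show ?thesis by (simp only: wirt_commute2[OF assms])
qed

lemma levi_cnj: "v \<noteq> 0 \<Longrightarrow> cnj (levi f v x y) = levi f v y x"
  unfolding levi_def cnj_sum complex_cnj_mult complex_cnj_cnj cnj_ww(1)
  by (subst sum.swap) (simp add: mult_ac)

text \<open>As \<open>f\<close> is real, conjugation exchanges barred and unbarred derivatives; C^+
  and C^- are thus conjugate with their first two arguments swapped.\<close>

lemma cart_cnj: "v \<noteq> 0 \<Longrightarrow> cnj (cart f v w u x) = cartb f v u w x"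
  unfolding cart_def cartb_def cnj_sum complex_cnj_mult complex_cnj_cnj cnj_www
  by (subst sum.swap) (simp add: mult_ac)

text \<open>The two unbarred indices \<open>i\<close> and \<open>l\<close> may be exchanged; the
  chain of \<open>sum.swap\<close> interchanges the outer and the inner summation.\<close>

lemma cart_sym: 
  assumes "v \<noteq> 0"
  shows "cart f v w u x = cart f v x u w"
proof -
  have "cart f v w u x = (\<Sum>i\<in>UNIV. \<Sum>j\<in>UNIV. \<Sum>l\<in>UNIV.
     wirt l (wirtb j (wirt i f)) v * w $ i * cnj (u $ j) * x $ l)"
    unfolding cart_def by (subst cart_index_sym[OF assms]) (rule refl)
  also have "\<dots> = (\<Sum>i\<in>UNIV. \<Sum>l\<in>UNIV. \<Sum>j\<in>UNIV.
     wirt l (wirtb j (wirt i f)) v * w $ i * cnj (u $ j) * x $ l)"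
    by (intro sum.cong refl sum.swap)
  also have "\<dots> = (\<Sum>l\<in>UNIV. \<Sum>i\<in>UNIV. \<Sum>j\<in>UNIV.
     wirt l (wirtb j (wirt i f)) v * w $ i * cnj (u $ j) * x $ l)"
    by (rule sum.swap)
  also have "\<dots> = (\<Sum>l\<in>UNIV. \<Sum>j\<in>UNIV. \<Sum>i\<in>UNIV.
     wirt l (wirtb j (wirt i f)) v * w $ i * cnj (u $ j) * x $ l)"
    by (intro sum.cong refl sum.swap)
  also have "\<dots> = cart f v x u w"
    unfolding cart_def by (simp add: mult_ac)
  finally show ?thesis .
qed

text \<open>The unbarred part of the direction differentiates g into C^+, the barred part into C^-.
  The latter appears as \<open>vcnj y\<close> because \<open>cartb\<close> conjugates its last
  argument.\<close>

lemma dderiv_levi: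
  assumes "v \<noteq> 0"
  shows "dderiv (\<lambda>v. levi f v a b) v (x, y) = cart f v a b x + cartb f v a b (vcnj y)"
proof -
  have "dderiv (\<lambda>v. levi f v a b) v (x, y)
      = (\<Sum>i\<in>UNIV. \<Sum>j\<in>UNIV. dderiv (wirt i (wirtb j f)) v (x, y) * a $ i * cnj (b $ j))"
    unfolding levi_def using differentiable_w[OF assms]
    by (simp add: dderiv_sum differentiable_sum' dderiv_cmult_right differentiable_mult)
  also have "\<dots> = cart f v a b x + cartb f v a b (vcnj y)"
    unfolding dderiv_def cart_def cartb_def wirt_commute2[OF assms]
    by (simp add: sum_distrib_right sum_distrib_left sum.distrib algebra_simps)
  finally show ?thesis .
qed

text \<open>The product rule when the fibre point and both vectors move, as happens in a frame that
  is not left-invariant. Quantities that enter antilinearly are differentiated along the conjugate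
  direction.\<close>

lemma dderiv_levi_full:
  fixes y a b :: "complex^'n \<Rightarrow> complex^'n"
  assumes y: "\<And>k. (\<lambda>x. y x $ k) differentiable (at x)" and "y x \<noteq> 0"
    and a: "\<And>k. (\<lambda>x. a x $ k) differentiable (at x)" and b: "\<And>k. (\<lambda>x. b x $ k) differentiable (at x)"
  shows "dderiv (\<lambda>x. levi f (y x) (a x) (b x)) x z
    = cart f (y x) (a x) (b x) (\<chi> k. dderiv (\<lambda>x. y x $ k) x z)
    + cartb f (y x) (a x) (b x) (\<chi> k. dderiv (\<lambda>x. y x $ k) x (pcnj z))
    + levi f (y x) (\<chi> k. dderiv (\<lambda>x. a x $ k) x z) (b x)
    + levi f (y x) (a x) (\<chi> k. dderiv (\<lambda>x. b x $ k) x (pcnj z))"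
proof -
  note dy = differentiable_vec[of y, OF y]
  note dG = differentiable_w(4)[OF assms(2)]
  have dGy: "(\<lambda>x. wirt i (wirtb j f) (y x)) differentiable (at x)" for i j
    using differentiable_chain_at[OF dy dG] by (simp add: o_def)
  note db = differentiable_cnj[OF b]
  have p: "push y x z = (\<chi> k. dderiv (\<lambda>x. y x $ k) x z, vcnj (\<chi> k. dderiv (\<lambda>x. y x $ k) x (pcnj z)))"
    by (simp add: push_def dderiv_cnj[OF y] vec_eq_iff)
  have "dderiv (\<lambda>x. levi f (y x) (a x) (b x)) x z
     = (\<Sum>i\<in>UNIV. \<Sum>j\<in>UNIV. dderiv (wirt i (wirtb j f)) (y x) (push y x z) * a x $ i * cnj (b x $ j)
        + wirt i (wirtb j f) (y x) * dderiv (\<lambda>x. a x $ i) x z * cnj (b x $ j)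
        + wirt i (wirtb j f) (y x) * a x $ i * cnj (dderiv (\<lambda>x. b x $ j) x (pcnj z)))"
    unfolding levi_def using dGy a db
    by (simp add: dderiv_sum differentiable_sum' dderiv_mult differentiable_mult dderiv_compose[OF dy dG]
        dderiv_cnj[OF b] distrib_right)
  also have "\<dots> = dderiv (\<lambda>u. levi f u (a x) (b x)) (y x) (push y x z)
    + levi f (y x) (\<chi> k. dderiv (\<lambda>x. a x $ k) x z) (b x)
    + levi f (y x) (a x) (\<chi> k. dderiv (\<lambda>x. b x $ k) x (pcnj z))"
  proof -
    have "dderiv (\<lambda>u. levi f u (a x) (b x)) (y x) (push y x z)
        = (\<Sum>i\<in>UNIV. \<Sum>j\<in>UNIV. dderiv (wirt i (wirtb j f)) (y x) (push y x z) * a x $ i * cnj (b x $ j))"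
      unfolding levi_def using dG
      by (simp add: dderiv_sum differentiable_sum' dderiv_cmult_right differentiable_mult)
    then show ?thesis by (simp add: levi_def sum.distrib)
  qed
  finally show ?thesis unfolding p dderiv_levi[OF assms(2)] vcnj_vcnj .
qed

lemma cnj_hess: "v \<noteq> 0 \<Longrightarrow> cnj (hess f v x y)
    = (\<Sum>i\<in>UNIV. \<Sum>j\<in>UNIV. wirtb i (wirtb j f) v * cnj (x $ i) * cnj (y $ j))"
  unfolding hess_def cnj_sum complex_cnj_mult cnj_ww ..

lemma dderiv_dderiv_commute:
  assumes "smooth_on (- {0}) h" "v \<noteq> 0"
  shows "dderiv (\<lambda>v. dderiv h v (x, 0)) v (y, 0) = dderiv (\<lambda>v. dderiv h v (y, 0)) v (x, 0)"
proof -
  have d: "wirt i h differentiable (at v)" for i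
    by (rule smooth_on_differentiable[OF smooth_w(1)[OF assms(1)]]) (simp add: assms)
  have e: "dderiv (\<lambda>v. dderiv h v (x, 0)) v (y, 0) = (\<Sum>i\<in>UNIV. \<Sum>j\<in>UNIV. x $ i * y $ j * wirt j (wirt i h) v)"
    for x y
  proof -
    have "(\<lambda>v. dderiv h v (x, 0)) = (\<lambda>v. \<Sum>i\<in>UNIV. x $ i * wirt i h v)"
      by (simp add: dderiv_def)
    then have "dderiv (\<lambda>v. dderiv h v (x, 0)) v (y, 0) = (\<Sum>i\<in>UNIV. x $ i * dderiv (wirt i h) v (y, 0))"
      using d by (simp add: dderiv_sum dderiv_cmult)
    then show ?thesis by (simp add: dderiv_def sum_distrib_left mult.assoc)
  qed
  have "wirt j (wirt i h) v = wirt i (wirt j h) v" for i j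
    by (rule wirt_commute[OF open_nonzero assms(1)]) (simp add: assms)
  then show ?thesis
    unfolding e by (subst sum.swap) (simp add: mult_ac)
qed

end

section \<open>Euler's identities for F^2 on a fibre\<close>

locale homogeneous_fibre = smooth_fibre f for f :: "complex^'n::finite \<Rightarrow> complex" +
  assumes homog: "f (a *s v) = of_real ((cmod a)\<^sup>2) * f v"
begin

text \<open>Homogeneity is differentiated at t = 0 along the curves (1 + t b) v for b = 1 and b =
  \<open>\<i>\<close>. The derivative of |1 + t b|^2 is 2 and 0 respectively, and the (1,0)-part of
  the differential is half of the first value minus \<open>\<i>\<close> times the second.\<close>

lemma euler: 
  assumes "v \<noteq> 0"
  shows "(\<Sum>i\<in>UNIV. v $ i * wirt i f v) = f v"
proof -
  have D: "(f has_derivative frechet_derivative f (at v)) (at v)"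
    by (rule frechet_derivative_works'[OF differentiable_w(1)[OF assms]])
  have *: "frechet_derivative f (at v) (b *s v) = of_real d * f v"
    if b: "((\<lambda>t. (cmod (1 + of_real t * b))\<^sup>2) has_real_derivative d) (at 0)" for b d
  proof -
    have lin: "(1 + complex_of_real t * b) *s v = v + t *\<^sub>R (b *s v)" for t
      by (simp add: vec_eq_iff algebra_simps scaleR_conv_of_real[where 'a=complex])
    have "((\<lambda>t. v + t *\<^sub>R (b *s v)) has_derivative (\<lambda>t. t *\<^sub>R (b *s v))) (at 0)"
      by (auto intro!: derivative_eq_intros)
    from diff_chain_at[OF this, of f "frechet_derivative f (at v)"] D
    have "((\<lambda>t. f ((1 + complex_of_real t * b) *s v)) has_derivative
        (\<lambda>t. frechet_derivative f (at v) (t *\<^sub>R (b *s v)))) (at 0)"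
      by (simp only: lin o_def scaleR_zero_left add_0_right)
    moreover have "((\<lambda>t. f ((1 + complex_of_real t * b) *s v)) has_derivative (\<lambda>t. of_real (d * t) * f v)) (at 0)"
      unfolding homog using b unfolding has_field_derivative_def
      by (intro has_derivative_mult_left has_derivative_of_real)
    ultimately have "(\<lambda>t. frechet_derivative f (at v) (t *\<^sub>R (b *s v))) = (\<lambda>t. of_real (d * t) * f v)"
      by (rule has_derivative_unique)
    from fun_cong[OF this, of 1] show ?thesis by simp
  qed
  have "frechet_derivative f (at v) (1 *s v) = of_real 2 * f v"
    by (rule *) (auto simp: cmod_power2 intro!: derivative_eq_intros)
  moreover have "frechet_derivative f (at v) (\<i> *s v) = of_real 0 * f v"
    by (rule *) (auto simp: cmod_power2 intro!: derivative_eq_intros)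
  moreover have "dderiv f v (v, 0) = (frechet_derivative f (at v) v - \<i> * frechet_derivative f (at v) (\<i> *s v)) / 2"
  proof -
    have "(v, 0) = ((1/2) *s v, (1/2) *s vcnj v) + ((- \<i>/2) *s (\<i> *s v), (- \<i>/2) *s vcnj (\<i> *s v))"
      by (simp add: vec_eq_iff zero_prod_def)
    then have "dderiv f v (v, 0) = (1/2) * dderiv f v (v, vcnj v) + (- \<i>/2) * dderiv f v (\<i> *s v, vcnj (\<i> *s v))"
      by (metis dderiv_add_vec dderiv_scale_vec)
    then show ?thesis
      unfolding frechet_derivative_dderiv[OF differentiable_w(1)[OF assms]] by (simp add: field_simps)
  qed
  ultimately have "dderiv f v (v, 0) = f v" by simp
  then show ?thesis by (simp add: dderiv_def)
qed

text \<open>Differentiates an Euler identity once more; it is applied first to the gradient of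
  \<open>f\<close> and then to g.\<close>

lemma euler_derivative:
  assumes "v \<noteq> 0" "\<And>i u. u \<noteq> 0 \<Longrightarrow> h i differentiable (at u)"
    and "\<And>u. u \<noteq> 0 \<Longrightarrow> (\<Sum>i\<in>UNIV. u $ i * h i u) = k u"
  shows "(\<Sum>i\<in>UNIV. fst Z $ i * h i v) + (\<Sum>i\<in>UNIV. v $ i * dderiv (h i) v Z) = dderiv k v Z"
proof -
  have n: "(\<lambda>x. x $ k) differentiable (at v)" for k by (rule differentiable_nth) simp
  have "dderiv (\<lambda>u. \<Sum>i\<in>UNIV. u $ i * h i u) v Z = dderiv k v Z"
    by (rule dderiv_cong_open[OF open_nonzero])
       (use assms n in \<open>auto intro!: differentiable_sum' differentiable_mult\<close>)
  then show ?thesis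
    using assms n by (simp add: dderiv_sum dderiv_mult differentiable_mult dderiv_nth sum.distrib)
qed

text \<open>A barred derivative of v^i f_i = f gives the first identity. In an unbarred derivative,
  the term f_l coming from v^l cancels against the right-hand side, whence the zero.\<close>

lemma euler_index:
  assumes "v \<noteq> 0"
  shows "(\<Sum>i\<in>UNIV. v $ i * wirt i (wirtb j f) v) = wirtb j f v"
    and "(\<Sum>i\<in>UNIV. v $ i * wirt i (wirt l f) v) = 0"
proof -
  note e = euler_derivative[OF assms differentiable_w(2) euler]
  show "(\<Sum>i\<in>UNIV. v $ i * wirt i (wirtb j f) v) = wirtb j f v"
    using e[of "(0, axis j 1)"] by (simp add: wirtb_eq_dderiv[symmetric] wirt_commute1[OF assms])
  show "(\<Sum>i\<in>UNIV. v $ i * wirt i (wirt l f) v) = 0"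
    using e[of "(axis l 1, 0)"] wirt_commute1(1)[OF assms, of l]
    by (simp add: wirt_eq_dderiv[symmetric] axis_sum)
qed

text \<open>The same mechanism one order higher: the unbarred derivative of the first identity in
  \<open>euler_index\<close> produces g on both sides, which cancels and leaves 0.\<close>

lemma euler_index3:
  assumes "v \<noteq> 0"
  shows "(\<Sum>i\<in>UNIV. v $ i * wirt i (wirtb j (wirt l f)) v) = 0"
    and "(\<Sum>i\<in>UNIV. v $ i * wirt i (wirtb j (wirtb l f)) v) = wirtb j (wirtb l f) v"
proof -
  note e = euler_derivative[OF assms differentiable_w(4) euler_index(1)]
  show "(\<Sum>i\<in>UNIV. v $ i * wirt i (wirtb j (wirt l f)) v) = 0"
    using e[of "(axis l 1, 0)"]
    by (simp add: wirt_eq_dderiv[symmetric] wirt_commute2[OF assms] axis_sum)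
  show "(\<Sum>i\<in>UNIV. v $ i * wirt i (wirtb j (wirtb l f)) v) = wirtb j (wirtb l f) v"
    using e[of "(0, axis l 1)"] wirt_commute1(3)[OF assms, of l]
    by (simp add: wirtb_eq_dderiv[symmetric] wirt_commute2[OF assms])
qed

lemma levi_self1:
  assumes "v \<noteq> 0"
  shows "levi f v v y = (\<Sum>j\<in>UNIV. wirtb j f v * cnj (y $ j))"
  unfolding levi_def euler_index(1)[OF assms, symmetric]
  by (subst sum.swap) (simp add: sum_distrib_left sum_distrib_right mult_ac)

lemma hess_self1:
  assumes "v \<noteq> 0"
  shows "hess f v v y = 0"
proof -
  have "hess f v v y = (\<Sum>j\<in>UNIV. (\<Sum>i\<in>UNIV. v $ i * wirt i (wirt j f) v) * y $ j)"
    unfolding hess_def by (subst sum.swap) (simp add: sum_distrib_left sum_distrib_right mult_ac)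
  then show ?thesis by (simp add: euler_index[OF assms])
qed

lemma cart_self1:
  assumes "v \<noteq> 0"
  shows "cart f v v u x = 0"
proof -
  have "cart f v v u x = (\<Sum>j\<in>UNIV. \<Sum>i\<in>UNIV. \<Sum>l\<in>UNIV. wirt i (wirtb j (wirt l f)) v * v $ i * cnj (u $ j) * x $ l)"
    unfolding cart_def by (rule sum.swap)
  also have "\<dots> = (\<Sum>j\<in>UNIV. \<Sum>l\<in>UNIV. \<Sum>i\<in>UNIV. wirt i (wirtb j (wirt l f)) v * v $ i * cnj (u $ j) * x $ l)"
    by (intro sum.cong refl sum.swap)
  also have "\<dots> = (\<Sum>j\<in>UNIV. \<Sum>l\<in>UNIV. (\<Sum>i\<in>UNIV. v $ i * wirt i (wirtb j (wirt l f)) v) * cnj (u $ j) * x $ l)"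
    by (simp add: sum_distrib_left sum_distrib_right mult_ac)
  finally show ?thesis by (simp add: euler_index3[OF assms])
qed

text \<open>This is the origin of the conjugated S-term in the connection operator: it is the C^-
  term of the metric equation contracted with \<open>v\<close>.\<close>

lemma cartb_self1:
  assumes "v \<noteq> 0"
  shows "cartb f v v u x = cnj (hess f v u x)"
proof -
  have "cartb f v v u x = (\<Sum>j\<in>UNIV. \<Sum>i\<in>UNIV. \<Sum>l\<in>UNIV. wirt i (wirtb j (wirtb l f)) v * v $ i * cnj (u $ j) * cnj (x $ l))"
    unfolding cartb_def by (rule sum.swap)
  also have "\<dots> = (\<Sum>j\<in>UNIV. \<Sum>l\<in>UNIV. \<Sum>i\<in>UNIV. wirt i (wirtb j (wirtb l f)) v * v $ i * cnj (u $ j) * cnj (x $ l))"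
    by (intro sum.cong refl sum.swap)
  also have "\<dots> = (\<Sum>j\<in>UNIV. \<Sum>l\<in>UNIV. (\<Sum>i\<in>UNIV. v $ i * wirt i (wirtb j (wirtb l f)) v) * cnj (u $ j) * cnj (x $ l))"
    by (simp add: sum_distrib_left sum_distrib_right mult_ac)
  finally show ?thesis by (simp add: euler_index3[OF assms] cnj_hess[OF assms])
qed

text \<open>The conjugate of \<open>cartb_self1\<close>. It turns the C^+ term of the first
  condition into the S-term of the second one.\<close>

lemma cart_self2: "v \<noteq> 0 \<Longrightarrow> cart f v w v x = hess f v w x"
  using cart_cnj[of v w v x] cartb_self1[of v w x] by (metis complex_cnj_cnj)

lemma cartb_self2: "v \<noteq> 0 \<Longrightarrow> cartb f v w v x = 0"
  using cart_cnj[of v v w x] cart_self1[of v w x] by simp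

end

section \<open>The connection on a fibre\<close>

text \<open>Separates the argument on a fibre from the group: the brackets enter only as a
  sesquilinear map \<open>B\<close> and an alternating bilinear map \<open>c\<close>, and positivity
  makes g_v nondegenerate.\<close>

locale connection_fibre = homogeneous_fibre f for f :: "complex^'n::finite \<Rightarrow> complex" +
  fixes B c :: "complex^'n \<Rightarrow> complex^'n \<Rightarrow> complex^'n"
  assumes posdef: "v \<noteq> 0 \<Longrightarrow> positive_definite (\<lambda>i j. wirt i (wirtb j f) v)"
    and B_add1: "B (x + y) w = B x w + B y w" and B_scale1: "B (a *s x) w = a *s B x w"
    and B_add2: "B x (w + z) = B x w + B x z" and B_scale2: "B x (a *s w) = cnj a *s B x w"
    and c_add: "c (x + y) w = c x w + c y w" and c_scale: "c (a *s x) w = a *s c x w"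
    and c_anti: "c x y = - c y x"
begin

lemma c_add2: "c w (x + y) = c w x + c w y"
  using c_anti[of w "x + y"] c_anti[of w x] c_anti[of w y] by (simp add: c_add)

lemma c_scale2: "c w (a *s x) = a *s c w x"
  using c_anti[of w "a *s x"] c_anti[of w x] by (simp add: c_scale vec_eq_iff)

lemma levi_nondegenerate:
  assumes "v \<noteq> 0" "\<And>u. levi f v x u = 0"
  shows "x = 0"
proof (rule ccontr)
  assume "x \<noteq> 0"
  then have "0 < Re (levi f v x x)"
    using posdef[OF assms(1)] unfolding positive_definite_def levi_def by blast
  then show False using assms(2)[of x] by simp
qed

text \<open>Most vector identities below are verified by pairing both sides with an arbitrary
  \<open>u\<close>.\<close>

lemma levi_ext:
  assumes "v \<noteq> 0" "\<And>u. levi f v x u = levi f v y u"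
  shows "x = y"
  using levi_nondegenerate[OF assms(1), of "x - y"] assms(2) by (simp add: levi_diff1)

text \<open>The barred index labels the rows, so the matrix maps \<open>x\<close> to the list of its
  products with the basis vectors in the second slot.\<close>

definition levi_matrix :: "complex^'n \<Rightarrow> complex^'n^'n" where
  "levi_matrix v = (\<chi> j l. wirt l (wirtb j f) v)"

lemma levi_matrix_mult: "(levi_matrix v *v x) $ j = levi f v x (axis j 1)"
  unfolding levi_def levi_matrix_def cnj_axis axis_sum by (simp add: matrix_vector_mult_def)

lemma levi_basis: "levi f v x u = (\<Sum>j\<in>UNIV. cnj (u $ j) * levi f v x (axis j 1))"
  by (rule antifunctional_basis) (simp_all add: levi_add2 levi_scale2)

lemma invertible_levi_matrix:
  assumes "v \<noteq> 0"
  shows "invertible (levi_matrix v)"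
  unfolding invertible_left_inverse matrix_left_invertible_ker
proof (intro allI impI)
  fix x assume "levi_matrix v *v x = 0"
  then have "levi f v x (axis j 1) = 0" for j using levi_matrix_mult[of v x j] by simp
  then show "x = 0"
    by (intro levi_nondegenerate[OF assms]) (subst levi_basis, simp)
qed

text \<open>\<open>B u w\<close> and \<open>c u w\<close> stand for \<open>[u, \<bar>w]\<^bsup>1,0\<^esup>\<close> and \<open>[u, w]\<close>, \<open>N v\<close> for the connection operator at
  \<open>v\<close>, and \<open>Gam v x w\<close> for \<open>\<Gamma>\<^sup>i\<^bsub>jk\<^esub> x\<^sup>j w\<^sup>k\<close>, which in the left-invariant frame is the derivative of \<open>N\<close>
  with respect to \<open>v\<close> along \<open>x\<close>.\<close>

definition rho :: "complex^'n \<Rightarrow> complex^'n \<Rightarrow> complex^'n \<Rightarrow> complex" where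
  "rho v w u = levi f v v (B u w) + cnj (hess f v u (B v w))"

definition N :: "complex^'n \<Rightarrow> complex^'n \<Rightarrow> complex^'n" where
  "N v w = matrix_inv (levi_matrix v) *v (\<chi> j. rho v w (axis j 1))"

definition Gam :: "complex^'n \<Rightarrow> complex^'n \<Rightarrow> complex^'n \<Rightarrow> complex^'n" where
  "Gam v x w = (\<chi> l. dderiv (\<lambda>v. N v w $ l) v (x, 0))"

text \<open>Twice the torsion.\<close>

definition tor :: "complex^'n \<Rightarrow> complex^'n \<Rightarrow> complex^'n \<Rightarrow> complex^'n" where
  "tor v x w = - c x w - (Gam v x w - Gam v w x)"

lemma levi_matrix_N:
  assumes "v \<noteq> 0"
  shows "levi_matrix v *v N v w = (\<chi> j. rho v w (axis j 1))"
  unfolding N_def matrix_vector_mul_assoc matrix_inv_cancel(1)[OF invertible_levi_matrix[OF assms]]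
  by (rule matrix_vector_mul_lid)

text \<open>The matrix equation gives the case of basis vectors; both sides are antilinear in
  \<open>u\<close>, which in \<open>rho\<close> comes from the linearity of \<open>B\<close> in its
  first argument under the conjugation.\<close>

lemma levi_N:
  assumes "v \<noteq> 0"
  shows "levi f v (N v w) u = rho v w u"
proof -
  have "levi f v (N v w) (axis j 1) = rho v w (axis j 1)" for j
    using levi_matrix_mult[of v "N v w" j] levi_matrix_N[OF assms, of w] by simp
  moreover have "rho v w u = (\<Sum>j\<in>UNIV. cnj (u $ j) * rho v w (axis j 1))"
    by (rule antifunctional_basis)
       (simp_all add: rho_def B_add1 B_scale1 levi_add2 levi_scale2 hess_add1 hess_scale1 algebra_simps)
  ultimately show ?thesis by (simp only: levi_basis[of v "N v w" u])
qed

lemma N_add: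
  assumes "v \<noteq> 0"
  shows "N v (w + z) = N v w + N v z"
  by (rule levi_ext[OF assms])
     (simp add: levi_N[OF assms] levi_add1 rho_def B_add2 levi_add2 hess_add2)

lemma N_scale:
  assumes "v \<noteq> 0"
  shows "N v (a *s w) = a *s N v w"
  by (rule levi_ext[OF assms])
     (simp add: levi_N[OF assms] levi_scale1 rho_def B_scale2 levi_scale2 hess_scale2 algebra_simps)

lemma N_basis: "v \<noteq> 0 \<Longrightarrow> N v w = (\<Sum>k\<in>UNIV. w $ k *s N v (axis k 1))"
  by (rule linear_basis) (simp_all add: N_add N_scale)

lemma B_functional: "B (x + y) w $ k = B x w $ k + B y w $ k" "B (a *s x) w $ k = a * B x w $ k"
  by (simp_all add: B_add1 B_scale1)

text \<open>\<open>N v w\<close> solves a linear system whose matrix and right-hand side are smooth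
  in \<open>v\<close>, and positivity makes the determinant nonzero.\<close>

lemma smooth_N: "smooth_on (- {0}) (\<lambda>v. N v w $ l)"
proof (rule smooth_on_solution[where M = levi_matrix and b = "\<lambda>v. \<chi> j. rho v w (axis j 1)"])
  note S = open_nonzero
  show "open (- {0 :: complex^'n})" by (rule S)
  show "smooth_on (- {0}) (\<lambda>x. levi_matrix x $ i $ j)" for i j
    unfolding levi_matrix_def by (simp add: smooth_w smooth)
  show "det (levi_matrix x) \<noteq> 0" if "x \<in> - {0}" for x
    using invertible_levi_matrix[of x] that by (simp add: invertible_det_nz)
  show "levi_matrix x *v N x w = (\<chi> j. rho x w (axis j 1))" if "x \<in> - {0}" for x
    using levi_matrix_N[of x] that by simp
  show "smooth_on (- {0}) (\<lambda>x. (\<chi> j. rho x w (axis j 1)) $ i)" for i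
  proof (rule smooth_on_cong[OF S])
    \<comment> \<open>Euler's identity rewrites the product of \<open>v\<close> with a fixed vector
      through first derivatives of \<open>f\<close>; the remaining dependence of
      \<open>B v w\<close> on \<open>v\<close> is linear.\<close>
    show "smooth_on (- {0}) (\<lambda>v. (\<Sum>j\<in>UNIV. cnj (B (axis i 1) w $ j) * wirtb j f v) +
        cnj (\<Sum>j\<in>UNIV. wirt i (wirt j f) v * B v w $ j))"
      by (intro smooth_on_add smooth_on_sum smooth_on_cmult smooth_on_cnj smooth_on_mult smooth_w smooth S
          smooth_on_functional B_functional finite_class.finite_UNIV)
    show "(\<Sum>j\<in>UNIV. cnj (B (axis i 1) w $ j) * wirtb j f v) + cnj (\<Sum>j\<in>UNIV. wirt i (wirt j f) v * B v w $ j)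
        = (\<chi> j. rho v w (axis j 1)) $ i" if "v \<in> - {0}" for v
    proof -
      have "hess f v (axis i 1) y = (\<Sum>j\<in>UNIV. wirt i (wirt j f) v * y $ j)" for y
        unfolding hess_def by (subst sum.swap) (simp only: sum_distrib_right[symmetric] axis_sum)
      then show ?thesis using that by (simp add: rho_def levi_self1 mult.commute)
    qed
  qed
qed

lemma differentiable_N: "v \<noteq> 0 \<Longrightarrow> (\<lambda>v. N v w $ l) differentiable (at v)"
  by (rule smooth_on_differentiable[OF smooth_N]) simp

section \<open>The vertical derivative of the connection operator\<close>

lemma Gam_add1: "Gam v (x + y) w = Gam v x w + Gam v y w"
  using dderiv_add_vec[of _ v "(x, 0)" "(y, 0)"] by (simp add: Gam_def vec_eq_iff)

lemma Gam_scale1: "Gam v (a *s x) w = a *s Gam v x w"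
  using dderiv_scale_vec[of _ v a x 0] by (simp add: Gam_def vec_eq_iff)

lemma dderiv_levi_var:
  assumes "v \<noteq> 0" "\<And>l. (\<lambda>v. y v $ l) differentiable (at v)"
  shows "dderiv (\<lambda>v. levi f v (y v) b) v (x, 0)
    = cart f v (y v) b x + levi f v (\<chi> l. dderiv (\<lambda>v. y v $ l) v (x, 0)) b"
proof -
  have "dderiv (\<lambda>v. levi f v (y v) b) v (x, 0)
      = (\<Sum>i\<in>UNIV. \<Sum>j\<in>UNIV. (dderiv (wirt i (wirtb j f)) v (x, 0) * y v $ i
          + wirt i (wirtb j f) v * dderiv (\<lambda>v. y v $ i) v (x, 0)) * cnj (b $ j))"
    unfolding levi_def using differentiable_w[OF assms(1)] assms(2)
    by (simp add: dderiv_sum differentiable_sum' dderiv_cmult_right dderiv_mult differentiable_mult)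
  also have "\<dots> = dderiv (\<lambda>u. levi f u (y v) b) v (x, 0) + levi f v (\<chi> l. dderiv (\<lambda>v. y v $ l) v (x, 0)) b"
  proof -
    have "dderiv (\<lambda>u. levi f u (y v) b) v (x, 0)
        = (\<Sum>i\<in>UNIV. \<Sum>j\<in>UNIV. dderiv (wirt i (wirtb j f)) v (x, 0) * y v $ i * cnj (b $ j))"
      unfolding levi_def using differentiable_w[OF assms(1)]
      by (simp add: dderiv_sum differentiable_sum' dderiv_cmult_right differentiable_mult)
    then show ?thesis
      by (simp add: levi_def algebra_simps sum.distrib)
  qed
  finally show ?thesis
    unfolding dderiv_levi[OF assms(1)] by (simp add: cartb_def)
qed

text \<open>The derivative of g itself contributes a C^+ term with \<open>v\<close> in its first
  slot, which vanishes by Euler's identity.\<close>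

lemma dderiv_levi_self:
  assumes "v \<noteq> 0"
  shows "dderiv (\<lambda>v. levi f v v b) v (x, 0) = levi f v x b"
proof -
  have n: "(\<lambda>v. v $ l) differentiable (at v)" for l and v :: "complex^'n" by (rule differentiable_nth) simp
  have "dderiv (\<lambda>v. levi f v v b) v (x, 0) = cart f v v b x + levi f v (\<chi> l. x $ l) b"
    using dderiv_levi_var[OF assms, of "\<lambda>v. v" b x] n by (simp add: dderiv_nth)
  then show ?thesis by (simp add: cart_self1[OF assms])
qed

text \<open>\<open>B v w\<close> is complex linear in \<open>v\<close>, so its conjugate has no
  derivative in the unbarred direction \<open>(x, 0)\<close>; only the coefficients of the Hessian
  contribute.\<close>

lemma dderiv_cnj_hess:
  assumes "v \<noteq> 0"
  shows "dderiv (\<lambda>v. cnj (hess f v u (B v w))) v (x, 0) = cartb f v x u (B v w)"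
proof -
  have bd: "(\<lambda>v. cnj (B v w $ j)) differentiable (at v)" for j
    by (rule differentiable_cnj[OF differentiable_functional[OF B_functional]])
  have bz: "dderiv (\<lambda>v. cnj (B v w $ j)) v (x, 0) = 0" for j
    unfolding dderiv_cnj[OF differentiable_functional[OF B_functional]] dderiv_functional[OF B_functional]
    using B_scale1[of 0 0 w] by (simp add: pcnj_def)
  have "dderiv (\<lambda>v. cnj (hess f v u (B v w))) v (x, 0)
    = dderiv (\<lambda>v. \<Sum>i\<in>UNIV. \<Sum>j\<in>UNIV. cnj (wirt i (wirt j f) v) * cnj (u $ i) * cnj (B v w $ j)) v (x, 0)"
    unfolding hess_def cnj_sum complex_cnj_mult ..
  also have "\<dots> = (\<Sum>i\<in>UNIV. \<Sum>j\<in>UNIV.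
      dderiv (\<lambda>v. cnj (wirt i (wirt j f) v)) v (x, 0) * cnj (u $ i) * cnj (B v w $ j))"
    using differentiable_cnj[OF differentiable_w(5)[OF assms]] bd bz
    by (simp add: dderiv_sum differentiable_sum' dderiv_cmult_right dderiv_mult differentiable_mult)
  also have "\<dots> = (\<Sum>i\<in>UNIV. \<Sum>j\<in>UNIV. (\<Sum>l\<in>UNIV. x $ l * wirt l (wirtb i (wirtb j f)) v)
      * cnj (u $ i) * cnj (B v w $ j))"
  proof -
    have "dderiv (\<lambda>v. cnj (wirt i (wirt j f) v)) v (x, 0) = dderiv (wirtb i (wirtb j f)) v (x, 0)" for i j
      by (rule dderiv_cong_open[OF open_nonzero _ _ differentiable_cnj[OF differentiable_w(5)[OF assms]]])
         (use assms cnj_ww in auto)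
    then show ?thesis by (simp add: dderiv_def)
  qed
  also have "\<dots> = (\<Sum>i\<in>UNIV. \<Sum>j\<in>UNIV. \<Sum>l\<in>UNIV. x $ l * wirt l (wirtb i (wirtb j f)) v
      * cnj (u $ i) * cnj (B v w $ j))"
    by (simp only: sum_distrib_right)
  also have "\<dots> = (\<Sum>i\<in>UNIV. \<Sum>l\<in>UNIV. \<Sum>j\<in>UNIV. x $ l * wirt l (wirtb i (wirtb j f)) v
      * cnj (u $ i) * cnj (B v w $ j))"
    by (intro sum.cong refl sum.swap)
  also have "\<dots> = (\<Sum>l\<in>UNIV. \<Sum>i\<in>UNIV. \<Sum>j\<in>UNIV. x $ l * wirt l (wirtb i (wirtb j f)) v
      * cnj (u $ i) * cnj (B v w $ j))"
    by (rule sum.swap)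
  finally show ?thesis unfolding cartb_def by (simp only: mult.commute[of "x $ _"])
qed

text \<open>Obtained by differentiating \<open>levi_N\<close> along \<open>x\<close>. In the
  left-invariant frame this is exactly what the metric equation demands of \<Gamma>.\<close>

lemma levi_Gam:
  assumes "v \<noteq> 0"
  shows "levi f v (Gam v x w) u = levi f v x (B u w) - cart f v x u (N v w) + cartb f v x u (B v w)"
proof -
  have dl: "(\<lambda>v. levi f v v (B u w)) differentiable (at v)"
    unfolding levi_def using differentiable_w[OF assms] differentiable_nth[OF differentiable_ident]
    by (intro differentiable_sum' differentiable_mult differentiable_const) auto
  have bd: "(\<lambda>v. B v w $ j) differentiable (at v)" for j
    by (rule differentiable_functional[OF B_functional])
  have dh: "(\<lambda>v. cnj (hess f v u (B v w))) differentiable (at v)"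
    unfolding hess_def
    by (intro differentiable_cnj differentiable_sum' differentiable_mult differentiable_const
        differentiable_w assms bd)
  have "cart f v (N v w) u x + levi f v (Gam v x w) u = dderiv (\<lambda>v. levi f v (N v w) u) v (x, 0)"
    using dderiv_levi_var[OF assms differentiable_N[OF assms], of w u x] by (simp add: Gam_def)
  also have "\<dots> = dderiv (\<lambda>v. levi f v v (B u w) + cnj (hess f v u (B v w))) v (x, 0)"
    by (rule dderiv_cong_open[OF open_nonzero, symmetric])
       (use assms dl dh in \<open>auto simp: levi_N rho_def\<close>)
  also have "\<dots> = levi f v x (B u w) + cartb f v x u (B v w)"
    by (simp add: dderiv_add[OF dl dh] dderiv_levi_self[OF assms] dderiv_cnj_hess[OF assms])
  finally show ?thesis using cart_sym[OF assms, of "N v w" u x] by (simp add: algebra_simps)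
qed

text \<open>For \<open>x = v\<close> the C^+ term drops out and the equation becomes the one
  defining \<open>N v w\<close>, so \<open>X v\<close> is known. Inserting it makes the right-hand
  side explicit for every \<open>x\<close>.\<close>

lemma Gam_unique:
  assumes "v \<noteq> 0"
    and "\<And>x u. levi f v (X x) u = levi f v x (B u w) - cart f v x u (X v) + cartb f v x u (B v w)"
  shows "X x = Gam v x w"
proof -
  have "X v = N v w"
    by (rule levi_ext[OF assms(1)])
       (simp add: assms(2)[of v] levi_N[OF assms(1)] rho_def cart_self1[OF assms(1)] cartb_self1[OF assms(1)])
  then show ?thesis
    by (intro levi_ext[OF assms(1)]) (simp add: assms(2)[of x] levi_Gam[OF assms(1)])
qed

text \<open>An Euler identity for \<open>N\<close>: it is homogeneous of degree one in the unbarred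
  direction.\<close>

lemma Gam_self:
  assumes "v \<noteq> 0"
  shows "Gam v v w = N v w"
  by (rule levi_ext[OF assms])
     (simp add: levi_Gam[OF assms] levi_N[OF assms] rho_def cart_self1[OF assms] cartb_self1[OF assms])

lemma Gam_add2:
  assumes "v \<noteq> 0"
  shows "Gam v x (w + z) = Gam v x w + Gam v x z"
  by (rule levi_ext[OF assms])
     (simp add: levi_Gam[OF assms] levi_add1 levi_add2 B_add2 N_add[OF assms] cart_add3 cartb_add3)

lemma Gam_scale2:
  assumes "v \<noteq> 0"
  shows "Gam v x (a *s w) = a *s Gam v x w"
  by (rule levi_ext[OF assms])
     (simp add: levi_Gam[OF assms] levi_scale1 levi_scale2 B_scale2 N_scale[OF assms] cart_scale3 cartb_scale3
       algebra_simps)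

text \<open>In the left-invariant frame the connection form \<open>\<omega>\<close> at the fibre coordinate \<open>v\<close>, on the
  vector \<open>s\<^sup>k e\<^sub>k + \<bar>t\<^sup>k \<bar>e\<^sub>k\<close>, is the endomorphism \<open>om v s t\<close> of the fibre.\<close>

definition om :: "complex^'n \<Rightarrow> complex^'n \<Rightarrow> complex^'n \<Rightarrow> complex^'n \<Rightarrow> complex^'n" where
  "om v s t x = Gam v x s - B x t"

text \<open>The metric equation in the left-invariant frame, where g has no horizontal derivative.
  The conjugate connection form belongs to the conjugate vector, hence \<open>om v t s\<close> with
  \<open>s\<close> and \<open>t\<close> exchanged. Conjugating \<open>levi_Gam\<close> for the
  second slot produces terms that cancel those of the first slot in pairs.\<close>

lemma metric_compatible:
  assumes "v \<noteq> 0"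
  shows "levi f v (om v s t x) y + levi f v x (om v t s y)
    + cart f v x y (om v s t v) + cartb f v x y (om v t s v) = 0"
proof -
  have "levi f v x (Gam v y t) = cnj (levi f v (Gam v y t) x)"
    by (simp add: levi_cnj[OF assms])
  also have "\<dots> = levi f v (B x t) y - cartb f v x y (N v t) + cart f v x y (B v t)"
    unfolding levi_Gam[OF assms] complex_cnj_add complex_cnj_diff levi_cnj[OF assms]
      cart_cnj[OF assms] cart_cnj[OF assms, symmetric, of x y "B v t", THEN arg_cong[of _ _ cnj]]
    by (metis cart_cnj[OF assms] complex_cnj_cnj)
  finally show ?thesis
    unfolding om_def Gam_self[OF assms] levi_diff1 levi_diff2 levi_Gam[OF assms] cart_diff3 cartb_diff3
    by simp
qed

section \<open>The two conditions as statements about torsion\<close>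

lemma hess_sym: "v \<noteq> 0 \<Longrightarrow> hess f v x y = hess f v y x"
  unfolding hess_def by (subst sum.swap) (simp add: wirt_commute1(1) mult_ac)

text \<open>The first term and the two Cartan terms combine to the product of
  \<open>Gam v w v\<close> with \<open>u\<close>, by \<open>levi_Gam\<close>; the third and fourth
  terms are that of \<open>- Gam v v w\<close>, by the equation defining \<open>N\<close>. The
  bracket term completes the torsion.\<close>

lemma kaehler_condition_tor:
  assumes "v \<noteq> 0"
  shows "levi f v w (B u v) - levi f v (c v w) u - levi f v v (B u w) - cnj (hess f v u (B v w))
    - cart f v w u (N v v) + cartb f v w u (B v v) = - levi f v (tor v w v) u"
proof -
  have "levi f v (Gam v v w) u = levi f v v (B u w) + cnj (hess f v u (B v w))"
    by (simp add: Gam_self[OF assms] levi_N[OF assms] rho_def)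
  moreover have "levi f v (tor v w v) u = levi f v (c v w) u - levi f v (Gam v w v) u + levi f v (Gam v v w) u"
    unfolding tor_def c_anti[of w v] by (simp add: levi_add1 levi_diff1)
  ultimately show ?thesis using levi_Gam[OF assms, of w v u] by simp
qed

text \<open>For \<open>u = v\<close> Euler's identities remove the conjugated S-term and the C^-
  term, and replace the C^+ term by S.\<close>

lemma weak_condition_tor:
  assumes "v \<noteq> 0"
  shows "levi f v w (B v v) - levi f v (c v w) v - levi f v v (B v w) - hess f v (N v v) w
    = - levi f v (tor v w v) v"
  using kaehler_condition_tor[OF assms, of w v] hess_sym[OF assms, of w "N v v"]
  by (simp add: hess_self1[OF assms] cart_self2[OF assms] cartb_self2[OF assms])

text \<open>The reason why the vanishing of the torsion on pairs \<open>(w, v)\<close> at the point \<open>v\<close> is enough: with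
  \<open>q = N v v\<close> the hypothesis reads \<open>2 N\<^sub>i = \<partial>\<^sub>i q + c\<^sub>i\<^sub>k v\<^sup>k\<close>, and differentiating once more turns the
  antisymmetric part of \<open>\<Gamma>\<^sub>j\<^sub>i = \<partial>\<^sub>j N\<^sub>i\<close> into that of \<open>c\<close>, since \<open>\<partial>\<^sub>j \<partial>\<^sub>i q\<close> is symmetric.\<close>

lemma tor_zero:
  assumes "\<And>v w. v \<noteq> 0 \<Longrightarrow> tor v w v = 0" "v \<noteq> 0"
  shows "tor v x y = 0"
proof -
  define q where "q l v = N v v $ l" for l v
  have nth: "(\<lambda>x. x $ k) differentiable (at v)" for k and v :: "complex^'n" by (rule differentiable_nth) simp
  have q: "q l u = (\<Sum>k\<in>UNIV. u $ k * N u (axis k 1) $ l)" if "u \<noteq> 0" for l u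
    using arg_cong[OF N_basis[OF that, of u], of "\<lambda>z. z $ l"] by (simp add: q_def)
  \<comment> \<open>Smoothness of the contraction is required because its second derivatives will be
    interchanged.\<close>
  have sq: "smooth_on (- {0}) (q l)" for l
  proof (rule smooth_on_cong[OF open_nonzero])
    show "smooth_on (- {0}) (\<lambda>u. \<Sum>k\<in>UNIV. u $ k * N u (axis k 1) $ l)"
      by (intro smooth_on_sum smooth_on_mult open_nonzero smooth_N smooth_on_functional) auto
  qed (use q in auto)
  have dq: "dderiv (q l) v (x, 0) = (N v x + Gam v x v) $ l" if v: "v \<noteq> 0" for v x l
  proof -
    have "dderiv (q l) v (x, 0) = dderiv (\<lambda>u. \<Sum>k\<in>UNIV. u $ k * N u (axis k 1) $ l) v (x, 0)"
      by (rule dderiv_cong_open[OF open_nonzero _ _ smooth_on_differentiable[OF sq]]) (use v q in auto)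
    also have "\<dots> = (\<Sum>k\<in>UNIV. x $ k * N v (axis k 1) $ l + v $ k * Gam v x (axis k 1) $ l)"
      using nth differentiable_N[OF v]
      by (simp add: dderiv_sum dderiv_mult differentiable_mult dderiv_nth Gam_def)
    also have "\<dots> = (N v x + Gam v x v) $ l"
      using arg_cong[OF N_basis[OF v, of x], of "\<lambda>z. z $ l"]
        arg_cong[OF linear_basis[of "Gam v x" v, OF Gam_add2[OF v] Gam_scale2[OF v]], of "\<lambda>z. z $ l"]
      by (simp add: sum.distrib)
    finally show ?thesis .
  qed
  \<comment> \<open>Differentiating the contraction gives \<open>N v x + Gam v x v\<close>, and the
    hypothesis gives \<open>Gam v x v = N v x - c x v\<close>; eliminating \<open>Gam\<close> leaves
    twice \<open>N\<close>.\<close>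
  have N2: "2 * N v x $ l = c x v $ l + dderiv (q l) v (x, 0)" if v: "v \<noteq> 0" for v x l
  proof -
    have "N v x $ l - (c x v $ l + Gam v x v $ l) = tor v x v $ l"
      by (simp add: tor_def Gam_self[OF v] algebra_simps)
    also have "\<dots> = 0" by (simp add: assms(1)[OF v])
    finally show ?thesis by (simp add: dq[OF v])
  qed
  have G2: "2 * Gam v x y $ l = c y x $ l + dderiv (\<lambda>v. dderiv (q l) v (y, 0)) v (x, 0)" for x y l
  proof -
    have dd: "(\<lambda>v. dderiv (q l) v (y, 0)) differentiable (at v)"
      unfolding dderiv_def
      by (intro differentiable_sum' differentiable_add differentiable_mult differentiable_const
          smooth_on_differentiable[OF smooth_w(1)[OF sq]] smooth_on_differentiable[OF smooth_w(2)[OF sq]])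
         (simp_all add: assms(2))
    have cf: "c y (a + b) $ l = c y a $ l + c y b $ l" "c y (r *s a) $ l = r * c y a $ l" for a b r
      by (simp_all add: c_add2 c_scale2)
    have "2 * Gam v x y $ l = dderiv (\<lambda>v. 2 * N v y $ l) v (x, 0)"
      using differentiable_N[OF assms(2)] by (simp add: dderiv_cmult Gam_def)
    also have "\<dots> = dderiv (\<lambda>v. c y v $ l + dderiv (q l) v (y, 0)) v (x, 0)"
      by (rule dderiv_cong_open[OF open_nonzero])
         (use assms(2) N2 differentiable_N in \<open>auto intro!: differentiable_mult\<close>)
    also have "\<dots> = c y x $ l + dderiv (\<lambda>v. dderiv (q l) v (y, 0)) v (x, 0)"
      by (simp add: dderiv_add[OF differentiable_functional[OF cf] dd] dderiv_functional[OF cf])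
    finally show ?thesis .
  qed
  \<comment> \<open>Antisymmetrizing \<open>G2\<close> removes the Hessian of \<open>q l\<close> and
    leaves twice the difference of the two \<open>Gam\<close> terms as \<open>c y x - c x y\<close>,
    that is \<open>- 2 * c x y\<close>.\<close>
  have "2 * tor v x y $ l = 0" for l
    using G2[of x y l] G2[of y x l] dderiv_dderiv_commute[OF sq assms(2), of l x y] c_anti[of x y]
    by (simp add: tor_def algebra_simps)
  then show ?thesis by (simp add: vec_eq_iff)
qed

lemma tor_anti: "tor v x y = - tor v y x"
  unfolding tor_def c_anti[of x y] by simp

lemma tor_add1: "v \<noteq> 0 \<Longrightarrow> tor v (x + x') y = tor v x y + tor v x' y"
  by (simp add: tor_def c_add Gam_add1 Gam_add2)

lemma tor_scale1:
  assumes "v \<noteq> 0"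
  shows "tor v (a *s x) y = a *s tor v x y"
  by (simp add: tor_def c_scale Gam_scale1 Gam_scale2[OF assms] vec_eq_iff algebra_simps)

lemma tor_add2: "v \<noteq> 0 \<Longrightarrow> tor v y (x + x') = tor v y x + tor v y x'"
  using tor_add1[of v x x' y] tor_anti[of v y "x + x'"] tor_anti[of v y x] tor_anti[of v y x'] by simp

lemma tor_scale2:
  assumes "v \<noteq> 0"
  shows "tor v y (a *s x) = a *s tor v y x"
  using tor_scale1[OF assms, of a x y] tor_anti[of v y "a *s x"] tor_anti[of v y x] by (simp add: vec_eq_iff)

lemma om_add: "om v s t (x + y) = om v s t x + om v s t y"
  by (simp add: om_def Gam_add1 B_add1)

lemma om_scale: "om v s t (a *s x) = a *s om v s t x"
  by (simp add: om_def Gam_scale1 B_scale1 vec_eq_iff algebra_simps)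

lemma tor_zero_axis:
  assumes "v \<noteq> 0" "\<And>j k. tor v (axis j 1) (axis k 1) = 0"
  shows "tor v x y = 0"
proof -
  have "tor v x (axis k 1) = 0" for x k
    unfolding linear_basis[of "\<lambda>x. tor v x (axis k 1)" x, OF tor_add1[OF assms(1)] tor_scale1[OF assms(1)]]
    by (simp add: assms(2))
  then show ?thesis
    unfolding linear_basis[of "tor v x" y, OF tor_add2[OF assms(1)] tor_scale2[OF assms(1)]]
    by simp
qed

end

section \<open>Linear changes of the fibre coordinate\<close>

lemma matrix_axis: "(M *v axis i 1) $ k = (M :: complex^'n^'m) $ k $ i"
  by (simp add: matrix_vector_mult_def axis_sum)

lemma matrix_scale: "M *v (a *s x) = a *s (M *v (x :: complex^'n))"
  by (simp add: matrix_vector_mult_def vec_eq_iff sum_distrib_left mult_ac)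

lemma wirt_matrix_sum:
  fixes M :: "complex^'n^'n" and g :: "'k \<Rightarrow> complex^'n \<Rightarrow> complex"
  assumes "\<And>k. g k differentiable (at (M *v v))"
  shows "wirt i (\<lambda>y. \<Sum>k\<in>I. \<alpha> k * g k (M *v y)) v = (\<Sum>k\<in>I. \<alpha> k * (\<Sum>m\<in>UNIV. M $ m $ i * wirt m (g k) (M *v v)))"
    and "wirtb i (\<lambda>y. \<Sum>k\<in>I. \<alpha> k * g k (M *v y)) v = (\<Sum>k\<in>I. \<alpha> k * (\<Sum>m\<in>UNIV. cnj (M $ m $ i) * wirtb m (g k) (M *v v)))"
proof -
  have d: "(\<lambda>y. g k (M *v y)) differentiable (at v)" for k
    using differentiable_chain_at[OF bounded_linear_imp_differentiable[OF bounded_linear_matrix_vector] assms, of k]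
    by (simp add: o_def)
  show "wirt i (\<lambda>y. \<Sum>k\<in>I. \<alpha> k * g k (M *v y)) v = (\<Sum>k\<in>I. \<alpha> k * (\<Sum>m\<in>UNIV. M $ m $ i * wirt m (g k) (M *v v)))"
    unfolding wirt_matrix(1)[OF assms, symmetric] wirt_eq_dderiv[of i]
    using d by (simp add: dderiv_sum dderiv_cmult)
  show "wirtb i (\<lambda>y. \<Sum>k\<in>I. \<alpha> k * g k (M *v y)) v = (\<Sum>k\<in>I. \<alpha> k * (\<Sum>m\<in>UNIV. cnj (M $ m $ i) * wirtb m (g k) (M *v v)))"
    unfolding wirt_matrix(2)[OF assms, symmetric] wirtb_eq_dderiv[of i]
    using d by (simp add: dderiv_sum dderiv_cmult)
qed

context smooth_fibre
begin

context
  fixes M :: "complex^'n^'n"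
  assumes M: "\<And>v. v \<noteq> 0 \<Longrightarrow> M *v v \<noteq> 0"
begin

lemma differentiable_matrix:
  assumes "v \<noteq> 0" "g differentiable (at (M *v v))"
  shows "(\<lambda>y. g (M *v y)) differentiable (at v)"
  using differentiable_chain_at[OF bounded_linear_imp_differentiable[OF bounded_linear_matrix_vector] assms(2)]
  by (simp add: o_def)

lemma wirt_change1:
  assumes "v \<noteq> 0"
  shows "wirt i (\<lambda>y. f (M *v y)) v = (\<Sum>k\<in>UNIV. M $ k $ i * wirt k f (M *v v))"
    and "wirtb i (\<lambda>y. f (M *v y)) v = (\<Sum>k\<in>UNIV. cnj (M $ k $ i) * wirtb k f (M *v v))"
  by (rule wirt_matrix[OF differentiable_w(1)[OF M[OF assms]]])+

lemma differentiable_change1: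
  assumes "v \<noteq> 0"
  shows "(\<lambda>v. \<Sum>k\<in>UNIV. \<alpha> k * wirt k f (M *v v)) differentiable (at v)"
    and "(\<lambda>v. \<Sum>k\<in>UNIV. \<alpha> k * wirtb k f (M *v v)) differentiable (at v)"
  by (intro differentiable_sum' differentiable_mult differentiable_const differentiable_matrix
      differentiable_w assms M)+

text \<open>The chain rule is applied one derivative at a time, each intermediate formula being
  valid on the open set of nonzero vectors. Injectivity of \<open>M\<close> keeps
  \<open>M *v v\<close> where \<open>f\<close> is smooth.\<close>

lemma wirt_change2:
  assumes "v \<noteq> 0"
  shows "wirt i (wirtb j (\<lambda>y. f (M *v y))) v = levi f (M *v v) (M *v axis i 1) (M *v axis j 1)"
    and "wirtb j (wirt l (\<lambda>y. f (M *v y))) v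
      = (\<Sum>k\<in>UNIV. M $ k $ l * (\<Sum>m\<in>UNIV. cnj (M $ m $ j) * wirtb m (wirt k f) (M *v v)))"
    and "wirtb j (wirtb l (\<lambda>y. f (M *v y))) v
      = (\<Sum>k\<in>UNIV. cnj (M $ k $ l) * (\<Sum>m\<in>UNIV. cnj (M $ m $ j) * wirtb m (wirtb k f) (M *v v)))"
proof -
  have m: "v \<in> - {0}" using assms by simp
  have "wirt i (wirtb j (\<lambda>y. f (M *v y))) v = wirt i (\<lambda>v. \<Sum>k\<in>UNIV. cnj (M $ k $ j) * wirtb k f (M *v v)) v"
    by (rule wirt_cong_open(1)[OF open_nonzero m, symmetric])
       (simp_all add: wirt_change1 differentiable_change1 assms)
  also have "\<dots> = (\<Sum>k\<in>UNIV. cnj (M $ k $ j) * (\<Sum>m\<in>UNIV. M $ m $ i * wirt m (wirtb k f) (M *v v)))"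
    by (rule wirt_matrix_sum(1)) (rule differentiable_w[OF M[OF assms]])
  also have "\<dots> = levi f (M *v v) (M *v axis i 1) (M *v axis j 1)"
    unfolding levi_def matrix_axis by (subst sum.swap) (simp add: sum_distrib_left mult_ac)
  finally show "wirt i (wirtb j (\<lambda>y. f (M *v y))) v = levi f (M *v v) (M *v axis i 1) (M *v axis j 1)" .
  have "wirtb j (wirt l (\<lambda>y. f (M *v y))) v = wirtb j (\<lambda>v. \<Sum>k\<in>UNIV. M $ k $ l * wirt k f (M *v v)) v"
    by (rule wirt_cong_open(2)[OF open_nonzero m, symmetric])
       (simp_all add: wirt_change1 differentiable_change1 assms)
  also have "\<dots> = (\<Sum>k\<in>UNIV. M $ k $ l * (\<Sum>m\<in>UNIV. cnj (M $ m $ j) * wirtb m (wirt k f) (M *v v)))"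
    by (rule wirt_matrix_sum(2)) (rule differentiable_w[OF M[OF assms]])
  finally show "wirtb j (wirt l (\<lambda>y. f (M *v y))) v
      = (\<Sum>k\<in>UNIV. M $ k $ l * (\<Sum>m\<in>UNIV. cnj (M $ m $ j) * wirtb m (wirt k f) (M *v v)))" .
  have "wirtb j (wirtb l (\<lambda>y. f (M *v y))) v = wirtb j (\<lambda>v. \<Sum>k\<in>UNIV. cnj (M $ k $ l) * wirtb k f (M *v v)) v"
    by (rule wirt_cong_open(2)[OF open_nonzero m, symmetric])
       (simp_all add: wirt_change1 differentiable_change1 assms)
  also have "\<dots> = (\<Sum>k\<in>UNIV. cnj (M $ k $ l) * (\<Sum>m\<in>UNIV. cnj (M $ m $ j) * wirtb m (wirtb k f) (M *v v)))"
    by (rule wirt_matrix_sum(2)) (rule differentiable_w[OF M[OF assms]])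
  finally show "wirtb j (wirtb l (\<lambda>y. f (M *v y))) v
      = (\<Sum>k\<in>UNIV. cnj (M $ k $ l) * (\<Sum>m\<in>UNIV. cnj (M $ m $ j) * wirtb m (wirtb k f) (M *v v)))" .
qed

lemma differentiable_w3:
  assumes "v \<noteq> 0"
  shows "wirtb m (wirt k f) differentiable (at v)" "wirtb m (wirtb k f) differentiable (at v)"
  by (rule smooth_on_differentiable[OF smooth_w(2)[OF smooth_w(1)[OF smooth]]], simp add: assms)
     (rule smooth_on_differentiable[OF smooth_w(2)[OF smooth_w(2)[OF smooth]]], simp add: assms)

lemma wirt_change3:
  assumes "v \<noteq> 0"
  shows "wirt i (wirtb j (wirt l (\<lambda>y. f (M *v y)))) v
      = cart f (M *v v) (M *v axis i 1) (M *v axis j 1) (M *v axis l 1)"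
    and "wirt i (wirtb j (wirtb l (\<lambda>y. f (M *v y)))) v
      = cartb f (M *v v) (M *v axis i 1) (M *v axis j 1) (M *v axis l 1)"
proof -
  have m: "v \<in> - {0}" using assms by simp
  have reorder: "(\<Sum>k\<in>UNIV. \<Sum>m\<in>UNIV. \<Sum>q\<in>UNIV. t k m q) = (\<Sum>q\<in>UNIV. \<Sum>m\<in>UNIV. \<Sum>k\<in>UNIV. t k m q)"
    for t :: "'n \<Rightarrow> 'n \<Rightarrow> 'n \<Rightarrow> complex"
  proof -
    have "(\<Sum>k\<in>UNIV. \<Sum>m\<in>UNIV. \<Sum>q\<in>UNIV. t k m q) = (\<Sum>m\<in>UNIV. \<Sum>k\<in>UNIV. \<Sum>q\<in>UNIV. t k m q)"
      by (rule sum.swap)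
    also have "\<dots> = (\<Sum>m\<in>UNIV. \<Sum>q\<in>UNIV. \<Sum>k\<in>UNIV. t k m q)"
      by (intro sum.cong refl sum.swap)
    also have "\<dots> = (\<Sum>q\<in>UNIV. \<Sum>m\<in>UNIV. \<Sum>k\<in>UNIV. t k m q)"
      by (rule sum.swap)
    finally show ?thesis .
  qed
  have d: "(\<lambda>v. \<Sum>k\<in>UNIV. \<alpha> k * (\<Sum>m\<in>UNIV. \<beta> m * wirtb m (wirt k f) (M *v v))) differentiable (at v)"
    "(\<lambda>v. \<Sum>k\<in>UNIV. \<alpha> k * (\<Sum>m\<in>UNIV. \<beta> m * wirtb m (wirtb k f) (M *v v))) differentiable (at v)"
    for \<alpha> \<beta> :: "'n \<Rightarrow> complex"
    by (intro differentiable_sum' differentiable_mult differentiable_const differentiable_matrix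
        differentiable_w3 assms M)+
  \<comment> \<open>A double sum is read as one sum over pairs, so that the chain rule for finite
    combinations applies to the second derivatives as well.\<close>
  have pair: "(\<Sum>km\<in>UNIV. t (fst km) (snd km)) = (\<Sum>k\<in>UNIV. \<Sum>m\<in>UNIV. t k m)"
    for t :: "'n \<Rightarrow> 'n \<Rightarrow> complex"
    by (simp add: sum.cartesian_product split_def)
  have s: "(\<Sum>k\<in>UNIV. \<alpha> k * (\<Sum>m\<in>UNIV. \<beta> m * h m k v)) = (\<Sum>km\<in>UNIV. (\<alpha> (fst km) * \<beta> (snd km)) * h (snd km) (fst km) v)"
    for \<alpha> \<beta> :: "'n \<Rightarrow> complex" and h :: "'n \<Rightarrow> 'n \<Rightarrow> complex^'n \<Rightarrow> complex" and v
    using pair[of "\<lambda>k m. \<alpha> k * \<beta> m * h m k v"] by (simp add: sum_distrib_left mult_ac)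
  have dd: "wirt i (\<lambda>v. \<Sum>k\<in>UNIV. \<alpha> k * (\<Sum>m\<in>UNIV. \<beta> m * h m k (M *v v))) v
    = (\<Sum>k\<in>UNIV. \<Sum>m\<in>UNIV. \<Sum>q\<in>UNIV. \<alpha> k * \<beta> m * M $ q $ i * wirt q (h m k) (M *v v))"
    if "\<And>m k. h m k differentiable (at (M *v v))"
    for \<alpha> \<beta> :: "'n \<Rightarrow> complex" and h :: "'n \<Rightarrow> 'n \<Rightarrow> complex^'n \<Rightarrow> complex"
  proof -
    have "wirt i (\<lambda>v. \<Sum>k\<in>UNIV. \<alpha> k * (\<Sum>m\<in>UNIV. \<beta> m * h m k (M *v v))) v
        = (\<Sum>km\<in>UNIV. (\<alpha> (fst km) * \<beta> (snd km)) * (\<Sum>q\<in>UNIV. M $ q $ i * wirt q (h (snd km) (fst km)) (M *v v)))"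
      unfolding s by (rule wirt_matrix_sum(1)) (rule that)
    then show ?thesis
      using pair[of "\<lambda>k m. \<alpha> k * \<beta> m * (\<Sum>q\<in>UNIV. M $ q $ i * wirt q (h m k) (M *v v))"]
      by (simp add: sum_distrib_left mult_ac)
  qed
  have "wirt i (wirtb j (wirt l (\<lambda>y. f (M *v y)))) v
    = wirt i (\<lambda>v. \<Sum>k\<in>UNIV. M $ k $ l * (\<Sum>m\<in>UNIV. cnj (M $ m $ j) * wirtb m (wirt k f) (M *v v))) v"
    by (rule wirt_cong_open(1)[OF open_nonzero m, symmetric]) (simp_all add: wirt_change2 d)
  also have "\<dots> = (\<Sum>k\<in>UNIV. \<Sum>m\<in>UNIV. \<Sum>q\<in>UNIV.
      M $ k $ l * cnj (M $ m $ j) * M $ q $ i * wirt q (wirtb m (wirt k f)) (M *v v))"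
    by (rule dd) (rule differentiable_w3[OF M[OF assms]])
  also have "\<dots> = (\<Sum>q\<in>UNIV. \<Sum>m\<in>UNIV. \<Sum>k\<in>UNIV.
      M $ k $ l * cnj (M $ m $ j) * M $ q $ i * wirt q (wirtb m (wirt k f)) (M *v v))"
    by (rule reorder)
  finally show "wirt i (wirtb j (wirt l (\<lambda>y. f (M *v y)))) v
      = cart f (M *v v) (M *v axis i 1) (M *v axis j 1) (M *v axis l 1)"
    unfolding cart_def matrix_axis by (simp only: mult_ac)
  have "wirt i (wirtb j (wirtb l (\<lambda>y. f (M *v y)))) v
    = wirt i (\<lambda>v. \<Sum>k\<in>UNIV. cnj (M $ k $ l) * (\<Sum>m\<in>UNIV. cnj (M $ m $ j) * wirtb m (wirtb k f) (M *v v))) v"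
    by (rule wirt_cong_open(1)[OF open_nonzero m, symmetric]) (simp_all add: wirt_change2 d)
  also have "\<dots> = (\<Sum>k\<in>UNIV. \<Sum>m\<in>UNIV. \<Sum>q\<in>UNIV.
      cnj (M $ k $ l) * cnj (M $ m $ j) * M $ q $ i * wirt q (wirtb m (wirtb k f)) (M *v v))"
    by (rule dd) (rule differentiable_w3[OF M[OF assms]])
  also have "\<dots> = (\<Sum>q\<in>UNIV. \<Sum>m\<in>UNIV. \<Sum>k\<in>UNIV.
      cnj (M $ k $ l) * cnj (M $ m $ j) * M $ q $ i * wirt q (wirtb m (wirtb k f)) (M *v v))"
    by (rule reorder)
  finally show "wirt i (wirtb j (wirtb l (\<lambda>y. f (M *v y)))) v
      = cartb f (M *v v) (M *v axis i 1) (M *v axis j 1) (M *v axis l 1)"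
    unfolding cartb_def matrix_axis by (simp only: mult_ac)
qed

end

text \<open>Tensoriality of g. It transfers positivity from a coordinate frame to the left-invariant
  frame, and the metric from the latter to any other frame.\<close>

lemma levi_change:
  fixes M :: "complex^'n^'n"
  assumes "\<And>v. v \<noteq> 0 \<Longrightarrow> M *v v \<noteq> 0" "v \<noteq> 0"
  shows "levi (\<lambda>y. f (M *v y)) v x y = levi f (M *v v) (M *v x) (M *v y)"
proof -
  have 1: "levi f (M *v v) (M *v x) w = (\<Sum>i\<in>UNIV. x $ i * levi f (M *v v) (M *v axis i 1) w)" for w
    by (rule functional_basis) (simp_all add: matrix_vector_right_distrib matrix_scale levi_add1 levi_scale1)
  have 2: "levi f (M *v v) w (M *v y) = (\<Sum>j\<in>UNIV. cnj (y $ j) * levi f (M *v v) w (M *v axis j 1))" for w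
    by (rule antifunctional_basis) (simp_all add: matrix_vector_right_distrib matrix_scale levi_add2 levi_scale2)
  have w: "wirt i (wirtb j (\<lambda>y. f (M *v y))) v = levi f (M *v v) (M *v axis i 1) (M *v axis j 1)" for i j
    by (rule wirt_change2(1), erule assms(1), rule assms(2))
  show ?thesis
    unfolding 1[of "M *v y"] unfolding 2 unfolding levi_def[of "\<lambda>y. f (M *v y)"] w
    by (simp add: sum_distrib_left mult_ac)
qed

lemma cart_change_sum:
  fixes M :: "complex^'n^'n"
  assumes "\<And>v. v \<noteq> 0 \<Longrightarrow> M *v v \<noteq> 0" "v \<noteq> 0"
  shows "(\<Sum>l\<in>UNIV. wirt i (wirtb j (wirt l (\<lambda>y. f (M *v y)))) v * x $ l)
      = cart f (M *v v) (M *v axis i 1) (M *v axis j 1) (M *v x)"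
    and "(\<Sum>l\<in>UNIV. wirt i (wirtb j (wirtb l (\<lambda>y. f (M *v y)))) v * cnj (x $ l))
      = cartb f (M *v v) (M *v axis i 1) (M *v axis j 1) (M *v x)"
proof -
  have 1: "cart f (M *v v) a b (M *v x) = (\<Sum>l\<in>UNIV. x $ l * cart f (M *v v) a b (M *v axis l 1))" for a b
    by (rule functional_basis) (simp_all add: matrix_vector_right_distrib matrix_scale cart_add3 cart_scale3)
  have 2: "cartb f (M *v v) a b (M *v x) = (\<Sum>l\<in>UNIV. cnj (x $ l) * cartb f (M *v v) a b (M *v axis l 1))" for a b
    by (rule antifunctional_basis) (simp_all add: matrix_vector_right_distrib matrix_scale cartb_add3 cartb_scale3)
  have w: "wirt i (wirtb j (wirt l (\<lambda>y. f (M *v y)))) v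
      = cart f (M *v v) (M *v axis i 1) (M *v axis j 1) (M *v axis l 1)"
    "wirt i (wirtb j (wirtb l (\<lambda>y. f (M *v y)))) v
      = cartb f (M *v v) (M *v axis i 1) (M *v axis j 1) (M *v axis l 1)" for l
    by (rule wirt_change3, erule assms(1), rule assms(2))+
  show "(\<Sum>l\<in>UNIV. wirt i (wirtb j (wirt l (\<lambda>y. f (M *v y)))) v * x $ l)
      = cart f (M *v v) (M *v axis i 1) (M *v axis j 1) (M *v x)"
    "(\<Sum>l\<in>UNIV. wirt i (wirtb j (wirtb l (\<lambda>y. f (M *v y)))) v * cnj (x $ l))
      = cartb f (M *v v) (M *v axis i 1) (M *v axis j 1) (M *v x)"
    unfolding 1[of "M *v axis i 1" "M *v axis j 1"] 2[of "M *v axis i 1" "M *v axis j 1"] w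
    by (simp_all add: mult.commute)
qed

end

section \<open>Charts and tangent vectors\<close>

text \<open>A complex linear differential commutes with the splitting of \<open>Z\<close> into real
  vectors, so types are preserved and the (0,1)-part is mapped by the conjugate
  differential.\<close>

lemma push_holomorphic:
  fixes h :: "complex^'n \<Rightarrow> complex^'n"
  assumes d: "h differentiable (at x)"
    and h: "\<And>a z. frechet_derivative h (at x) (a *s z) = a *s frechet_derivative h (at x) z"
  shows "push h x (a, b) = (frechet_derivative h (at x) a, vcnj (frechet_derivative h (at x) (vcnj b)))"
proof -
  let ?D = "frechet_derivative h (at x)"
  have lin: "?D (u + w) = ?D u + ?D w" for u w
    by (rule linear_add[OF linear_frechet_derivative[OF d]])
  have e: "fst Z = cre Z + \<i> *s cim Z" "snd Z = vcnj (cre Z + (- \<i>) *s cim Z)" for Z :: "'n cvec"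
    by (simp_all add: cre_def cim_def vec_eq_iff field_simps)
  have "fst (push h x Z) = ?D (fst Z)" for Z
    unfolding e(1)[of "push h x Z"] push_frechet[OF d] e(1)[of Z] lin h ..
  moreover have "snd (push h x Z) = vcnj (?D (vcnj (snd Z)))" for Z
    unfolding e(2)[of "push h x Z"] push_frechet[OF d] e(2)[of Z] vcnj_vcnj lin h ..
  ultimately show ?thesis by (simp add: prod_eq_iff)
qed

lemma push_ident: "push (\<lambda>x. x) x Z = Z"
proof -
  have d: "(\<lambda>y::complex^'a. y $ i) differentiable (at x)" for i x by (rule differentiable_nth) simp
  show ?thesis
    by (cases Z) (simp add: push_def dderiv_nth dderiv_cnj[OF d] pcnj_def vec_eq_iff)
qed

locale complex_mfd =
  fixes X :: "'a topology" and A :: "('a, 'n::finite) chart set"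
  assumes cm: "complex_manifold X A"
begin

lemma chart_open: "c \<in> A \<Longrightarrow> openin X (fst c)"
  using cm unfolding complex_manifold_def by blast

lemma chart_inj:
  assumes "c \<in> A"
  shows "inj_on (snd c) (fst c)"
proof -
  have "homeomorphic_map (subtopology X (fst c)) (top_of_set (snd c ` fst c)) (snd c)"
    using cm assms unfolding complex_manifold_def by blast
  moreover have "topspace (subtopology X (fst c)) = fst c"
    using openin_subset[OF chart_open[OF assms]] by auto
  ultimately show ?thesis by (metis homeomorphic_imp_injective_map)
qed

lemma chart_inv_chart: "c \<in> A \<Longrightarrow> p \<in> fst c \<Longrightarrow> chart_inv c (snd c p) = p"
  unfolding chart_inv_def by (simp add: chart_inj)

lemma chart_inv_in:
  assumes "c \<in> A" "x \<in> snd c ` fst c"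
  shows "chart_inv c x \<in> fst c" "snd c (chart_inv c x) = x"
  using assms(2) unfolding chart_inv_def by (simp_all add: inv_into_into f_inv_into_f)

lemma chart_image_open:
  assumes "c \<in> A" "openin X U"
  shows "open (snd c ` (U \<inter> fst c))"
proof -
  have h: "homeomorphic_map (subtopology X (fst c)) (top_of_set (snd c ` fst c)) (snd c)"
    and o: "open (snd c ` fst c)"
    using cm assms(1) unfolding complex_manifold_def by blast+
  have "openin (subtopology X (fst c)) (U \<inter> fst c)"
    using assms(2) by (auto simp: openin_subtopology)
  then have "openin (top_of_set (snd c ` fst c)) (snd c ` (U \<inter> fst c))"
    using homeomorphic_map_openness_eq[OF h] by blast
  then show ?thesis using o openin_open_eq by blast
qed

lemma charts_atD: "c \<in> charts_at A p \<Longrightarrow> c \<in> A" "c \<in> charts_at A p \<Longrightarrow> p \<in> fst c"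
  by (simp_all add: charts_at_def)

lemma charts_at_topspace: "c \<in> charts_at A p \<Longrightarrow> p \<in> topspace X"
  using openin_subset[OF chart_open[OF charts_atD(1)]] charts_atD(2) by blast

lemma chart_at_in:
  assumes "p \<in> topspace X"
  shows "chart_at A p \<in> charts_at A p"
proof -
  have "p \<in> (\<Union>c\<in>A. fst c)" using cm assms unfolding complex_manifold_def by blast
  then have "\<exists>c. c \<in> charts_at A p" by (auto simp: charts_at_def)
  then show ?thesis unfolding chart_at_def by (rule someI_ex)
qed

lemma transition:
  assumes "c \<in> A" "d \<in> A"
  shows "open (snd c ` (fst c \<inter> fst d))" "smooth_on (snd c ` (fst c \<inter> fst d)) (snd d \<circ> chart_inv c)"
    and "x \<in> snd c ` (fst c \<inter> fst d) \<Longrightarrow>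
      frechet_derivative (snd d \<circ> chart_inv c) (at x) (a *s z) = a *s frechet_derivative (snd d \<circ> chart_inv c) (at x) z"
proof -
  show "open (snd c ` (fst c \<inter> fst d))"
    using chart_image_open[OF assms(1) chart_open[OF assms(2)]] by (simp add: Int_commute)
  have h: "holomorphic_map_on (snd c ` (fst c \<inter> fst d)) (snd d \<circ> chart_inv c)"
    using cm assms unfolding complex_manifold_def by blast
  then show "smooth_on (snd c ` (fst c \<inter> fst d)) (snd d \<circ> chart_inv c)"
    unfolding holomorphic_map_on_def by blast
  show "x \<in> snd c ` (fst c \<inter> fst d) \<Longrightarrow>
      frechet_derivative (snd d \<circ> chart_inv c) (at x) (a *s z) = a *s frechet_derivative (snd d \<circ> chart_inv c) (at x) z"
    using h unfolding holomorphic_map_on_def by blast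
qed

lemma transition_at:
  assumes "c \<in> charts_at A p" "d \<in> charts_at A p"
  shows "(snd d \<circ> chart_inv c) differentiable (at (snd c p))"
    and "push (snd d \<circ> chart_inv c) (snd c p) (a, b)
      = (frechet_derivative (snd d \<circ> chart_inv c) (at (snd c p)) a,
         vcnj (frechet_derivative (snd d \<circ> chart_inv c) (at (snd c p)) (vcnj b)))"
proof -
  have i: "snd c p \<in> snd c ` (fst c \<inter> fst d)" using assms by (auto simp: charts_at_def)
  note t = transition[OF charts_atD(1)[OF assms(1)] charts_atD(1)[OF assms(2)]]
  show d: "(snd d \<circ> chart_inv c) differentiable (at (snd c p))"
    by (rule smooth_on_differentiable[OF t(2) i])
  show "push (snd d \<circ> chart_inv c) (snd c p) (a, b)
      = (frechet_derivative (snd d \<circ> chart_inv c) (at (snd c p)) a,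
         vcnj (frechet_derivative (snd d \<circ> chart_inv c) (at (snd c p)) (vcnj b)))"
    by (rule push_holomorphic[OF d t(3)[OF i]])
qed

section \<open>Complexified tangent vectors and their types\<close>

lemma ctangent_transition:
  "Z \<in> ctangent A p \<Longrightarrow> c \<in> charts_at A p \<Longrightarrow> d \<in> charts_at A p
    \<Longrightarrow> Z d = push (snd d \<circ> chart_inv c) (snd c p) (Z c)"
  unfolding ctangent_def by blast

lemma ctangent_outside: "Z \<in> ctangent A p \<Longrightarrow> c \<notin> charts_at A p \<Longrightarrow> Z c = 0"
  unfolding ctangent_def by blast

text \<open>The transformation law determines all components from those in one chart; equalities of
  tangent vectors are therefore checked in a single chart.\<close>

lemma ctangent_eqI:
  assumes "Y \<in> ctangent A p" "Z \<in> ctangent A p" "c \<in> charts_at A p" "Y c = Z c"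
  shows "Y = Z"
proof
  fix d show "Y d = Z d"
    using ctangent_transition[OF assms(1,3), of d] ctangent_transition[OF assms(2,3), of d]
      ctangent_outside[OF assms(1), of d] ctangent_outside[OF assms(2), of d] assms(4)
    by (cases "d \<in> charts_at A p") simp_all
qed

lemma ctangentI:
  assumes "\<And>c. c \<notin> charts_at A p \<Longrightarrow> Z c = 0"
    and "\<And>c d. c \<in> charts_at A p \<Longrightarrow> d \<in> charts_at A p \<Longrightarrow> Z d = push (snd d \<circ> chart_inv c) (snd c p) (Z c)"
  shows "Z \<in> ctangent A p"
  using assms unfolding ctangent_def by blast

lemma ctangent_tadd:
  assumes "Y \<in> ctangent A p" "Z \<in> ctangent A p"
  shows "tadd Y Z \<in> ctangent A p"
proof (rule ctangentI)
  show "tadd Y Z c = 0" if "c \<notin> charts_at A p" for c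
    by (simp add: tadd_def ctangent_outside[OF assms(1) that] ctangent_outside[OF assms(2) that])
  show "tadd Y Z d = push (snd d \<circ> chart_inv c) (snd c p) (tadd Y Z c)"
    if "c \<in> charts_at A p" "d \<in> charts_at A p" for c d
    by (simp only: tadd_def push_add ctangent_transition[OF assms(1) that] ctangent_transition[OF assms(2) that])
qed

lemma ctangent_tscale:
  assumes "Z \<in> ctangent A p"
  shows "tscale a Z \<in> ctangent A p"
proof (rule ctangentI)
  show "tscale a Z c = 0" if "c \<notin> charts_at A p" for c
    by (simp add: tscale_def ctangent_outside[OF assms that] zero_prod_def)
  show "tscale a Z d = push (snd d \<circ> chart_inv c) (snd c p) (tscale a Z c)"
    if "c \<in> charts_at A p" "d \<in> charts_at A p" for c d
    by (simp add: tscale_def push_scale ctangent_transition[OF assms that])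
qed

lemma ctangent_zero: "(\<lambda>c. 0) \<in> ctangent A p"
  by (intro ctangentI) simp_all

lemma tlin_sum: "tlin \<xi> E c = (\<Sum>i\<in>UNIV. (\<xi> $ i *s fst (E i c), \<xi> $ i *s snd (E i c)))"
  by (simp add: tlin_def prod_eq_iff fst_sum snd_sum)

lemma push_sum: "push h x (\<Sum>i\<in>I. Z i) = (\<Sum>i\<in>I. push h x (Z i))"
  by (induction I rule: infinite_finite_induct) (simp_all add: push_add)

lemma push_tlin: "push h x (tlin \<xi> E c) = (\<Sum>i\<in>UNIV. (\<xi> $ i *s fst (push h x (E i c)), \<xi> $ i *s snd (push h x (E i c))))"
  by (simp add: tlin_sum push_sum push_scale)

lemma ctangent_tlin:
  assumes "\<And>i. E i \<in> ctangent A p"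
  shows "tlin \<xi> E \<in> ctangent A p"
proof (rule ctangentI)
  show "tlin \<xi> E c = 0" if "c \<notin> charts_at A p" for c
    using ctangent_outside[OF assms that] by (simp add: tlin_def zero_prod_def)
  show "tlin \<xi> E d = push (snd d \<circ> chart_inv c) (snd c p) (tlin \<xi> E c)"
    if "c \<in> charts_at A p" "d \<in> charts_at A p" for c d
    unfolding push_tlin unfolding ctangent_transition[OF assms that, symmetric] by (rule tlin_sum)
qed

lemma ctangent_tconj:
  assumes "Z \<in> ctangent A p"
  shows "tconj Z \<in> ctangent A p"
proof (rule ctangentI)
  show "tconj Z c = 0" if "c \<notin> charts_at A p" for c
    by (simp add: tconj_def ctangent_outside[OF assms that] pcnj_def zero_prod_def)
  show "tconj Z d = push (snd d \<circ> chart_inv c) (snd c p) (tconj Z c)"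
    if "c \<in> charts_at A p" "d \<in> charts_at A p" for c d
    by (simp only: tconj_def push_pcnj[OF transition_at(1)[OF that]] ctangent_transition[OF assms that])
qed

text \<open>The type components satisfy the transformation law because transition maps are
  holomorphic and do not mix the two types.\<close>

lemma ctangent_part:
  assumes "Z \<in> ctangent A p"
  shows "part10 Z \<in> ctangent A p" "part01 Z \<in> ctangent A p"
proof -
  have *: "fst (Z d) = fst (push (snd d \<circ> chart_inv c) (snd c p) (fst (Z c), b))"
    "snd (Z d) = snd (push (snd d \<circ> chart_inv c) (snd c p) (a, snd (Z c)))"
    "fst (push (snd d \<circ> chart_inv c) (snd c p) (0, b)) = 0"
    "snd (push (snd d \<circ> chart_inv c) (snd c p) (a, 0)) = 0"
    if cd: "c \<in> charts_at A p" "d \<in> charts_at A p" for c d a b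
  proof -
    have z: "frechet_derivative (snd d \<circ> chart_inv c) (at (snd c p)) 0 = 0"
      by (rule linear_0[OF linear_frechet_derivative[OF transition_at(1)[OF cd]]])
    have Z: "Z d = push (snd d \<circ> chart_inv c) (snd c p) (fst (Z c), snd (Z c))"
      using ctangent_transition[OF assms cd] by simp
    show "fst (Z d) = fst (push (snd d \<circ> chart_inv c) (snd c p) (fst (Z c), b))"
      "snd (Z d) = snd (push (snd d \<circ> chart_inv c) (snd c p) (a, snd (Z c)))"
      "fst (push (snd d \<circ> chart_inv c) (snd c p) (0, b)) = 0"
      "snd (push (snd d \<circ> chart_inv c) (snd c p) (a, 0)) = 0"
      unfolding Z transition_at(2)[OF cd] by (simp_all add: z)
  qed
  show "part10 Z \<in> ctangent A p" "part01 Z \<in> ctangent A p"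
    by (rule ctangentI;
        simp add: part10_def part01_def prod_eq_iff *(3,4) *(1,2)[symmetric] ctangent_outside[OF assms])+
qed

text \<open>The chain rule for transition maps, together with the identity as transition from a
  chart to itself, makes the pushed components consistent.\<close>

lemma tvec_of_at:
  assumes "c \<in> charts_at A p"
  shows "tvec_of A c p z \<in> ctangent A p" "tvec_of A c p z c = z"
proof -
  have comp: "push (snd d \<circ> chart_inv c) (snd c p) z
      = push (snd d \<circ> chart_inv b) (snd b p) (push (snd b \<circ> chart_inv c) (snd c p) z)"
    if b: "b \<in> charts_at A p" and d: "d \<in> charts_at A p" for b d z
  proof -
    note A = charts_atD(1)[OF assms] charts_atD(1)[OF b] charts_atD(1)[OF d]
    have e: "(snd b \<circ> chart_inv c) (snd c p) = snd b p"
      using chart_inv_chart[OF A(1)] assms by (simp add: charts_at_def)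
    have "push (\<lambda>y. (snd d \<circ> chart_inv b) ((snd b \<circ> chart_inv c) y)) (snd c p) z
        = push (snd d \<circ> chart_inv b) (snd b p) (push (snd b \<circ> chart_inv c) (snd c p) z)"
      using push_compose[OF transition_at(1)[OF assms b], of "snd d \<circ> chart_inv b" z]
        transition_at(1)[OF b d] e by simp
    moreover have "push (snd d \<circ> chart_inv c) (snd c p) z
        = push (\<lambda>y. (snd d \<circ> chart_inv b) ((snd b \<circ> chart_inv c) y)) (snd c p) z"
    proof (rule push_cong_open[OF _ _ _ transition_at(1)[OF assms d]])
      show "open (snd c ` (fst b \<inter> fst c))" by (rule chart_image_open[OF A(1) chart_open[OF A(2)]])
      show "snd c p \<in> snd c ` (fst b \<inter> fst c)" using assms b by (auto simp: charts_at_def)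
      show "(snd d \<circ> chart_inv c) y = (snd d \<circ> chart_inv b) ((snd b \<circ> chart_inv c) y)"
        if "y \<in> snd c ` (fst b \<inter> fst c)" for y
        using that chart_inv_chart[OF A(1)] chart_inv_chart[OF A(2)] by auto
    qed
    ultimately show ?thesis by simp
  qed
  show "tvec_of A c p z \<in> ctangent A p"
    by (rule ctangentI) (simp_all add: tvec_of_def comp[symmetric])
  have "push (\<lambda>x. x) (snd c p) z = push (snd c \<circ> chart_inv c) (snd c p) z"
  proof (rule push_cong_open)
    show "open (snd c ` (fst c \<inter> fst c))"
      by (rule chart_image_open[OF charts_atD(1)[OF assms] chart_open[OF charts_atD(1)[OF assms]]])
    show "snd c p \<in> snd c ` (fst c \<inter> fst c)" using assms by (auto simp: charts_at_def)
    show "y = (snd c \<circ> chart_inv c) y" if "y \<in> snd c ` (fst c \<inter> fst c)" for y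
      using that chart_inv_chart[OF charts_atD(1)[OF assms]] by auto
  qed simp
  then show "tvec_of A c p z c = z" using assms by (simp add: tvec_of_def push_ident)
qed

lemma T10_iff: "Z \<in> T10 A p \<longleftrightarrow> Z \<in> ctangent A p \<and> (\<forall>c. snd (Z c) = 0)"
proof -
  have "(- \<i>) *s b = \<i> *s b \<longleftrightarrow> b = 0" for b :: "complex^'n"
    by (auto simp: vec_eq_iff complex_eq_iff)
  then show ?thesis
    unfolding T10_def cplx_str_def tscale_def by (simp add: fun_eq_iff)
qed

lemma part10_T10: "Z \<in> ctangent A p \<Longrightarrow> part10 Z \<in> T10 A p"
  unfolding T10_iff using ctangent_part(1) by (auto simp: part10_def)

lemma tlin_T10:
  assumes "\<And>i. E i \<in> T10 A p"
  shows "tlin \<xi> E \<in> T10 A p"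
  using assms ctangent_tlin[of E p] unfolding T10_iff by (simp add: tlin_def)

end

section \<open>Frames\<close>

definition coef :: "('n \<Rightarrow> ('a, 'n::finite) field) \<Rightarrow> 'a \<Rightarrow> ('a, 'n) tvec \<Rightarrow> complex^'n" where
  "coef e p Z = (\<chi> i. coframe e i p Z)"

lemma coframe_coef: "coframe f i p Z = coef f p Z $ i"
  by (simp add: coef_def)

definition frame_matrix :: "('n \<Rightarrow> ('a, 'n::finite) field) \<Rightarrow> ('a, 'n) chart \<Rightarrow> 'a \<Rightarrow> complex^'n^'n" where
  "frame_matrix e c p = (\<chi> m k. fst (e k p c) $ m)"

definition dmatrix :: "(complex^'n \<Rightarrow> complex^'n^'n) \<Rightarrow> complex^'n \<Rightarrow> 'n::finite cvec \<Rightarrow> complex^'n^'n" where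
  "dmatrix M x z = (\<chi> m k. dderiv (\<lambda>y. M y $ m $ k) x z)"

lemma dmatrix_add: "dmatrix M x (y + z) = dmatrix M x y + dmatrix M x z"
  by (simp add: dmatrix_def dderiv_add_vec vec_eq_iff)

lemma dmatrix_scale: "dmatrix M x (a *s p, a *s q) *v w = a *s (dmatrix M x (p, q) *v w)"
  by (simp add: dmatrix_def dderiv_scale_vec vec_eq_iff matrix_vector_mult_def sum_distrib_left mult.assoc)

lemma dderiv_matrix_vector:
  fixes M :: "complex^'n \<Rightarrow> complex^'n^'n" and y :: "complex^'n \<Rightarrow> complex^'n"
  assumes "\<And>m k. (\<lambda>x. M x $ m $ k) differentiable (at x)" "\<And>k. (\<lambda>x. y x $ k) differentiable (at x)"
  shows "dderiv (\<lambda>x. (M x *v y x) $ m) x z = (dmatrix M x z *v y x) $ m + (M x *v (\<chi> k. dderiv (\<lambda>x. y x $ k) x z)) $ m"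
  unfolding matrix_vector_mult_def dmatrix_def using assms
  by (simp add: dderiv_sum dderiv_mult differentiable_mult sum.distrib)

lemma dderiv_matrix_const:
  fixes M :: "complex^'n \<Rightarrow> complex^'n^'n"
  assumes "\<And>m k. (\<lambda>x. M x $ m $ k) differentiable (at x)"
  shows "dderiv (\<lambda>x. (M x *v w) $ m) x z = (dmatrix M x z *v w) $ m"
proof -
  have "(\<chi> k. dderiv (\<lambda>x. w $ k) x z) = 0" by (simp add: vec_eq_iff)
  then show ?thesis using dderiv_matrix_vector[of M x "\<lambda>x. w" m z] assms by simp
qed

lemma frame_matrix_mult: "frame_matrix e c p *v \<xi> = fst (tlin \<xi> (\<lambda>i. e i p) c)"
  by (simp add: frame_matrix_def tlin_def matrix_vector_mult_def vec_eq_iff mult.commute sum_component)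

context complex_mfd
begin

text \<open>The pointwise content of \<open>local_frame\<close>, isolated because the linear algebra
  of the coframe takes place at a single point.\<close>

definition basis_at :: "('n \<Rightarrow> ('a, 'n) field) \<Rightarrow> 'a \<Rightarrow> bool" where
  "basis_at e p \<longleftrightarrow> p \<in> topspace X \<and> (\<forall>i. e i p \<in> T10 A p) \<and> (\<forall>Z\<in>T10 A p. \<exists>!\<xi>. Z = tlin \<xi> (\<lambda>i. e i p))"

lemma coef_THE: "coef e p Z = (THE \<xi>. part10 Z = tlin \<xi> (\<lambda>i. e i p))"
  by (simp add: coef_def coframe_def vec_eq_iff)

lemma coef_part10:
  assumes "basis_at e p" "Z \<in> ctangent A p"
  shows "part10 Z = tlin (coef e p Z) (\<lambda>i. e i p)"
proof -
  have "\<exists>!\<xi>. part10 Z = tlin \<xi> (\<lambda>i. e i p)"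
    using assms part10_T10[OF assms(2)] unfolding basis_at_def by blast
  from theI'[OF this] show ?thesis unfolding coef_THE .
qed

lemma basis_atD:
  assumes "basis_at e p"
  shows "e i p \<in> ctangent A p" "e i p \<in> T10 A p" "snd (e i p c) = 0" "p \<in> topspace X"
  using assms unfolding basis_at_def T10_iff by blast+

lemma frame_matrix_coef:
  assumes "basis_at e p" "Z \<in> ctangent A p"
  shows "frame_matrix e c p *v coef e p Z = fst (Z c)"
  unfolding frame_matrix_mult coef_part10[OF assms, symmetric] by (simp add: part10_def)

lemma frame_matrix_inj:
  assumes "basis_at e p" "c \<in> charts_at A p" "frame_matrix e c p *v \<xi> = 0"
  shows "\<xi> = 0"
proof -
  have t: "tlin \<xi> (\<lambda>i. e i p) \<in> T10 A p" by (rule tlin_T10) (rule basis_atD(2)[OF assms(1)])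
  have z: "(\<lambda>c. 0) = tlin 0 (\<lambda>i. e i p)" by (simp add: tlin_def fun_eq_iff zero_prod_def)
  have "tlin \<xi> (\<lambda>i. e i p) = (\<lambda>c. 0)"
  proof (rule ctangent_eqI[OF _ ctangent_zero assms(2)])
    show "tlin \<xi> (\<lambda>i. e i p) \<in> ctangent A p" using t by (simp add: T10_iff)
    have "snd (tlin \<xi> (\<lambda>i. e i p) c) = 0" using t unfolding T10_iff by blast
    then show "tlin \<xi> (\<lambda>i. e i p) c = 0"
      using assms(3) unfolding frame_matrix_mult by (simp add: prod_eq_iff)
  qed
  then show ?thesis using assms(1) t z unfolding basis_at_def by metis
qed

lemma frame_matrix_det:
  assumes "basis_at e p" "c \<in> charts_at A p"
  shows "invertible (frame_matrix e c p)" "det (frame_matrix e c p) \<noteq> 0"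
proof -
  show "invertible (frame_matrix e c p)"
    unfolding invertible_left_inverse matrix_left_invertible_ker
    using frame_matrix_inj[OF assms] by blast
  then show "det (frame_matrix e c p) \<noteq> 0" by (simp add: invertible_det_nz)
qed

lemma frame_matrix_cancel:
  assumes "basis_at e p" "c \<in> charts_at A p" "frame_matrix e c p *v \<xi> = frame_matrix e c p *v \<eta>"
  shows "\<xi> = \<eta>"
  using frame_matrix_inj[OF assms(1,2), of "\<xi> - \<eta>"] assms(3) by (simp add: matrix_vector_mult_diff_distrib)

lemma coef_eqI:
  assumes "basis_at e p" "c \<in> charts_at A p" "Z \<in> ctangent A p" "fst (Z c) = frame_matrix e c p *v \<xi>"
  shows "coef e p Z = \<xi>"
  by (rule frame_matrix_cancel[OF assms(1,2)]) (simp only: frame_matrix_coef[OF assms(1,3)] assms(4))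

lemma frame_matrix_axis: "frame_matrix e c p *v axis k 1 = fst (e k p c)"
  by (simp add: vec_eq_iff matrix_axis frame_matrix_def)

lemma coef_simps:
  assumes "basis_at e p"
  shows "coef e p (e k p) = axis k 1" "coef e p (tconj (e k p)) = 0"
    "Z \<in> ctangent A p \<Longrightarrow> coef e p (part10 Z) = coef e p Z"
    "Z \<in> ctangent A p \<Longrightarrow> coef e p (part01 Z) = 0"
    "Z \<in> ctangent A p \<Longrightarrow> coef e p (tconj (part10 Z)) = 0"
    "Z \<in> ctangent A p \<Longrightarrow> coef e p (tconj (part01 Z)) = coef e p (tconj Z)"
proof -
  note c = chart_at_in[OF basis_atD(4)[OF assms]]
  note I = coef_eqI[OF assms c]
  show "coef e p (e k p) = axis k 1"
    by (rule I) (simp_all add: basis_atD(1)[OF assms] frame_matrix_axis)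
  show "coef e p (tconj (e k p)) = 0"
    by (rule I[OF ctangent_tconj[OF basis_atD(1)[OF assms]]]) (simp add: basis_atD(3)[OF assms] tconj_def pcnj_def)
  assume Z: "Z \<in> ctangent A p"
  note F = frame_matrix_coef[OF assms]
  show "coef e p (part10 Z) = coef e p Z"
    by (rule I[OF ctangent_part(1)[OF Z]]) (simp add: F[OF Z] part10_def)
  show "coef e p (part01 Z) = 0"
    by (rule I[OF ctangent_part(2)[OF Z]]) (simp add: part01_def)
  show "coef e p (tconj (part10 Z)) = 0"
    by (rule I[OF ctangent_tconj[OF ctangent_part(1)[OF Z]]]) (simp add: part10_def tconj_def pcnj_def)
  show "coef e p (tconj (part01 Z)) = coef e p (tconj Z)"
    by (rule I[OF ctangent_tconj[OF ctangent_part(2)[OF Z]]], simp only: F[OF ctangent_tconj[OF Z]])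
       (simp add: part01_def tconj_def pcnj_def)
qed

lemma tconj_tconj [simp]: "tconj (tconj Z) = Z"
  by (simp add: tconj_def pcnj_def)

lemma ctangent_decompose:
  assumes "basis_at e p" "Z \<in> ctangent A p"
  shows "Z c = (frame_matrix e c p *v coef e p Z, vcnj (frame_matrix e c p *v coef e p (tconj Z)))"
  using frame_matrix_coef[OF assms, of c] frame_matrix_coef[OF assms(1) ctangent_tconj[OF assms(2)], of c]
  by (simp add: prod_eq_iff tconj_def pcnj_def)

text \<open>The (0,1)-part of \<open>Z\<close> is the conjugate of the (1,0)-part of
  \<open>tconj Z\<close>; this explains the conjugated coefficients in front of the conjugate frame
  vectors.\<close>

lemma linear_frame_expansion:
  fixes D :: "'n cvec \<Rightarrow> complex"
  assumes b: "basis_at e p" and Z: "Z \<in> ctangent A p"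
    and D: "\<And>y z. D (y + z) = D y + D z" "\<And>r y z. D (r *s y, r *s z) = r * D (y, z)"
  shows "D (Z c) = (\<Sum>k\<in>UNIV. coef e p Z $ k * D (e k p c) + cnj (coef e p (tconj Z) $ k) * D (tconj (e k p) c))"
proof -
  let ?M = "frame_matrix e c p"
  have z: "D 0 = 0" using D(2)[of 0 0 0] by (simp add: zero_prod_def)
  have 1: "D (?M *v x, 0) = (\<Sum>k\<in>UNIV. x $ k * D (e k p c))" for x
  proof -
    have "D (?M *v x, 0) = (\<Sum>k\<in>UNIV. x $ k * D (?M *v axis k 1, 0))"
      using D(1)[of "(_, 0)" "(_, 0)"] D(2)[of _ _ 0]
      by (intro functional_basis) (simp_all add: matrix_vector_right_distrib matrix_scale)
    moreover have "(?M *v axis k 1, 0) = e k p c" for k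
      by (simp add: frame_matrix_axis prod_eq_iff basis_atD(3)[OF b])
    ultimately show ?thesis by simp
  qed
  have s: "vcnj (a *s x) = cnj a *s vcnj x" for a and x :: "complex^'n" by (simp add: vec_eq_iff)
  have 2: "D (0, vcnj (?M *v x)) = (\<Sum>k\<in>UNIV. cnj (x $ k) * D (tconj (e k p) c))" for x
  proof -
    have "D (0, vcnj (?M *v x)) = (\<Sum>k\<in>UNIV. cnj (x $ k) * D (0, vcnj (?M *v axis k 1)))"
      using D(1)[of "(0, _)" "(0, _)"] D(2)[of _ 0]
      by (intro antifunctional_basis) (simp_all add: matrix_vector_right_distrib matrix_scale vcnj_add s)
    moreover have "(0, vcnj (?M *v axis k 1)) = tconj (e k p) c" for k
      by (simp add: frame_matrix_axis prod_eq_iff basis_atD(3)[OF b] tconj_def pcnj_def)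
    ultimately show ?thesis by simp
  qed
  have "Z c = (?M *v coef e p Z, 0) + (0, vcnj (?M *v coef e p (tconj Z)))"
    using ctangent_decompose[OF b Z, of c] by simp
  then show ?thesis by (simp only: D(1) 1 2 sum.distrib)
qed

lemma local_frame_basis:
  assumes "local_frame X A U e" "p \<in> U"
  shows "basis_at e p"
  using assms openin_subset unfolding local_frame_def basis_at_def by blast

lemma local_frame_open: "local_frame X A U e \<Longrightarrow> openin X U"
  unfolding local_frame_def by blast

lemma smooth_frame_matrix:
  assumes "local_frame X A U e" "c \<in> A"
  shows "smooth_on (snd c ` (U \<inter> fst c)) (\<lambda>x. frame_matrix e c (chart_inv c x) $ m $ k)"
proof -
  have o: "open (snd c ` (U \<inter> fst c))" by (rule chart_image_open[OF assms(2) local_frame_open[OF assms(1)]])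
  have "smooth_on (snd c ` (U \<inter> fst c)) (\<lambda>x. e k (chart_inv c x) c)"
    using assms unfolding local_frame_def smooth_field_def by blast
  from smooth_on_linear[OF o bounded_linear_compose[OF bounded_linear_vec_nth bounded_linear_fst] this, of m]
  show ?thesis by (simp add: frame_matrix_def)
qed

lemma chart_image_point:
  assumes "c \<in> A" "x \<in> snd c ` (U \<inter> fst c)"
  shows "chart_inv c x \<in> U" "c \<in> charts_at A (chart_inv c x)" "snd c (chart_inv c x) = x"
  using assms chart_inv_chart[OF assms(1)] by (auto simp: charts_at_def)

lemma matrix_inv_fst:
  assumes "basis_at e p" "c \<in> charts_at A p" "Z \<in> ctangent A p"
  shows "matrix_inv (frame_matrix e c p) *v fst (Z c) = coef e p Z"
  unfolding frame_matrix_coef[OF assms(1,3), symmetric] matrix_vector_mul_assoc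
    matrix_inv_cancel(2)[OF frame_matrix_det(1)[OF assms(1,2)]]
  by (rule matrix_vector_mul_lid)

text \<open>In a chart the coframe components of a constant-coefficient vector are the inverse frame
  matrix times a constant. Differentiating the product of matrix and components, which is constant,
  expresses the derivative of the coframe by that of the frame.\<close>

lemma ext_deriv_coframe:
  assumes "local_frame X A U e" "p \<in> U"
  defines "c \<equiv> chart_at A p"
  shows "frame_matrix e c p *v (\<chi> i. ext_deriv A (coframe e i) p Y Z)
    = dmatrix (\<lambda>x. frame_matrix e c (chart_inv c x)) (snd c p) (Z c) *v (matrix_inv (frame_matrix e c p) *v fst (Y c))
    - dmatrix (\<lambda>x. frame_matrix e c (chart_inv c x)) (snd c p) (Y c) *v (matrix_inv (frame_matrix e c p) *v fst (Z c))"
proof -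
  let ?S = "snd c ` (U \<inter> fst c)"
  let ?M = "\<lambda>x. frame_matrix e c (chart_inv c x)"
  have pX: "p \<in> topspace X" using assms(2) openin_subset[OF local_frame_open[OF assms(1)]] by blast
  have c: "c \<in> charts_at A p" "c \<in> A" unfolding c_def using chart_at_in[OF pX] charts_atD by blast+
  have o: "open ?S" by (rule chart_image_open[OF c(2) local_frame_open[OF assms(1)]])
  have pS: "snd c p \<in> ?S" using assms(2) charts_atD(2)[OF c(1)] by blast
  have inv: "chart_inv c (snd c p) = p" by (rule chart_inv_chart[OF c(2) charts_atD(2)[OF c(1)]])
  define \<phi> where "\<phi> z x = coef e (chart_inv c x) (tvec_of A c (chart_inv c x) z)" for z x
  have M\<phi>: "?M x *v \<phi> z x = fst z" if x: "x \<in> ?S" for x z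
  proof -
    note q = chart_image_point[OF c(2) x]
    have "?M x *v \<phi> z x = fst (tvec_of A c (chart_inv c x) z c)"
      unfolding \<phi>_def by (rule frame_matrix_coef[OF local_frame_basis[OF assms(1) q(1)] tvec_of_at(1)[OF q(2)]])
    then show ?thesis by (simp only: tvec_of_at(2)[OF q(2)])
  qed
  have det: "det (?M x) \<noteq> 0" if x: "x \<in> ?S" for x
    using chart_image_point[OF c(2) x] frame_matrix_det(2) local_frame_basis[OF assms(1)] by blast
  have s\<phi>: "smooth_on ?S (\<lambda>x. \<phi> z x $ k)" for z k
    by (rule smooth_on_solution[OF o, of ?M "\<lambda>x. fst z"])
       (simp_all add: smooth_frame_matrix[OF assms(1) c(2)] smooth_on_const det M\<phi>)
  have dM: "(\<lambda>x. ?M x $ m $ k) differentiable (at (snd c p))" for m k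
    by (rule smooth_on_differentiable[OF smooth_frame_matrix[OF assms(1) c(2)] pS])
  have d\<phi>: "(\<lambda>x. \<phi> z x $ k) differentiable (at (snd c p))" for z k
    by (rule smooth_on_differentiable[OF s\<phi> pS])
  \<comment> \<open>Leibniz rule for the constant product \<open>M\<phi>\<close>.\<close>
  have key: "dmatrix ?M (snd c p) y *v \<phi> z (snd c p) + frame_matrix e c p *v (\<chi> k. dderiv (\<lambda>x. \<phi> z x $ k) (snd c p) y) = 0" for y z
  proof -
    have "dderiv (\<lambda>x. (?M x *v \<phi> z x) $ m) (snd c p) y = 0" for m
    proof -
      have "dderiv (\<lambda>x. fst z $ m) (snd c p) y = dderiv (\<lambda>x. (?M x *v \<phi> z x) $ m) (snd c p) y"
        by (rule dderiv_cong_open[OF o pS]) (simp_all add: M\<phi>)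
      then show ?thesis by simp
    qed
    then show ?thesis
      by (simp add: dderiv_matrix_vector[of ?M "snd c p" "\<phi> z", OF dM d\<phi>] inv vec_eq_iff)
  qed
  have inv\<phi>: "\<phi> z (snd c p) = matrix_inv (frame_matrix e c p) *v fst z" for z
  proof -
    note i = matrix_inv_cancel(2)[OF frame_matrix_det(1)[OF local_frame_basis[OF assms(1,2)] c(1)]]
    have "fst z = frame_matrix e c p *v \<phi> z (snd c p)" using M\<phi>[OF pS, of z] inv by simp
    then show ?thesis by (simp add: matrix_vector_mul_assoc i)
  qed
  have "(\<chi> i. ext_deriv A (coframe e i) p Y Z)
      = (\<chi> k. dderiv (\<lambda>x. \<phi> (Z c) x $ k) (snd c p) (Y c)) - (\<chi> k. dderiv (\<lambda>x. \<phi> (Y c) x $ k) (snd c p) (Z c))"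
    by (simp add: ext_deriv_def c_def[symmetric] \<phi>_def coef_def vec_eq_iff)
  then have "frame_matrix e c p *v (\<chi> i. ext_deriv A (coframe e i) p Y Z)
     = frame_matrix e c p *v (\<chi> k. dderiv (\<lambda>x. \<phi> (Z c) x $ k) (snd c p) (Y c))
     - frame_matrix e c p *v (\<chi> k. dderiv (\<lambda>x. \<phi> (Y c) x $ k) (snd c p) (Z c))"
    by (simp only: matrix_vector_mult_diff_distrib)
  also have "\<dots> = dmatrix ?M (snd c p) (Z c) *v \<phi> (Y c) (snd c p) - dmatrix ?M (snd c p) (Y c) *v \<phi> (Z c) (snd c p)"
    using key[of "Y c" "Z c"] key[of "Z c" "Y c"] by (simp add: add_eq_0_iff)
  finally show ?thesis by (simp only: inv\<phi>)
qed

section \<open>Change of frame\<close>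

definition change :: "('n \<Rightarrow> ('a, 'n) field) \<Rightarrow> ('n \<Rightarrow> ('a, 'n) field) \<Rightarrow> 'a \<Rightarrow> complex^'n^'n" where
  "change e e' p = (\<chi> l k. coef e p (e' k p) $ l)"

lemma frame_matrix_change:
  assumes "basis_at e p" "basis_at e' p"
  shows "frame_matrix e' c p = frame_matrix e c p ** change e e' p"
proof -
  have "frame_matrix e' c p $ m $ k = (frame_matrix e c p ** change e e' p) $ m $ k" for m k
  proof -
    have "frame_matrix e' c p $ m $ k = (frame_matrix e c p *v coef e p (e' k p)) $ m"
      unfolding frame_matrix_coef[OF assms(1) basis_atD(1)[OF assms(2)]] by (simp add: frame_matrix_def)
    then show ?thesis by (simp add: matrix_matrix_mult_def matrix_vector_mult_def change_def)
  qed
  then show ?thesis by (simp add: vec_eq_iff)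
qed

lemma coef_change:
  assumes "basis_at e p" "basis_at e' p" "Z \<in> ctangent A p"
  shows "change e e' p *v coef e' p Z = coef e p Z"
proof (rule coef_eqI[OF assms(1) chart_at_in[OF basis_atD(4)[OF assms(1)]] assms(3), symmetric])
  show "fst (Z (chart_at A p)) = frame_matrix e (chart_at A p) p *v (change e e' p *v coef e' p Z)"
    using frame_matrix_coef[OF assms(2,3)]
    by (simp add: matrix_vector_mul_assoc frame_matrix_change[OF assms(1,2), symmetric])
qed

lemma change_inj:
  assumes "basis_at e p" "basis_at e' p" "change e e' p *v x = 0"
  shows "x = 0"
proof (rule frame_matrix_inj[OF assms(2) chart_at_in[OF basis_atD(4)[OF assms(1)]]])
  show "frame_matrix e' (chart_at A p) p *v x = 0"
    using assms(3) by (simp add: frame_matrix_change[OF assms(1,2)] matrix_vector_mul_assoc[symmetric])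
qed

lemma smooth_change:
  assumes "local_frame X A U e" "local_frame X A U' e'" "U' \<subseteq> U" "c \<in> A"
  shows "smooth_on (snd c ` (U' \<inter> fst c)) (\<lambda>x. change e e' (chart_inv c x) $ l $ k)"
proof -
  let ?S = "snd c ` (U' \<inter> fst c)"
  have o: "open ?S" by (rule chart_image_open[OF assms(4) local_frame_open[OF assms(2)]])
  have "smooth_on ?S (\<lambda>x. coef e (chart_inv c x) (e' k (chart_inv c x)) $ l)"
  proof (rule smooth_on_solution[OF o])
    show "smooth_on ?S (\<lambda>x. frame_matrix e c (chart_inv c x) $ i $ j)" for i j
      by (rule smooth_on_subset[OF smooth_frame_matrix[OF assms(1,4)]]) (use assms(3) in blast)
    show "smooth_on ?S (\<lambda>x. fst (e' k (chart_inv c x) c) $ i)" for i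
      using smooth_frame_matrix[OF assms(2,4), of i k] by (simp add: frame_matrix_def)
    fix x assume x: "x \<in> ?S"
    note q = chart_image_point[OF assms(4) x]
    have b: "basis_at e (chart_inv c x)" "basis_at e' (chart_inv c x)"
      using q(1) assms(3) local_frame_basis[OF assms(1)] local_frame_basis[OF assms(2)] by blast+
    show "det (frame_matrix e c (chart_inv c x)) \<noteq> 0" by (rule frame_matrix_det(2)[OF b(1) q(2)])
    show "frame_matrix e c (chart_inv c x) *v coef e (chart_inv c x) (e' k (chart_inv c x)) = fst (e' k (chart_inv c x) c)"
      by (rule frame_matrix_coef[OF b(1) basis_atD(1)[OF b(2)]])
  qed
  then show ?thesis by (simp add: change_def)
qed

text \<open>Leibniz rule for the factorization of the new frame matrix as the old one times the
  change of frame; the last term is what makes connection forms transform inhomogeneously.\<close>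

lemma dmatrix_change:
  assumes "local_frame X A U e" "local_frame X A U' e'" "U' \<subseteq> U" "c \<in> charts_at A p" "p \<in> U'"
  shows "dmatrix (\<lambda>x. frame_matrix e' c (chart_inv c x)) (snd c p) z *v w
    = dmatrix (\<lambda>x. frame_matrix e c (chart_inv c x)) (snd c p) z *v (change e e' p *v w)
    + frame_matrix e c p *v (dmatrix (\<lambda>x. change e e' (chart_inv c x)) (snd c p) z *v w)"
proof -
  note cA = charts_atD(1)[OF assms(4)]
  let ?S = "snd c ` (U' \<inter> fst c)"
  have o: "open ?S" by (rule chart_image_open[OF cA local_frame_open[OF assms(2)]])
  have pS: "snd c p \<in> ?S" using assms(5) charts_atD(2)[OF assms(4)] by blast
  have pS': "snd c p \<in> snd c ` (U \<inter> fst c)" using pS assms(3) by blast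
  have inv: "chart_inv c (snd c p) = p" by (rule chart_inv_chart[OF cA charts_atD(2)[OF assms(4)]])
  note d1 = smooth_on_differentiable[OF smooth_frame_matrix[OF assms(1) cA] pS']
  note d2 = smooth_on_differentiable[OF smooth_frame_matrix[OF assms(2) cA] pS]
  note d3 = smooth_on_differentiable[OF smooth_change[OF assms(1,2,3) cA] pS]
  have d4: "(\<lambda>x. (change e e' (chart_inv c x) *v w) $ k) differentiable (at (snd c p))" for k
    unfolding matrix_vector_mult_def using d3
    by (simp add: differentiable_sum' differentiable_mult)
  have d5: "(\<lambda>x. (frame_matrix e' c (chart_inv c x) *v w) $ k) differentiable (at (snd c p))" for k
    unfolding matrix_vector_mult_def using d2
    by (simp add: differentiable_sum' differentiable_mult)
  have "(dmatrix (\<lambda>x. frame_matrix e' c (chart_inv c x)) (snd c p) z *v w) $ m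
     = (dmatrix (\<lambda>x. frame_matrix e c (chart_inv c x)) (snd c p) z *v (change e e' p *v w)
    + frame_matrix e c p *v (dmatrix (\<lambda>x. change e e' (chart_inv c x)) (snd c p) z *v w)) $ m" for m
  proof -
    have "(dmatrix (\<lambda>x. frame_matrix e' c (chart_inv c x)) (snd c p) z *v w) $ m
      = dderiv (\<lambda>x. (frame_matrix e' c (chart_inv c x) *v w) $ m) (snd c p) z"
      by (rule dderiv_matrix_const[symmetric]) (rule d2)
    also have "\<dots> = dderiv (\<lambda>x. (frame_matrix e c (chart_inv c x) *v (change e e' (chart_inv c x) *v w)) $ m) (snd c p) z"
    proof (rule dderiv_cong_open[OF o pS _ d5])
      fix x assume x: "x \<in> ?S"
      note q = chart_image_point(1)[OF cA x]
      have b: "basis_at e (chart_inv c x)" "basis_at e' (chart_inv c x)"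
        using q assms(3) local_frame_basis[OF assms(1)] local_frame_basis[OF assms(2)] by blast+
      show "(frame_matrix e' c (chart_inv c x) *v w) $ m = (frame_matrix e c (chart_inv c x) *v (change e e' (chart_inv c x) *v w)) $ m"
        by (simp add: frame_matrix_change[OF b] matrix_vector_mul_assoc)
    qed
    also have "\<dots> = (dmatrix (\<lambda>x. frame_matrix e c (chart_inv c x)) (snd c p) z *v (change e e' p *v w)) $ m
      + (frame_matrix e c p *v (\<chi> k. dderiv (\<lambda>x. (change e e' (chart_inv c x) *v w) $ k) (snd c p) z)) $ m"
      using dderiv_matrix_vector[of "\<lambda>x. frame_matrix e c (chart_inv c x)" "snd c p"
          "\<lambda>x. change e e' (chart_inv c x) *v w" m z, OF d1 d4] by (simp only: inv)
    also have "(\<chi> k. dderiv (\<lambda>x. (change e e' (chart_inv c x) *v w) $ k) (snd c p) z)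
      = dmatrix (\<lambda>x. change e e' (chart_inv c x)) (snd c p) z *v w"
      by (simp add: dderiv_matrix_const[of "\<lambda>x. change e e' (chart_inv c x)" "snd c p", OF d3] vec_eq_iff)
    finally show ?thesis by simp
  qed
  then show ?thesis by (simp add: vec_eq_iff)
qed

end

section \<open>Lie groups with a left-invariant complex structure\<close>

locale lie_setting =
  fixes G :: "('a, 'm) monoid_scheme" (structure) and X :: "'a topology" and A :: "('a, 'n::finite) chart set"
    and F :: "'a \<Rightarrow> ('a, 'n) tvec \<Rightarrow> real" and e :: "'n \<Rightarrow> ('a, 'n) field"
  assumes lie: "lie_group G X A"
    and left_inv: "left_invariant_structure G A"
    and finsler: "complex_finsler_metric X A F"
    and pseudoconvex: "strongly_pseudoconvex A F"
    and metric_inv: "left_invariant_metric G A F"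
    and basis: "g10_basis G A e"
begin

sublocale complex_mfd X A
  using lie by unfold_locales (simp add: lie_group_def)

lemma carrier: "carrier G = topspace X"
  using lie by (simp add: lie_group_def)

sublocale group G
  using lie by (simp add: lie_group_def)

section \<open>Left translations in charts\<close>

definition lt_dom :: "'a \<Rightarrow> ('a, 'n) chart \<Rightarrow> ('a, 'n) chart \<Rightarrow> (complex^'n) set" where
  "lt_dom g c d = {x \<in> snd c ` fst c. g \<otimes> chart_inv c x \<in> fst d}"

definition lt_map :: "'a \<Rightarrow> ('a, 'n) chart \<Rightarrow> ('a, 'n) chart \<Rightarrow> complex^'n \<Rightarrow> complex^'n" where
  "lt_map g c d x = snd d (g \<otimes> chart_inv c x)"

lemma chart_carrier: "c \<in> charts_at A p \<Longrightarrow> p \<in> carrier G"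
  using charts_at_topspace carrier by blast

text \<open>Left translation is the group product with its first factor frozen, a slice of the
  smooth map on pairs of coordinates.\<close>

lemma lt_smooth:
  assumes "g \<in> carrier G" "c \<in> A" "d \<in> A"
  shows "open (lt_dom g c d)" "smooth_on (lt_dom g c d) (lt_map g c d)"
proof -
  define a where "a = chart_at A g"
  have a: "a \<in> A" "g \<in> fst a"
    using chart_at_in[of g] assms(1) carrier charts_atD unfolding a_def by blast+
  define S where "S = {(x, y). x \<in> snd a ` fst a \<and> y \<in> snd c ` fst c \<and>
      chart_inv a x \<otimes> chart_inv c y \<in> fst d}"
  have S: "open S" "smooth_on S (\<lambda>(x, y). snd d (chart_inv a x \<otimes> chart_inv c y))"
    using lie a(1) assms(2,3) unfolding lie_group_def Let_def S_def by blast+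
  have ag: "chart_inv a (snd a g) = g" by (rule chart_inv_chart[OF a])
  have dom: "lt_dom g c d = (\<lambda>y. (snd a g, y)) -` S"
    using a(2) ag by (auto simp: lt_dom_def S_def)
  show o: "open (lt_dom g c d)"
    unfolding dom by (rule open_vimage[OF S(1)]) (intro continuous_intros)
  have bl: "bounded_linear (\<lambda>y :: complex^'n. (0 :: complex^'n, y))"
    by (rule bounded_linear_Pair[OF bounded_linear_zero bounded_linear_ident])
  have "smooth_on (lt_dom g c d) (\<lambda>y. (\<lambda>(x, y). snd d (chart_inv a x \<otimes> chart_inv c y)) ((snd a g, 0) + (0, y)))"
    by (rule smooth_on_affine[OF S(1) bl o _ S(2)]) (simp add: dom)
  then show "smooth_on (lt_dom g c d) (lt_map g c d)"
    by (simp add: ag lt_map_def[abs_def])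
qed

lemma lt_dom_point:
  assumes "c \<in> charts_at A p" "d \<in> charts_at A (g \<otimes> p)"
  shows "snd c p \<in> lt_dom g c d" "lt_map g c d (snd c p) = snd d (g \<otimes> p)"
  using assms chart_inv_chart[of c p] by (auto simp: charts_at_def lt_dom_def lt_map_def)

lemma lt_dom_pointD:
  assumes "x \<in> lt_dom g c d" "c \<in> A" "d \<in> A"
  shows "c \<in> charts_at A (chart_inv c x)" "d \<in> charts_at A (g \<otimes> chart_inv c x)"
    "snd c (chart_inv c x) = x" "chart_inv d (lt_map g c d x) = g \<otimes> chart_inv c x"
  using assms chart_inv_in[of c x] chart_inv_chart[of d] by (auto simp: charts_at_def lt_dom_def lt_map_def)

text \<open>The chain rule through a transition map replaces the chart selected in
  \<open>tmap\<close> by any other chart around \<open>p\<close>.\<close>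

lemma tmap_push:
  assumes "g \<in> carrier G" "c \<in> charts_at A p" "d \<in> charts_at A (g \<otimes> p)" "Z \<in> ctangent A p"
  shows "tmap A (\<lambda>q. g \<otimes> q) p Z d = push (lt_map g c d) (snd c p) (Z c)"
proof -
  define b where "b = chart_at A p"
  have b: "b \<in> charts_at A p" unfolding b_def by (rule chart_at_in[OF charts_at_topspace[OF assms(2)]])
  note A = charts_atD(1)[OF assms(2)] charts_atD(1)[OF assms(3)] charts_atD(1)[OF b]
  have dc: "lt_map g c d differentiable (at (snd c p))"
    by (rule smooth_on_differentiable[OF lt_smooth(2)[OF assms(1) A(1,2)] lt_dom_point(1)[OF assms(2,3)]])
  have db: "lt_map g b d differentiable (at (snd b p))"
    by (rule smooth_on_differentiable[OF lt_smooth(2)[OF assms(1) A(3,2)] lt_dom_point(1)[OF b assms(3)]])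
  have ep: "(snd c \<circ> chart_inv b) (snd b p) = snd c p"
    using chart_inv_chart[OF A(3) charts_atD(2)[OF b]] by simp
  have "push (lt_map g b d) (snd b p) (Z b) = push (\<lambda>x. lt_map g c d ((snd c \<circ> chart_inv b) x)) (snd b p) (Z b)"
  proof (rule push_cong_open[OF _ _ _ db])
    show "open (snd b ` (fst b \<inter> fst c))" by (rule transition(1)[OF A(3,1)])
    show "snd b p \<in> snd b ` (fst b \<inter> fst c)" using b assms(2) by (auto simp: charts_at_def)
    show "lt_map g b d y = lt_map g c d ((snd c \<circ> chart_inv b) y)" if "y \<in> snd b ` (fst b \<inter> fst c)" for y
      using that chart_inv_chart[OF A(1)] chart_inv_chart[OF A(3)] by (auto simp: lt_map_def)
  qed
  also have "\<dots> = push (lt_map g c d) (snd c p) (push (snd c \<circ> chart_inv b) (snd b p) (Z b))"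
    using push_compose[OF transition_at(1)[OF b assms(2)], of "lt_map g c d" "Z b"] dc ep by simp
  also have "push (snd c \<circ> chart_inv b) (snd b p) (Z b) = Z c"
    by (rule ctangent_transition[OF assms(4) b assms(2), symmetric])
  finally show ?thesis
    using assms(3) by (simp add: tmap_def Let_def b_def lt_map_def[abs_def])
qed

text \<open>Left-invariance of the complex structure says that the differential of a translation
  commutes with I, that is, with multiplication by \<open>\<i>\<close> on real vectors; being real
  linear, it is then complex linear.\<close>

lemma lt_holomorphic:
  assumes g: "g \<in> carrier G" and c: "c \<in> A" "d \<in> A" and x: "x \<in> lt_dom g c d"
  shows "frechet_derivative (lt_map g c d) (at x) (a *s z) = a *s frechet_derivative (lt_map g c d) (at x) z"
proof -
  define p where "p = chart_inv c x"
  let ?D = "frechet_derivative (lt_map g c d) (at x)"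
  note P = lt_dom_pointD[OF x c, folded p_def]
  have d: "lt_map g c d differentiable (at x)"
    by (rule smooth_on_differentiable[OF lt_smooth(2)[OF g c] x])
  have lin: "linear ?D" by (rule linear_frechet_derivative[OF d])
  \<comment> \<open>The hypothesis concerns complexified vectors. It is applied to the
    complexification of the real vector \<open>w\<close>, and \<open>cre\<close> recovers the real
    vectors on both sides.\<close>
  have "?D (\<i> *s w) = \<i> *s ?D w" for w
  proof -
    define Z where "Z = tvec_of A c p (w, vcnj w)"
    have Z: "Z \<in> ctangent A p" "Z c = (w, vcnj w)"
      unfolding Z_def by (rule tvec_of_at[OF P(1)])+
    have IZ: "cplx_str Z \<in> ctangent A p"
    proof -
      have "cplx_str Z = tadd (tscale \<i> (part10 Z)) (tscale (- \<i>) (part01 Z))"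
        by (simp add: cplx_str_def tadd_def tscale_def part10_def part01_def)
      then show ?thesis using Z(1) by (simp only: ctangent_tadd ctangent_tscale ctangent_part)
    qed
    have pG: "p \<in> carrier G" by (rule chart_carrier[OF P(1)])
    have "tmap A (\<lambda>q. g \<otimes> q) p (cplx_str Z) d = cplx_str (tmap A (\<lambda>q. g \<otimes> q) p Z) d"
      using left_inv g pG Z(1) unfolding left_invariant_structure_def by metis
    then have "push (lt_map g c d) x (cplx_str Z c) = cplx_str (tmap A (\<lambda>q. g \<otimes> q) p Z) d"
      by (simp only: tmap_push[OF g P(1,2) IZ] P(3))
    then have eq: "push (lt_map g c d) x (\<i> *s w, (- \<i>) *s vcnj w)
        = (\<i> *s fst (push (lt_map g c d) x (w, vcnj w)), (- \<i>) *s snd (push (lt_map g c d) x (w, vcnj w)))"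
      unfolding cplx_str_def tmap_push[OF g P(1,2) Z(1)] P(3) by (simp add: Z(2))
    have r: "cre (\<i> *s p, (- \<i>) *s q) = \<i> *s cre (p, q)" for p q :: "complex^'n"
      by (simp add: cre_def vec_eq_iff field_simps)
    have w: "cre (w, vcnj w) = w" by (simp add: cre_def vec_eq_iff)
    have "?D (\<i> *s w) = cre (push (lt_map g c d) x (\<i> *s w, (- \<i>) *s vcnj w))"
      unfolding push_frechet[OF d] r w ..
    also have "\<dots> = \<i> *s cre (push (lt_map g c d) x (w, vcnj w))"
      unfolding eq r by simp
    also have "\<dots> = \<i> *s ?D w"
      unfolding push_frechet[OF d] w ..
    finally show ?thesis .
  qed
  moreover have "a *s z = Re a *\<^sub>R z + Im a *\<^sub>R (\<i> *s z)" for z :: "complex^'n"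
    by (simp add: vec_eq_iff complex_eq_iff)
  ultimately show ?thesis
    by (simp add: linear_add[OF lin] linear_cmul[OF lin])
qed

lemma tmap_tadd:
  shows "tmap A f p (tadd Y Z) = tadd (tmap A f p Y) (tmap A f p Z)"
  by (rule ext) (simp add: tmap_def tadd_def Let_def push_add)

lemma tmap_tlin:
  "tmap A f p (tlin \<xi> E) = tlin \<xi> (\<lambda>i. tmap A f p (E i))"
proof
  fix d show "tmap A f p (tlin \<xi> E) d = tlin \<xi> (\<lambda>i. tmap A f p (E i)) d"
  proof (cases "d \<in> charts_at A (f p)")
    case True
    then show ?thesis by (simp add: tmap_def Let_def push_tlin) (simp add: tlin_sum Let_def)
  next
    case False
    then show ?thesis by (simp add: tmap_def tlin_def zero_prod_def)
  qed
qed

lemma tmap_tscale: "tmap A f p (tscale a Z) = tscale a (tmap A f p Z)"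
  by (rule ext) (simp add: tmap_def tscale_def Let_def push_scale zero_prod_def)

section \<open>Left-invariant fields of type (1,0)\<close>

lemma lie_algebra_combination:
  assumes "Y \<in> lie_algebra G A" "Z \<in> lie_algebra G A"
  shows "(\<lambda>p c. r *\<^sub>R Y p c + s *\<^sub>R Z p c) \<in> lie_algebra G A"
proof -
  let ?W = "\<lambda>p c. r *\<^sub>R Y p c + s *\<^sub>R Z p c"
  have Y: "\<And>p. p \<notin> carrier G \<Longrightarrow> Y p = (\<lambda>c. 0)" "\<And>p. p \<in> carrier G \<Longrightarrow> Y p \<in> ctangent A p"
    "\<And>p. p \<in> carrier G \<Longrightarrow> tconj (Y p) = Y p" "smooth_field A (carrier G) Y"
    "\<And>g p. g \<in> carrier G \<Longrightarrow> p \<in> carrier G \<Longrightarrow> Y (g \<otimes> p) = tmap A (\<lambda>q. g \<otimes> q) p (Y p)"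
    using assms(1) unfolding lie_algebra_def by blast+
  have Z: "\<And>p. p \<notin> carrier G \<Longrightarrow> Z p = (\<lambda>c. 0)" "\<And>p. p \<in> carrier G \<Longrightarrow> Z p \<in> ctangent A p"
    "\<And>p. p \<in> carrier G \<Longrightarrow> tconj (Z p) = Z p" "smooth_field A (carrier G) Z"
    "\<And>g p. g \<in> carrier G \<Longrightarrow> p \<in> carrier G \<Longrightarrow> Z (g \<otimes> p) = tmap A (\<lambda>q. g \<otimes> q) p (Z p)"
    using assms(2) unfolding lie_algebra_def by blast+
  have sc: "r *\<^sub>R U = (of_real r *s fst U, of_real r *s snd U)" for r and U :: "'n cvec"
    by (simp add: prod_eq_iff vec_eq_iff scaleR_conv_of_real[where 'a = complex])
  have W: "(\<lambda>c. r *\<^sub>R U c + s *\<^sub>R V c) = tadd (tscale (of_real r) U) (tscale (of_real s) V)"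
    for U V :: "('a, 'n) tvec"
    by (simp add: fun_eq_iff tadd_def tscale_def sc)
  have "?W p = (\<lambda>c. 0)" if "p \<notin> carrier G" for p
    by (simp add: Y(1)[OF that] Z(1)[OF that])
  moreover have "?W p \<in> ctangent A p" if "p \<in> carrier G" for p
    unfolding W by (intro ctangent_tadd ctangent_tscale Y(2) Z(2) that)
  moreover have "tconj (?W p) = ?W p" if "p \<in> carrier G" for p
  proof -
    have l: "pcnj (r *\<^sub>R U + s *\<^sub>R V) = r *\<^sub>R pcnj U + s *\<^sub>R pcnj V" for U V :: "'n cvec"
      by (simp add: pcnj_def prod_eq_iff vec_eq_iff complex_eq_iff)
    show ?thesis
      using fun_cong[OF Y(3)[OF that]] fun_cong[OF Z(3)[OF that]] by (simp add: tconj_def l)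
  qed
  moreover have "smooth_field A (carrier G) ?W"
    unfolding smooth_field_def
  proof
    fix c assume c: "c \<in> A"
    have o: "open (snd c ` (carrier G \<inter> fst c))"
      by (rule chart_image_open[OF c]) (simp add: carrier)
    show "smooth_on (snd c ` (carrier G \<inter> fst c)) (\<lambda>x. ?W (chart_inv c x) c)"
      using Y(4) Z(4) c unfolding smooth_field_def
      by (intro smooth_on_add smooth_on_linear[OF o bounded_linear_scaleR_right] o) blast+
  qed
  moreover have "?W (g \<otimes> p) = tmap A (\<lambda>q. g \<otimes> q) p (?W p)" if "g \<in> carrier G" "p \<in> carrier G" for g p
    unfolding Y(5)[OF that] Z(5)[OF that] W
    by (simp only: tmap_tadd tmap_tscale)
  ultimately show ?thesis unfolding lie_algebra_def by blast
qed

text \<open>The coordinate isomorphism onto \<open>g10 G A\<close>, inverse to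
  \<open>fcoord e\<close>. It turns quantifiers over the Lie algebra into quantifiers over
  coordinate vectors.\<close>

definition fld :: "complex^'n \<Rightarrow> ('a, 'n) field" where
  "fld \<xi> = (\<lambda>p. tlin \<xi> (\<lambda>i. e i p))"

lemma e_g10: "e i \<in> g10 G A"
  using basis unfolding g10_basis_def by blast

lemma g10_unique: "Z \<in> g10 G A \<Longrightarrow> \<exists>!\<xi>. Z = fld \<xi>"
  using basis unfolding g10_basis_def fld_def by blast

lemma lie_algebra_sum:
  assumes "finite I" "I \<noteq> {}" "\<And>i. i \<in> I \<Longrightarrow> W i \<in> lie_algebra G A"
  shows "(\<lambda>p c. \<Sum>i\<in>I. W i p c) \<in> lie_algebra G A"
  using assms
proof (induction I rule: finite_ne_induct)
  case (singleton i)
  then show ?case by simp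
next
  case (insert i I)
  then show ?case
    using lie_algebra_combination[of "W i" "\<lambda>p c. \<Sum>i\<in>I. W i p c" 1 1] by simp
qed

text \<open>The basis property yields coordinates for given elements of \<open>g10 G A\<close>; that
  every combination of the basis lies there must be shown from the real Lie algebra.\<close>

lemma fld_g10: "fld \<xi> \<in> g10 G A"
proof -
  define P where "P i W \<longleftrightarrow> e i = (\<lambda>p. tadd (fst W p) (tscale \<i> (snd W p)))
    \<and> fst W \<in> lie_algebra G A \<and> snd W \<in> lie_algebra G A" for i W
  have "\<exists>W. P i W" for i
  proof -
    obtain Y Z where "e i = (\<lambda>p. tadd (Y p) (tscale \<i> (Z p)))" "Y \<in> lie_algebra G A" "Z \<in> lie_algebra G A"
      using e_g10[of i] unfolding g10_def lie_algebra_C_def by blast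
    then have "P i (Y, Z)" by (simp add: P_def)
    then show ?thesis by blast
  qed
  then have W: "P i (SOME W. P i W)" for i by (rule someI_ex)
  define Y where "Y i = fst (SOME W. P i W)" for i
  define Z where "Z i = snd (SOME W. P i W)" for i
  have YZ: "e i = (\<lambda>p. tadd (Y i p) (tscale \<i> (Z i p)))"
    "Y i \<in> lie_algebra G A" "Z i \<in> lie_algebra G A" for i
    using W[of i] unfolding P_def Y_def Z_def by blast+
  \<comment> \<open>Real and imaginary parts from (a + \<open>\<i>\<close> b)(Y +
    \<open>\<i>\<close> Z) = (a Y - b Z) + \<open>\<i>\<close> (b Y + a Z).\<close>
  define R where "R = (\<lambda>p c. \<Sum>i\<in>UNIV. Re (\<xi> $ i) *\<^sub>R Y i p c + (- Im (\<xi> $ i)) *\<^sub>R Z i p c)"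
  define J where "J = (\<lambda>p c. \<Sum>i\<in>UNIV. Im (\<xi> $ i) *\<^sub>R Y i p c + Re (\<xi> $ i) *\<^sub>R Z i p c)"
  have "R \<in> lie_algebra G A" "J \<in> lie_algebra G A"
    unfolding R_def J_def
    by (rule lie_algebra_sum, simp, simp, rule lie_algebra_combination[OF YZ(2,3)])+
  moreover have "fld \<xi> = (\<lambda>p. tadd (R p) (tscale \<i> (J p)))"
  proof (intro ext)
    fix p c
    show "fld \<xi> p c = tadd (R p) (tscale \<i> (J p)) c"
      unfolding fld_def tlin_def tadd_def tscale_def YZ(1) R_def J_def
      by (simp add: prod_eq_iff fst_sum snd_sum vec_eq_iff sum_component complex_eq_iff
          sum.distrib sum_subtractf sum_negf sum_distrib_left algebra_simps)
  qed
  ultimately have "fld \<xi> \<in> lie_algebra_C G A" unfolding lie_algebra_C_def by blast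
  moreover have "cplx_str (fld \<xi> p) = tscale \<i> (fld \<xi> p)" for p
  proof -
    have "snd (e i p c) = 0" for i c
    proof -
      have "cplx_str (e i p) c = tscale \<i> (e i p) c" using e_g10[of i] unfolding g10_def by simp
      then have "(- \<i>) *s snd (e i p c) = \<i> *s snd (e i p c)" by (simp add: cplx_str_def tscale_def)
      then show ?thesis by (auto simp: vec_eq_iff complex_eq_iff)
    qed
    then show ?thesis by (simp add: fun_eq_iff cplx_str_def tscale_def fld_def tlin_def)
  qed
  ultimately show ?thesis unfolding g10_def by blast
qed

lemma fcoord_fld [simp]: "fcoord e (fld \<xi>) = \<xi>"
proof -
  have "\<exists>!\<eta>. fld \<xi> = fld \<eta>" by (rule g10_unique[OF fld_g10])
  then show ?thesis unfolding fcoord_def fld_def[symmetric] by blast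
qed

lemma fld_fcoord: "Z \<in> g10 G A \<Longrightarrow> fld (fcoord e Z) = Z"
  using g10_unique fcoord_fld by metis

lemma fld_zero: "fld 0 = zero_field"
  by (simp add: fld_def zero_field_def tlin_def zero_prod_def fun_eq_iff)

lemma fld_eq_zero: "fld \<xi> = zero_field \<longleftrightarrow> \<xi> = 0"
  using fcoord_fld fld_zero by metis

lemma ball_g10: "(\<forall>Z\<in>g10 G A. P Z) \<longleftrightarrow> (\<forall>\<xi>. P (fld \<xi>))"
  using fld_g10 fld_fcoord by metis

lemma ball_g10_nonzero: "(\<forall>Z\<in>g10 G A - {zero_field}. P Z) \<longleftrightarrow> (\<forall>\<xi>. \<xi> \<noteq> 0 \<longrightarrow> P (fld \<xi>))"
  using fld_g10 fld_fcoord fld_eq_zero by (metis Diff_iff singletonD singletonI)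

lemma e_props:
  shows "p \<notin> carrier G \<Longrightarrow> e i p = (\<lambda>c. 0)" "p \<in> carrier G \<Longrightarrow> e i p \<in> T10 A p"
    "smooth_field A (carrier G) (e i)"
    "g \<in> carrier G \<Longrightarrow> p \<in> carrier G \<Longrightarrow> e i (g \<otimes> p) = tmap A (\<lambda>q. g \<otimes> q) p (e i p)"
proof -
  obtain Y Z where YZ: "e i = (\<lambda>p. tadd (Y p) (tscale \<i> (Z p)))"
    "Y \<in> lie_algebra G A" "Z \<in> lie_algebra G A"
    using e_g10[of i] unfolding g10_def lie_algebra_C_def by blast
  have Y: "\<And>p. p \<notin> carrier G \<Longrightarrow> Y p = (\<lambda>c. 0)" "\<And>p. p \<in> carrier G \<Longrightarrow> Y p \<in> ctangent A p"
    "smooth_field A (carrier G) Y"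
    "\<And>g p. g \<in> carrier G \<Longrightarrow> p \<in> carrier G \<Longrightarrow> Y (g \<otimes> p) = tmap A (\<lambda>q. g \<otimes> q) p (Y p)"
    using YZ(2) unfolding lie_algebra_def by blast+
  have Z: "\<And>p. p \<notin> carrier G \<Longrightarrow> Z p = (\<lambda>c. 0)" "\<And>p. p \<in> carrier G \<Longrightarrow> Z p \<in> ctangent A p"
    "smooth_field A (carrier G) Z"
    "\<And>g p. g \<in> carrier G \<Longrightarrow> p \<in> carrier G \<Longrightarrow> Z (g \<otimes> p) = tmap A (\<lambda>q. g \<otimes> q) p (Z p)"
    using YZ(3) unfolding lie_algebra_def by blast+
  show "e i p = (\<lambda>c. 0)" if "p \<notin> carrier G"
    unfolding YZ(1) by (simp add: Y(1)[OF that] Z(1)[OF that] tadd_def tscale_def zero_prod_def)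
  show "e i p \<in> T10 A p" if "p \<in> carrier G"
  proof -
    have "cplx_str (e i p) = tscale \<i> (e i p)" using e_g10[of i] unfolding g10_def by blast
    moreover have "e i p \<in> ctangent A p"
      unfolding YZ(1) by (intro ctangent_tadd ctangent_tscale Y(2) Z(2) that)
    ultimately show ?thesis unfolding T10_def by blast
  qed
  show "smooth_field A (carrier G) (e i)"
    unfolding smooth_field_def
  proof
    fix c assume c: "c \<in> A"
    have o: "open (snd c ` (carrier G \<inter> fst c))"
      by (rule chart_image_open[OF c]) (simp add: carrier)
    have bl: "bounded_linear (\<lambda>z :: 'n cvec. (\<i> *s fst z, \<i> *s snd z))"
      by (rule linear_conv_bounded_linear[THEN iffD1], rule linearI)
         (simp_all add: vec_eq_iff algebra_simps)
    show "smooth_on (snd c ` (carrier G \<inter> fst c)) (\<lambda>x. e i (chart_inv c x) c)"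
      unfolding YZ(1) tadd_def tscale_def using Y(3) Z(3) c unfolding smooth_field_def
      by (intro smooth_on_add smooth_on_linear[OF o bl] o) blast+
  qed
  show "e i (g \<otimes> p) = tmap A (\<lambda>q. g \<otimes> q) p (e i p)" if "g \<in> carrier G" "p \<in> carrier G"
    unfolding YZ(1) Y(4)[OF that] Z(4)[OF that]
    by (simp only: tmap_tadd tmap_tscale)
qed

lemma fld_left_inv:
  assumes "g \<in> carrier G" "p \<in> carrier G"
  shows "fld \<xi> (g \<otimes> p) = tmap A (\<lambda>q. g \<otimes> q) p (fld \<xi> p)"
  unfolding fld_def tmap_tlin e_props(4)[OF assms] ..

lemma tmap_zero: "tmap A f p (\<lambda>c. 0) = (\<lambda>c. 0)"
  by (simp add: tmap_def Let_def fun_eq_iff)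

text \<open>A left-invariant field that vanishes at \<open>p\<close> vanishes at every
  \<open>q\<close>, by translation with the product of \<open>q\<close> and the inverse of
  \<open>p\<close>.\<close>

lemma fld_inj:
  assumes "p \<in> carrier G" "fld \<xi> p = (\<lambda>c. 0)"
  shows "\<xi> = 0"
proof -
  have "fld \<xi> q = (\<lambda>c. 0)" for q
  proof (cases "q \<in> carrier G")
    case True
    define g where "g = q \<otimes> inv\<^bsub>G\<^esub> p"
    have g: "g \<in> carrier G" "g \<otimes> p = q"
      using True assms(1) by (simp_all add: g_def m_assoc)
    show ?thesis
      using fld_left_inv[OF g(1) assms(1), of \<xi>] by (simp add: g(2) assms(2) tmap_zero)
  next
    case False
    then show ?thesis by (simp add: fld_def e_props(1)[OF False] tlin_def zero_prod_def)
  qed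
  then have "fld \<xi> = zero_field" by (simp add: zero_field_def fun_eq_iff)
  then show ?thesis by (simp add: fld_eq_zero)
qed

text \<open>Independence at one point follows from \<open>fld_inj\<close>. The number of basis
  fields is the dimension of the charts, so the frame matrix is square and injectivity gives
  surjectivity.\<close>

lemma e_basis_at:
  assumes "p \<in> carrier G"
  shows "basis_at e p"
proof -
  define c where "c = chart_at A p"
  have c: "c \<in> charts_at A p" unfolding c_def by (rule chart_at_in) (use assms carrier in simp)
  let ?M = "frame_matrix e c p"
  have T: "fld \<xi> p \<in> T10 A p" for \<xi>
    unfolding fld_def by (rule tlin_T10) (rule e_props(2)[OF assms])
  have inj: "\<xi> = \<eta>" if "fst (fld \<xi> p c) = fst (fld \<eta> p c)" for \<xi> \<eta>
  proof -
    have "fst (fld (\<xi> - \<eta>) p c) = 0"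
      using that unfolding fld_def frame_matrix_mult[symmetric] by (simp add: matrix_vector_mult_diff_distrib)
    moreover have "snd (fld (\<xi> - \<eta>) p c) = 0" using T[of "\<xi> - \<eta>"] unfolding T10_iff by blast
    ultimately have "fld (\<xi> - \<eta>) p c = 0" by (simp add: prod_eq_iff)
    then have "fld (\<xi> - \<eta>) p = (\<lambda>c. 0)"
      using T[of "\<xi> - \<eta>"] c by (intro ctangent_eqI[OF _ ctangent_zero]) (simp_all add: T10_def)
    then show ?thesis using fld_inj[OF assms] by fastforce
  qed
  have "\<exists>B. B ** ?M = mat 1"
    unfolding matrix_left_invertible_ker
  proof (intro allI impI)
    fix x assume "?M *v x = 0"
    then show "x = 0" using inj[of x 0] by (simp add: fld_def frame_matrix_mult[symmetric])
  qed
  then obtain B where "?M ** B = mat 1" using matrix_left_right_inverse by blast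
  then have surj: "\<exists>\<xi>. fst (fld \<xi> p c) = y" for y
    unfolding fld_def frame_matrix_mult[symmetric]
    by (metis matrix_vector_mul_assoc matrix_vector_mul_lid)
  have "\<exists>!\<xi>. Z = fld \<xi> p" if Z: "Z \<in> T10 A p" for Z
  proof -
    obtain \<xi> where \<xi>: "fst (fld \<xi> p c) = fst (Z c)" using surj by blast
    have "snd (fld \<xi> p c) = 0" "snd (Z c) = 0" using T[of \<xi>] Z unfolding T10_iff by blast+
    then have "fld \<xi> p c = Z c" using \<xi> by (simp add: prod_eq_iff)
    moreover have "fld \<xi> p \<in> ctangent A p" "Z \<in> ctangent A p" using T[of \<xi>] Z unfolding T10_def by blast+
    ultimately have "Z = fld \<xi> p" using ctangent_eqI[OF _ _ c] by blast
    then show ?thesis using inj by metis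
  qed
  then show ?thesis
    using assms carrier e_props(2)[OF assms] unfolding basis_at_def fld_def by simp
qed

lemma e_local_frame: "local_frame X A (topspace X) e"
  unfolding local_frame_def
  using e_props(3) e_basis_at carrier unfolding basis_at_def by simp

section \<open>Brackets of left-invariant fields\<close>

abbreviation FM :: "('a, 'n) chart \<Rightarrow> complex^'n \<Rightarrow> complex^'n^'n" where
  "FM c \<equiv> \<lambda>x. frame_matrix e c (chart_inv c x)"

lemma differentiable_FM:
  assumes "c \<in> charts_at A p"
  shows "(\<lambda>x. FM c x $ m $ k) differentiable (at (snd c p))"
  by (rule smooth_on_differentiable[OF smooth_frame_matrix[OF e_local_frame charts_atD(1)[OF assms]]])
     (use charts_atD(2)[OF assms] charts_at_topspace[OF assms] in blast)

lemma FM_at: "c \<in> charts_at A p \<Longrightarrow> FM c (snd c p) = frame_matrix e c p"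
  by (simp add: chart_inv_chart charts_at_def)

lemma fst_fld: "fst (fld \<xi> p c) = frame_matrix e c p *v \<xi>"
  by (simp add: fld_def frame_matrix_mult)

lemma snd_fld: "snd (fld \<xi> p c) = 0"
proof -
  have "snd (e i p c) = 0" for i
  proof (cases "p \<in> carrier G")
    case True
    then show ?thesis using e_props(2)[OF True, of i] unfolding T10_iff by blast
  qed (simp add: e_props(1))
  then show ?thesis by (simp add: fld_def tlin_def)
qed

lemma fld_chart: "fld \<xi> p c = (frame_matrix e c p *v \<xi>, 0)"
  by (simp add: prod_eq_iff fst_fld snd_fld)

definition brk :: "('a, 'n) chart \<Rightarrow> 'a \<Rightarrow> complex^'n \<Rightarrow> complex^'n \<Rightarrow> complex^'n" where
  "brk c p u w = dmatrix (FM c) (snd c p) (frame_matrix e c p *v u, 0) *v w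
    - dmatrix (FM c) (snd c p) (frame_matrix e c p *v w, 0) *v u"

text \<open>The (1,0)-component of the conjugate field is zero, so of the two terms of the bracket
  only the derivative of the first field along the conjugate one remains.\<close>

definition mbrk :: "('a, 'n) chart \<Rightarrow> 'a \<Rightarrow> complex^'n \<Rightarrow> complex^'n \<Rightarrow> complex^'n" where
  "mbrk c p u w = - (dmatrix (FM c) (snd c p) (0, vcnj (frame_matrix e c p *v w)) *v u)"

lemma fst_bracket:
  assumes "c \<in> charts_at A p"
  shows "fst (bracket A (fld u) (fld w) p c) = brk c p u w"
  using assms
  by (simp add: bracket_def fst_fld fld_chart brk_def vec_eq_iff dderiv_matrix_const[OF differentiable_FM[OF assms]])

lemma fst_mixed_bracket:
  assumes "c \<in> charts_at A p"
  shows "fst (bracket A (fld u) (fconj (fld w)) p c) = mbrk c p u w"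
proof -
  have f: "fst (fconj (fld w) q c) = 0" for q
    by (simp add: fconj_def tconj_def pcnj_def snd_fld)
  have s: "fconj (fld w) p c = (0, vcnj (frame_matrix e c p *v w))"
    by (simp add: fconj_def tconj_def pcnj_def fld_chart)
  show ?thesis
    using assms
    by (simp add: bracket_def f s fst_fld mbrk_def vec_eq_iff dderiv_matrix_const[OF differentiable_FM[OF assms]])
qed

text \<open>With \<open>h\<close> the translation in charts and \<open>K\<close> its holomorphic
  Jacobian, left-invariance reads: frame matrix at \<open>h x\<close> = \<open>K x\<close> times
  frame matrix at \<open>x\<close>. Differentiating this carries the brackets along by
  \<open>K\<close>, provided that the derivative of \<open>K\<close> drops out.\<close>

lemma bracket_natural:
  assumes g: "g \<in> carrier G" and c: "c \<in> charts_at A p" and d: "d \<in> charts_at A (g \<otimes> p)"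
  obtains K where "frame_matrix e d (g \<otimes> p) = K ** frame_matrix e c p"
    "\<And>u w. brk d (g \<otimes> p) u w = K *v brk c p u w"
    "\<And>u w. mbrk d (g \<otimes> p) u w = K *v mbrk c p u w"
proof -
  define x0 where "x0 = snd c p"
  define h where "h = lt_map g c d"
  define V where "V = lt_dom g c d"
  define K where "K x = (\<chi> i l. wirt l (\<lambda>y. h y $ i) x)" for x
  note A = charts_atD(1)[OF c] charts_atD(1)[OF d]
  have o: "open V" and sh: "smooth_on V h" unfolding V_def h_def by (rule lt_smooth[OF g A])+
  have x0: "x0 \<in> V" "h x0 = snd d (g \<otimes> p)"
    unfolding x0_def V_def h_def by (rule lt_dom_point[OF c d])+
  have si: "smooth_on V (\<lambda>y. h y $ i)" for i
    by (rule smooth_on_linear[OF o bounded_linear_vec_nth sh])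
  have dh: "h differentiable (at x)" if "x \<in> V" for x by (rule smooth_on_differentiable[OF sh that])
  have push: "push h x (a, b) = (frechet_derivative h (at x) a, vcnj (frechet_derivative h (at x) (vcnj b)))"
    if "x \<in> V" for x a b
    by (rule push_holomorphic[OF dh[OF that]]) (use lt_holomorphic[OF g A] that in \<open>simp add: V_def h_def\<close>)
  have fp: "dderiv (\<lambda>y. h y $ i) x (a, b) = frechet_derivative h (at x) a $ i" if x: "x \<in> V" for x a b i
    using arg_cong[OF push[OF x, of a b], of "\<lambda>z. fst z $ i"] by (simp add: push_def)
  have DK: "frechet_derivative h (at x) a = K x *v a" if x: "x \<in> V" for x a
  proof -
    have "(K x *v a) $ i = dderiv (\<lambda>y. h y $ i) x (a, 0)" for i
      by (simp add: dderiv_def K_def matrix_vector_mult_def mult.commute)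
    then show ?thesis by (simp add: vec_eq_iff fp[OF x])
  qed
  have wb: "wirtb l (\<lambda>y. h y $ i) x = 0" if x: "x \<in> V" for x i l
  proof -
    have "dderiv (\<lambda>y. h y $ i) x (0, axis l 1) = frechet_derivative h (at x) 0 $ i"
      by (rule fp[OF x])
    then show ?thesis
      using linear_0[OF linear_frechet_derivative[OF dh[OF x]]] by (simp add: wirtb_eq_dderiv)
  qed
  have frame: "FM d (h x) *v \<xi> = K x *v (FM c x *v \<xi>)" if x: "x \<in> V" for x \<xi>
  proof -
    define q where "q = chart_inv c x"
    note P = lt_dom_pointD[OF x[unfolded V_def] A, folded q_def h_def]
    have q: "q \<in> carrier G" by (rule chart_carrier[OF P(1)])
    have "fld \<xi> q \<in> ctangent A q"
      unfolding fld_def by (rule ctangent_tlin) (use e_props(2)[OF q] in \<open>simp add: T10_iff\<close>)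
    then have "fld \<xi> (g \<otimes> q) d = push h x (fld \<xi> q c)"
      unfolding fld_left_inv[OF g q] using tmap_push[OF g P(1,2)] by (simp add: P(3) h_def)
    from arg_cong[OF this, of fst] show ?thesis
      unfolding fld_chart push[OF x] DK[OF x] P(4) by (simp add: q_def)
  qed
  have dK: "(\<lambda>x. K x $ m $ l) differentiable (at x0)" for m l
    unfolding K_def using smooth_on_differentiable[OF smooth_on_wirt(1)[OF o si] x0(1)] by simp
  have dFc: "(\<lambda>x. FM c x $ m $ k) differentiable (at x0)" for m k
    unfolding x0_def by (rule differentiable_FM[OF c])
  have dFd: "(\<lambda>x. FM d x $ m $ k) differentiable (at (h x0))" for m k
    unfolding x0(2) by (rule differentiable_FM[OF d])
  have dmv: "(\<lambda>x. (M x *v \<xi>) $ m) differentiable (at x)"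
    if "\<And>m k. (\<lambda>x. M x $ m $ k) differentiable (at x)" for M :: "complex^'n \<Rightarrow> complex^'n^'n" and \<xi> m x
    unfolding matrix_vector_mult_def using that by (simp add: differentiable_sum' differentiable_mult)
  \<comment> \<open>The derivative of the invariance relation; besides the transported term it
    contains the derivative of the Jacobian.\<close>
  have E: "dmatrix (FM d) (h x0) (push h x0 z) *v \<xi>
      = dmatrix K x0 z *v (FM c x0 *v \<xi>) + K x0 *v (dmatrix (FM c) x0 z *v \<xi>)" for z \<xi>
  proof -
    have "(dmatrix (FM d) (h x0) (push h x0 z) *v \<xi>) $ m
      = (dmatrix K x0 z *v (FM c x0 *v \<xi>) + K x0 *v (dmatrix (FM c) x0 z *v \<xi>)) $ m" for m
    proof -
      have "(dmatrix (FM d) (h x0) (push h x0 z) *v \<xi>) $ m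
          = dderiv (\<lambda>y. (FM d y *v \<xi>) $ m) (h x0) (push h x0 z)"
        by (rule dderiv_matrix_const[symmetric]) (rule dFd)
      also have "\<dots> = dderiv (\<lambda>x. (FM d (h x) *v \<xi>) $ m) x0 z"
        by (rule dderiv_compose[OF dh[OF x0(1)] dmv[of "FM d", OF dFd], symmetric])
      also have "\<dots> = dderiv (\<lambda>x. (K x *v (FM c x *v \<xi>)) $ m) x0 z"
      proof (rule dderiv_cong_open[OF o x0(1)])
        show "(\<lambda>x. (FM d (h x) *v \<xi>) $ m) differentiable (at x0)"
          using differentiable_chain_at[OF dh[OF x0(1)] dmv[of "FM d", OF dFd]] by (simp add: o_def)
      qed (simp add: frame)
      also have "\<dots> = (dmatrix K x0 z *v (FM c x0 *v \<xi>)) $ m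
          + (K x0 *v (\<chi> k. dderiv (\<lambda>x. (FM c x *v \<xi>) $ k) x0 z)) $ m"
        by (rule dderiv_matrix_vector[of K x0 "\<lambda>x. FM c x *v \<xi>", OF dK dmv[of "FM c", OF dFc]])
      also have "(\<chi> k. dderiv (\<lambda>x. (FM c x *v \<xi>) $ k) x0 z) = dmatrix (FM c) x0 z *v \<xi>"
        by (simp add: vec_eq_iff dderiv_matrix_const[of "FM c", OF dFc])
      finally show ?thesis by simp
    qed
    then show ?thesis by (simp add: vec_eq_iff)
  qed
  \<comment> \<open>Second derivatives of \<open>h\<close> are symmetric, so the derivative of the
    Jacobian cancels in the antisymmetric bracket.\<close>
  have sym: "dmatrix K x0 (a, 0) *v b = dmatrix K x0 (b, 0) *v a" for a b
  proof -
    have "wirt k (wirt l (\<lambda>y. h y $ i)) x0 = wirt l (wirt k (\<lambda>y. h y $ i)) x0" for i k l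
      by (rule wirt_commute(1)[OF o si x0(1)])
    then have "(\<Sum>l\<in>UNIV. (\<Sum>k\<in>UNIV. a $ k * wirt k (wirt l (\<lambda>y. h y $ i)) x0) * b $ l)
        = (\<Sum>l\<in>UNIV. (\<Sum>k\<in>UNIV. b $ k * wirt k (wirt l (\<lambda>y. h y $ i)) x0) * a $ l)" for i
      unfolding sum_distrib_right by (subst sum.swap) (simp add: mult_ac)
    then show ?thesis
      by (simp add: vec_eq_iff dmatrix_def K_def dderiv_def matrix_vector_mult_def)
  qed
  \<comment> \<open>\<open>h\<close> is holomorphic, so its Jacobian has no barred derivative and
    contributes nothing to the mixed bracket.\<close>
  have zero: "dmatrix K x0 (0, b) *v a = 0" for a b
  proof -
    have "wirtb k (wirt l (\<lambda>y. h y $ i)) x0 = 0" for i k l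
    proof -
      have "wirtb k (wirt l (\<lambda>y. h y $ i)) x0 = wirt l (wirtb k (\<lambda>y. h y $ i)) x0"
        by (rule wirt_commute(2)[OF o si x0(1), symmetric])
      also have "\<dots> = wirt l (\<lambda>x. 0) x0"
        by (rule wirt_cong_open(1)[OF o x0(1)])
           (simp_all add: wb smooth_on_differentiable[OF smooth_on_wirt(2)[OF o si] x0(1)])
      finally show ?thesis by (simp add: wirt_eq_dderiv)
    qed
    then show ?thesis
      by (simp add: vec_eq_iff dmatrix_def K_def dderiv_def matrix_vector_mult_def)
  qed
  have Fc: "FM c x0 = frame_matrix e c p" unfolding x0_def by (rule FM_at[OF c])
  have Fd: "FM d (h x0) = frame_matrix e d (g \<otimes> p)" unfolding x0(2) by (rule FM_at[OF d])
  have fr: "frame_matrix e d (g \<otimes> p) *v \<xi> = K x0 *v (frame_matrix e c p *v \<xi>)" for \<xi>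
    using frame[OF x0(1), of \<xi>] unfolding Fc Fd .
  have p1: "push h x0 (frame_matrix e c p *v u, 0) = (frame_matrix e d (g \<otimes> p) *v u, 0)" for u
    unfolding push[OF x0(1)] DK[OF x0(1)] fr by (simp add: matrix_vector_mult_def vec_eq_iff)
  have p2: "push h x0 (0, vcnj (frame_matrix e c p *v u)) = (0, vcnj (frame_matrix e d (g \<otimes> p) *v u))" for u
    unfolding push[OF x0(1)] DK[OF x0(1)] fr by (simp add: matrix_vector_mult_def vec_eq_iff)
  show thesis
  proof
    show "frame_matrix e d (g \<otimes> p) = K x0 ** frame_matrix e c p"
      unfolding matrix_eq by (simp add: fr matrix_vector_mul_assoc)
    show "brk d (g \<otimes> p) u w = K x0 *v brk c p u w" for u w
      unfolding brk_def x0(2)[symmetric] p1[symmetric] E unfolding Fc x0_def[symmetric]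
      using sym[of "frame_matrix e c p *v u" "frame_matrix e c p *v w"]
      by (simp add: matrix_vector_mult_diff_distrib)
    show "mbrk d (g \<otimes> p) u w = K x0 *v mbrk c p u w" for u w
      unfolding mbrk_def x0(2)[symmetric] p2[symmetric] E zero x0_def[symmetric]
      using matrix_vector_mult_diff_distrib[of "K x0" 0] by simp
  qed
qed

definition c0 :: "('a, 'n) chart" where
  "c0 = chart_at A \<one>"

definition cst :: "complex^'n \<Rightarrow> complex^'n \<Rightarrow> complex^'n" where
  "cst u w = matrix_inv (frame_matrix e c0 \<one>) *v brk c0 \<one> u w"

definition Bst :: "complex^'n \<Rightarrow> complex^'n \<Rightarrow> complex^'n" where
  "Bst u w = matrix_inv (frame_matrix e c0 \<one>) *v mbrk c0 \<one> u w"

lemma c0: "c0 \<in> charts_at A \<one>"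
  unfolding c0_def by (rule chart_at_in) (use carrier in auto)

text \<open>Translation by \<open>p\<close> takes the identity to \<open>p\<close>, and the frame
  and its brackets acquire the same Jacobian factor. The coefficients read off at the identity are
  hence valid everywhere.\<close>

lemma brk_structure:
  assumes "d \<in> charts_at A p"
  shows "brk d p u w = frame_matrix e d p *v cst u w" "mbrk d p u w = frame_matrix e d p *v Bst u w"
proof -
  let ?M = "frame_matrix e c0 \<one>"
  have p: "p \<in> carrier G" by (rule chart_carrier[OF assms])
  note i = matrix_inv_cancel(1)[OF frame_matrix_det(1)[OF e_basis_at[OF one_closed] c0]]
  have d: "d \<in> charts_at A (p \<otimes> \<one>)" using assms p by simp
  from bracket_natural[OF p c0 d]
  obtain K where K: "frame_matrix e d p = K ** ?M"
    "\<And>u w. brk d p u w = K *v brk c0 \<one> u w" "\<And>u w. mbrk d p u w = K *v mbrk c0 \<one> u w"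
    using p by auto
  have M: "?M *v (matrix_inv ?M *v y) = y" for y
    by (simp only: matrix_vector_mul_assoc i matrix_vector_mul_lid)
  show "brk d p u w = frame_matrix e d p *v cst u w" "mbrk d p u w = frame_matrix e d p *v Bst u w"
    unfolding K cst_def Bst_def matrix_vector_mul_assoc[symmetric] M by (rule refl)+
qed

lemma fpart10_bracket:
  "fpart10 (bracket A (fld u) (fld w)) = fld (cst u w)"
  "mixed_bracket A (fld u) (fld w) = fld (Bst u w)"
proof -
  have o: "fld \<xi> p c = 0" if "c \<notin> charts_at A p" for \<xi> p c
  proof (cases "p \<in> carrier G")
    case True
    have "fld \<xi> p \<in> ctangent A p"
      unfolding fld_def by (rule ctangent_tlin) (use e_props(2)[OF True] in \<open>simp add: T10_iff\<close>)
    then show ?thesis using that by (rule ctangent_outside)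
  qed (simp add: fld_def e_props(1) tlin_def zero_prod_def)
  show "fpart10 (bracket A (fld u) (fld w)) = fld (cst u w)"
  proof (intro ext)
    fix p c show "fpart10 (bracket A (fld u) (fld w)) p c = fld (cst u w) p c"
    proof (cases "c \<in> charts_at A p")
      case True
      then show ?thesis
        by (simp add: fpart10_def part10_def fst_bracket brk_structure fld_chart)
    next
      case False
      then show ?thesis by (simp add: fpart10_def part10_def o bracket_def zero_prod_def)
    qed
  qed
  show "mixed_bracket A (fld u) (fld w) = fld (Bst u w)"
  proof (intro ext)
    fix p c show "mixed_bracket A (fld u) (fld w) p c = fld (Bst u w) p c"
    proof (cases "c \<in> charts_at A p")
      case True
      then show ?thesis
        by (simp add: mixed_bracket_def fpart10_def part10_def fst_mixed_bracket brk_structure fld_chart)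
    next
      case False
      then show ?thesis by (simp add: mixed_bracket_def fpart10_def part10_def o bracket_def zero_prod_def)
    qed
  qed
qed

section \<open>The metric on the fibre\<close>

abbreviation fs :: "complex^'n \<Rightarrow> complex" where
  "fs \<equiv> fsq F e \<one>"

lemma fld_T10: "p \<in> carrier G \<Longrightarrow> fld \<xi> p \<in> T10 A p"
  unfolding fld_def by (rule tlin_T10) (rule e_props(2))

lemma fsq_invariant:
  assumes "p \<in> carrier G"
  shows "fsq F e p = fs"
proof
  fix v
  have "F (p \<otimes> \<one>) (tmap A (\<lambda>q. p \<otimes> q) \<one> (fld v \<one>)) = F \<one> (fld v \<one>)"
    using metric_inv assms fld_T10[OF one_closed] unfolding left_invariant_metric_def by blast
  then have "F p (fld v p) = F \<one> (fld v \<one>)"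
    unfolding fld_left_inv[OF assms one_closed, symmetric] using assms by simp
  then show "fsq F e p v = fs v" by (simp add: fsq_def fld_def)
qed

lemma fs_homogeneous: "fs (a *s v) = of_real ((cmod a)\<^sup>2) * fs v"
proof -
  have "fld (a *s v) \<one> = tscale a (fld v \<one>)"
    by (simp add: fun_eq_iff tscale_def fld_chart matrix_scale)
  moreover have "F \<one> (tscale a (fld v \<one>)) = cmod a * F \<one> (fld v \<one>)"
    using finsler fld_T10[OF one_closed] carrier unfolding complex_finsler_metric_def by blast
  ultimately show ?thesis by (simp add: fsq_def fld_def power_mult_distrib)
qed

abbreviation fc :: "complex^'n \<Rightarrow> complex" where
  "fc \<equiv> fsq F (coord_frame A c0) \<one>"

text \<open>Smoothness and positivity of the metric are given in coordinate frames; this linear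
  substitution transfers both to the left-invariant frame.\<close>

lemma fs_fc: "fs v = fc (frame_matrix e c0 \<one> *v v)"
proof -
  let ?y = "frame_matrix e c0 \<one> *v v"
  have t: "coord_frame A c0 i \<one> \<in> ctangent A \<one>" "coord_frame A c0 i \<one> c0 = (axis i 1, 0)" for i
    unfolding coord_frame_def by (rule tvec_of_at[OF c0])+
  have "fld v \<one> = tlin ?y (\<lambda>i. coord_frame A c0 i \<one>)"
  proof (rule ctangent_eqI[OF _ ctangent_tlin[OF t(1)] c0])
    show "fld v \<one> \<in> ctangent A \<one>" using fld_T10[OF one_closed] unfolding T10_iff by blast
    show "fld v \<one> c0 = tlin ?y (\<lambda>i. coord_frame A c0 i \<one>) c0"
      unfolding fld_chart tlin_def t(2) by (simp add: basis_expansion)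
  qed
  then show ?thesis by (simp add: fsq_def fld_def)
qed

lemma fc_smooth_fibre: "smooth_fibre fc"
proof
  show "cnj (fc v) = fc v" for v by (simp add: fsq_def)
  let ?x = "snd c0 \<one>"
  let ?S = "snd c0 ` fst c0 \<times> - {0 :: complex^'n}"
  note cA = charts_atD[OF c0]
  define Fc where "Fc = (\<lambda>(x, v). F (chart_inv c0 x) (tlin v (\<lambda>i. coord_frame A c0 i (chart_inv c0 x))))"
  have s: "smooth_on ?S Fc"
    using finsler cA(1) unfolding complex_finsler_metric_def Let_def Fc_def by blast
  have oS: "open ?S"
    using chart_image_open[OF cA(1) chart_open[OF cA(1)]] by (intro open_Times open_nonzero) simp
  have bl: "bounded_linear (\<lambda>y :: complex^'n. (0 :: complex^'n, y))"
    by (rule bounded_linear_Pair[OF bounded_linear_zero bounded_linear_ident])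
  have "smooth_on (- {0}) (\<lambda>v. Fc ((?x, 0) + (0, v)))"
    by (rule smooth_on_affine[OF oS bl open_nonzero _ s]) (use cA(2) in auto)
  then have "smooth_on (- {0}) (\<lambda>v. F \<one> (tlin v (\<lambda>i. coord_frame A c0 i \<one>)))"
    by (simp add: Fc_def chart_inv_chart[OF cA])
  from smooth_on_linear[OF open_nonzero bounded_linear_of_real this]
  have r: "smooth_on (- {0}) (\<lambda>v. complex_of_real (F \<one> (tlin v (\<lambda>i. coord_frame A c0 i \<one>))))" .
  from smooth_on_mult[OF open_nonzero r r]
  show "smooth_on (- {0}) fc" by (simp add: fsq_def[abs_def] power2_eq_square)
qed

lemma M0_nonzero: "v \<noteq> 0 \<Longrightarrow> frame_matrix e c0 \<one> *v v \<noteq> 0"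
  using frame_matrix_inj[OF e_basis_at[OF one_closed] c0] by blast

lemma positive_definite_fs:
  assumes "v \<noteq> 0"
  shows "positive_definite (\<lambda>i j. wirt i (wirtb j fs) v)"
proof -
  interpret fc: smooth_fibre fc by (rule fc_smooth_fibre)
  let ?M = "frame_matrix e c0 \<one>"
  have p: "positive_definite (\<lambda>i j. wirt i (wirtb j fc) (?M *v v))"
    using pseudoconvex charts_atD[OF c0] M0_nonzero[OF assms]
    unfolding strongly_pseudoconvex_def g_mix_def by blast
  have e: "fs = (\<lambda>y. fc (?M *v y))" by (rule ext) (rule fs_fc)
  have "levi fs v \<xi> \<xi> = levi fc (?M *v v) (?M *v \<xi>) (?M *v \<xi>)" for \<xi>
    unfolding e by (rule fc.levi_change, erule M0_nonzero, rule assms)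
  note l = this
  show ?thesis
    unfolding positive_definite_def
  proof (intro allI impI)
    fix \<xi> :: "complex^'n" assume "\<xi> \<noteq> 0"
    from p[unfolded positive_definite_def, rule_format, OF M0_nonzero[OF this]]
    show "(\<Sum>i\<in>UNIV. \<Sum>j\<in>UNIV. wirt i (wirtb j fs) v * \<xi> $ i * cnj (\<xi> $ j)) \<in> \<real> \<and>
      0 < Re (\<Sum>i\<in>UNIV. \<Sum>j\<in>UNIV. wirt i (wirtb j fs) v * \<xi> $ i * cnj (\<xi> $ j))"
      unfolding levi_def[symmetric] l .
  qed
qed

lemma smooth_fs: "smooth_on (- {0}) fs"
proof -
  interpret fc: smooth_fibre fc by (rule fc_smooth_fibre)
  have "smooth_on (- {0}) (\<lambda>v. fc (0 + frame_matrix e c0 \<one> *v v))"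
    by (rule smooth_on_affine[OF open_nonzero bounded_linear_matrix_vector open_nonzero _ fc.smooth])
       (use M0_nonzero in auto)
  then show ?thesis by (simp add: fs_fc[symmetric, abs_def])
qed

text \<open>Antilinearity of \<open>Bst\<close> in its second argument stems from the
  \<open>vcnj\<close> in \<open>mbrk\<close>, and \<open>brk\<close> is visibly antisymmetric. From
  here on the results on a fibre apply to the actual structure constants.\<close>

sublocale fib: connection_fibre fs Bst cst
proof
  let ?Mi = "matrix_inv (frame_matrix e c0 \<one>)"
  have d1: "dmatrix M x (y + y', 0) = dmatrix M x (y, 0) + dmatrix M x (y', 0)" for M x and y y' :: "complex^'n"
    using dmatrix_add[of M x "(y, 0)" "(y', 0)"] by simp
  have d2: "dmatrix M x (0, y + y') = dmatrix M x (0, y) + dmatrix M x (0, y')" for M x and y y' :: "complex^'n"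
    using dmatrix_add[of M x "(0, y)" "(0, y')"] by simp
  have d3: "dmatrix M x (a *s y, 0) *v w = a *s (dmatrix M x (y, 0) *v w)" for M x a w and y :: "complex^'n"
    using dmatrix_scale[of M x a y 0 w] by simp
  have d4: "dmatrix M x (0, vcnj (a *s y)) *v w = cnj a *s (dmatrix M x (0, vcnj y) *v w)" for M x a w and y :: "complex^'n"
  proof -
    have "vcnj (a *s y) = cnj a *s vcnj y" by (simp add: vec_eq_iff)
    then show ?thesis using dmatrix_scale[of M x "cnj a" 0 "vcnj y" w] by simp
  qed
  have neg: "M *v (- x) = - (M *v x)" for M :: "complex^'n^'n" and x
    using matrix_vector_mult_diff_distrib[of M 0 x] by simp
  have sm: "- (a *s x) = a *s (- x)" for a and x :: "complex^'n"
    by (simp add: vec_eq_iff)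
  have sd: "a *s x - a *s y = a *s (x - y)" for a and x y :: "complex^'n"
    by (simp add: vec_eq_iff algebra_simps)
  show "smooth_on (- {0}) fs" by (rule smooth_fs)
  show "cnj (fs v) = fs v" for v by (simp add: fsq_def)
  show "fs (a *s v) = of_real ((cmod a)\<^sup>2) * fs v" for a v by (rule fs_homogeneous)
  show "v \<noteq> 0 \<Longrightarrow> positive_definite (\<lambda>i j. wirt i (wirtb j fs) v)" for v by (rule positive_definite_fs)
  show "Bst (x + y) w = Bst x w + Bst y w" for x y w
    by (simp add: Bst_def mbrk_def matrix_vector_right_distrib matrix_vector_mult_diff_distrib neg)
  show "Bst (a *s x) w = a *s Bst x w" for a x w
    by (simp only: Bst_def mbrk_def matrix_scale sm[symmetric] neg)
  show "Bst x (w + z) = Bst x w + Bst x z" for x w z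
    by (simp add: Bst_def mbrk_def matrix_vector_right_distrib vcnj_add d2 matrix_vector_mult_add_rdistrib
        matrix_vector_mult_diff_distrib neg)
  show "Bst x (a *s w) = cnj a *s Bst x w" for a x w
    by (simp only: Bst_def mbrk_def matrix_scale d4 sm[symmetric] neg)
  show "cst (x + y) w = cst x w + cst y w" for x y w
    unfolding cst_def brk_def matrix_vector_right_distrib d1 matrix_vector_mult_add_rdistrib
      matrix_vector_mult_diff_distrib by (rule add_diff_add)
  show "cst (a *s x) w = a *s cst x w" for a x w
    by (simp only: cst_def brk_def matrix_scale d3 sd)
  show "cst x y = - cst y x" for x y
    unfolding cst_def brk_def neg[symmetric] minus_diff_eq ..
qed

section \<open>The Chern-Rund connection of a frame\<close>

text \<open>Decomposing \<open>Y\<close> and \<open>Z\<close> by type splits the left side into a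
  pure bracket and two mixed ones; this is the bracket formula read backwards.\<close>

lemma frame_structure:
  assumes "c \<in> charts_at A p" "Y \<in> ctangent A p" "Z \<in> ctangent A p"
  shows "dmatrix (FM c) (snd c p) (Z c) *v coef e p Y - dmatrix (FM c) (snd c p) (Y c) *v coef e p Z
    = frame_matrix e c p *v (cst (coef e p Z) (coef e p Y)
        - Bst (coef e p Y) (coef e p (tconj Z)) + Bst (coef e p Z) (coef e p (tconj Y)))"
proof -
  have b: "basis_at e p" by (rule e_basis_at[OF chart_carrier[OF assms(1)]])
  let ?M = "frame_matrix e c p"
  have d: "dmatrix (FM c) (snd c p) (W c)
      = dmatrix (FM c) (snd c p) (?M *v coef e p W, 0) + dmatrix (FM c) (snd c p) (0, vcnj (?M *v coef e p (tconj W)))"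
    if "W \<in> ctangent A p" for W
    using dmatrix_add[of "FM c" "snd c p" "(?M *v coef e p W, 0)" "(0, vcnj (?M *v coef e p (tconj W)))"]
      ctangent_decompose[OF b that, of c] by simp
  show ?thesis
    unfolding d[OF assms(2)] d[OF assms(3)] matrix_vector_mult_add_rdistrib
      matrix_vector_right_distrib matrix_vector_mult_diff_distrib
      brk_structure[OF assms(1), symmetric] brk_def mbrk_def
    by simp
qed

text \<open>The Maurer-Cartan equation for the left-invariant coframe of type (1,0).\<close>

lemma ext_deriv_e:
  assumes "p \<in> carrier G" "Y \<in> ctangent A p" "Z \<in> ctangent A p"
  shows "(\<chi> i. ext_deriv A (coframe e i) p Y Z) = cst (coef e p Z) (coef e p Y)
        - Bst (coef e p Y) (coef e p (tconj Z)) + Bst (coef e p Z) (coef e p (tconj Y))"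
proof -
  have p: "p \<in> topspace X" using assms(1) carrier by simp
  note b = e_basis_at[OF assms(1)]
  note c = chart_at_in[OF p]
  show ?thesis
    by (rule frame_matrix_cancel[OF b c])
       (simp only: ext_deriv_coframe[OF e_local_frame p] matrix_inv_fst[OF b c] assms(2,3) frame_structure[OF c])
qed

section \<open>An arbitrary local frame compared with the left-invariant one\<close>

context
  fixes U :: "'a set" and e' :: "'n \<Rightarrow> ('a, 'n) field"
  assumes frame': "local_frame X A U e'"
begin

lemma U_sub: "U \<subseteq> topspace X"
  by (rule openin_subset[OF local_frame_open[OF frame']])

lemma bases:
  assumes "p \<in> U"
  shows "basis_at e p" "basis_at e' p" "chart_at A p \<in> charts_at A p" "p \<in> carrier G"
proof -
  show "p \<in> carrier G" using assms U_sub carrier by blast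
  then show "basis_at e p" by (rule e_basis_at)
  show "basis_at e' p" by (rule local_frame_basis[OF frame' assms])
  show "chart_at A p \<in> charts_at A p" by (rule chart_at_in) (use assms U_sub in blast)
qed

abbreviation ch :: "'a \<Rightarrow> complex^'n^'n" where
  "ch p \<equiv> change e e' p"

definition dch :: "'a \<Rightarrow> ('a, 'n) tvec \<Rightarrow> complex^'n^'n" where
  "dch p Z = dmatrix (\<lambda>x. ch (chart_inv (chart_at A p) x)) (snd (chart_at A p) p) (Z (chart_at A p))"

lemma ch_nonzero: "p \<in> U \<Longrightarrow> v \<noteq> 0 \<Longrightarrow> ch p *v v \<noteq> 0"
  using change_inj[OF bases(1,2)] by blast

lemma ch_inverse:
  assumes "p \<in> U"
  shows "ch p *v (matrix_inv (ch p) *v x) = x"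
proof -
  have "invertible (ch p)"
    unfolding invertible_left_inverse matrix_left_invertible_ker
    using ch_nonzero[OF assms] by blast
  then show ?thesis by (simp only: matrix_vector_mul_assoc matrix_inv_cancel(1) matrix_vector_mul_lid)
qed

lemma ch_cancel: "p \<in> U \<Longrightarrow> ch p *v x = ch p *v y \<Longrightarrow> x = y"
  using ch_nonzero[of p "x - y"] by (auto simp: matrix_vector_mult_diff_distrib)

lemma fsq_frame:
  assumes "p \<in> U"
  shows "fsq F e' p = (\<lambda>y. fs (ch p *v y))"
proof
  fix y
  note B = bases[OF assms]
  have "tlin y (\<lambda>i. e' i p) = fld (ch p *v y) p"
  proof (rule ctangent_eqI[OF _ _ B(3)])
    show "tlin y (\<lambda>i. e' i p) \<in> ctangent A p" by (rule ctangent_tlin) (rule basis_atD(1)[OF B(2)])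
    show "fld (ch p *v y) p \<in> ctangent A p" using fld_T10[OF B(4)] unfolding T10_iff by blast
    have "fst (tlin y (\<lambda>i. e' i p) (chart_at A p)) = frame_matrix e (chart_at A p) p *v (ch p *v y)"
      unfolding frame_matrix_mult[symmetric] frame_matrix_change[OF B(1,2)] by (simp only: matrix_vector_mul_assoc)
    moreover have "snd (tlin y (\<lambda>i. e' i p) (chart_at A p)) = 0"
      by (simp add: tlin_def basis_atD(3)[OF B(2)])
    ultimately show "tlin y (\<lambda>i. e' i p) (chart_at A p) = fld (ch p *v y) p (chart_at A p)"
      unfolding fld_chart by (simp add: prod_eq_iff)
  qed
  then have "fsq F e' p y = fsq F e p (ch p *v y)" by (simp add: fsq_def fld_def)
  then show "fsq F e' p y = fs (ch p *v y)" by (simp only: fsq_invariant[OF B(4)])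
qed

lemma differentiable_ch:
  assumes "p \<in> U"
  shows "(\<lambda>x. ch (chart_inv (chart_at A p) x) $ l $ k) differentiable (at (snd (chart_at A p) p))"
  by (rule smooth_on_differentiable[OF smooth_change[OF e_local_frame frame' U_sub charts_atD(1)[OF bases(3)[OF assms]]]])
     (use assms charts_atD(2)[OF bases(3)[OF assms]] in blast)

text \<open>The Maurer-Cartan equation transported by the change of frame; the \<open>dch\<close>
  terms come from the Leibniz rule in \<open>dmatrix_change\<close>.\<close>

lemma ext_deriv_frame:
  assumes p: "p \<in> U" and Y: "Y \<in> ctangent A p" and Z: "Z \<in> ctangent A p"
  shows "ch p *v (\<chi> i. ext_deriv A (coframe e' i) p Y Z) = cst (coef e p Z) (coef e p Y)
        - Bst (coef e p Y) (coef e p (tconj Z)) + Bst (coef e p Z) (coef e p (tconj Y))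
        + dch p Z *v coef e' p Y - dch p Y *v coef e' p Z"
proof -
  note B = bases[OF p]
  let ?c = "chart_at A p"
  have "frame_matrix e ?c p *v (ch p *v (\<chi> i. ext_deriv A (coframe e' i) p Y Z))
     = frame_matrix e' ?c p *v (\<chi> i. ext_deriv A (coframe e' i) p Y Z)"
    by (simp only: frame_matrix_change[OF B(1,2)] matrix_vector_mul_assoc)
  also have "\<dots> = (dmatrix (FM ?c) (snd ?c p) (Z ?c) *v coef e p Y + frame_matrix e ?c p *v (dch p Z *v coef e' p Y))
     - (dmatrix (FM ?c) (snd ?c p) (Y ?c) *v coef e p Z + frame_matrix e ?c p *v (dch p Y *v coef e' p Z))"
    unfolding ext_deriv_coframe[OF frame' p] matrix_inv_fst[OF B(2,3) Y] matrix_inv_fst[OF B(2,3) Z]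
      dmatrix_change[OF e_local_frame frame' U_sub B(3) p] coef_change[OF B(1,2) Y] coef_change[OF B(1,2) Z] dch_def ..
  also have "\<dots> = (dmatrix (FM ?c) (snd ?c p) (Z ?c) *v coef e p Y - dmatrix (FM ?c) (snd ?c p) (Y ?c) *v coef e p Z)
     + frame_matrix e ?c p *v (dch p Z *v coef e' p Y) - frame_matrix e ?c p *v (dch p Y *v coef e' p Z)"
    by simp
  also have "\<dots> = frame_matrix e ?c p *v (cst (coef e p Z) (coef e p Y)
        - Bst (coef e p Y) (coef e p (tconj Z)) + Bst (coef e p Z) (coef e p (tconj Y))
        + dch p Z *v coef e' p Y - dch p Y *v coef e' p Z)"
    unfolding frame_structure[OF B(3) Y Z] matrix_vector_mult_diff_distrib matrix_vector_right_distrib ..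
  finally show ?thesis by (rule frame_matrix_cancel[OF B(1,3)])
qed

text \<open>With \<open>e'\<^sub>j = a\<^sup>k\<^sub>j e\<^sub>k\<close> the connection forms are related by \<open>\<omega>' = a\<^sup>-\<^sup>1 (\<omega> a + da)\<close>, the fibre
  coordinates by \<open>v = a v'\<close> and the torsions by \<open>\<tau>' = a\<^sup>-\<^sup>1 \<tau>\<close>.\<close>

definition omf :: "'a \<Rightarrow> complex^'n \<Rightarrow> ('a, 'n) tvec \<Rightarrow> complex^'n \<Rightarrow> complex^'n" where
  "omf p v Z x = matrix_inv (ch p) *v
     (fib.om (ch p *v v) (coef e p Z) (coef e p (tconj Z)) (ch p *v x) + dch p Z *v x)"

definition Gf :: "('a, 'n) coeffs" where
  "Gf i j k p v = omf p v (e' k p) (axis j 1) $ i"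

definition Gfb :: "('a, 'n) coeffs" where
  "Gfb i j k p v = omf p v (tconj (e' k p)) (axis j 1) $ i"

text \<open>Halved because the value of \<tau> on a pair of frame vectors is T_jk - T_kj, twice the
  coefficient.\<close>

definition Tf :: "('a, 'n) coeffs" where
  "Tf i j k p v = (matrix_inv (ch p) *v fib.tor (ch p *v v) (ch p *v axis j 1) (ch p *v axis k 1)) $ i / 2"

lemma ch_omf:
  "p \<in> U \<Longrightarrow> ch p *v omf p v Z x
    = fib.om (ch p *v v) (coef e p Z) (coef e p (tconj Z)) (ch p *v x) + dch p Z *v x"
  unfolding omf_def by (rule ch_inverse)

lemma omf_add: "omf p v Z (x + y) = omf p v Z x + omf p v Z y"
  by (simp add: omf_def matrix_vector_right_distrib fib.om_add)

lemma omf_scale: "omf p v Z (a *s x) = a *s omf p v Z x"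
  by (simp only: omf_def matrix_scale fib.om_scale vector_add_ldistrib matrix_vector_right_distrib)

lemma omf_basis: "(\<Sum>j\<in>UNIV. x $ j * omf p v Z (axis j 1) $ i) = omf p v Z x $ i"
  unfolding linear_basis[of "omf p v Z" x, OF omf_add omf_scale] by (simp add: sum_component)

text \<open>The coefficients are by definition the values of \<open>omf\<close> on the frame and its
  conjugate, so the claim is complex linearity of \<open>omf\<close> in \<open>Z\<close>. It holds
  because \<open>om\<close> is linear in \<open>s\<close> and antilinear in \<open>t\<close>, and
  \<open>t\<close> comes from the conjugate vector.\<close>

lemma conn_form_omf:
  assumes p: "p \<in> U" and v: "v \<noteq> 0" and Z: "Z \<in> ctangent A p"
  shows "conn_form e' Gf Gfb i j p v Z = omf p v Z (axis j 1) $ i"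
proof -
  note B = bases[OF p]
  let ?c = "chart_at A p"
  let ?M = "matrix_inv (frame_matrix e ?c p)"
  let ?x = "axis j 1"
  have v': "ch p *v v \<noteq> 0" by (rule ch_nonzero[OF p v])
  \<comment> \<open>The same expression as a function of chart components, the form in which the
    expansion along the frame is available.\<close>
  define D where "D z = (matrix_inv (ch p) *v
     (fib.om (ch p *v v) (?M *v fst z) (?M *v vcnj (snd z)) (ch p *v ?x)
      + dmatrix (\<lambda>x. ch (chart_inv ?c x)) (snd ?c p) z *v ?x)) $ i" for z
  have D: "omf p v W ?x $ i = D (W ?c)" if W: "W \<in> ctangent A p" for W
  proof -
    have "coef e p (tconj W) = ?M *v vcnj (snd (W ?c))"
      using matrix_inv_fst[OF B(1,3) ctangent_tconj[OF W]] by (simp add: tconj_def pcnj_def)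
    then show ?thesis
      unfolding omf_def D_def dch_def by (simp only: matrix_inv_fst[OF B(1,3) W])
  qed
  have om1: "fib.om u (s + s') (t + t') x = fib.om u s t x + fib.om u s' t' x" if "u \<noteq> 0" for u s s' t t' x
    by (simp add: fib.om_def fib.Gam_add2[OF that] fib.B_add2)
  have om2: "fib.om u (a *s s) (cnj a *s t) x = a *s fib.om u s t x" if "u \<noteq> 0" for u a s t x
    by (simp add: fib.om_def fib.Gam_scale2[OF that] fib.B_scale2 vec_eq_iff algebra_simps)
  have vs: "vcnj (a *s x) = cnj a *s vcnj x" for a and x :: "complex^'n" by (simp add: vec_eq_iff)
  have "D (Z ?c) = (\<Sum>k\<in>UNIV. coef e' p Z $ k * D (e' k p ?c) + cnj (coef e' p (tconj Z) $ k) * D (tconj (e' k p) ?c))"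
  proof (rule linear_frame_expansion[OF B(2) Z])
    show "D (y + z) = D y + D z" for y z
      by (simp add: D_def vcnj_add matrix_vector_right_distrib om1[OF v'] dmatrix_add matrix_vector_mult_add_rdistrib)
    show "D (r *s y, r *s z) = r * D (y, z)" for r y z
      by (simp add: D_def vs matrix_scale om2[OF v'] dmatrix_scale vector_add_ldistrib matrix_vector_right_distrib
          distrib_left)
  qed
  then show ?thesis
    unfolding conn_form_def Gf_def Gfb_def coframe_coef D[OF Z, symmetric]
      D[OF basis_atD(1)[OF B(2)], symmetric] D[OF ctangent_tconj[OF basis_atD(1)[OF B(2)]], symmetric]
    by (simp add: mult.commute)
qed

text \<open>After multiplication by the change of frame the \<open>dch\<close> terms cancel, and so
  do the mixed brackets against the barred part of \<open>om\<close>. What remains depends only on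
  (1,0)-components, so the (1,1)-component of the torsion is zero.\<close>

lemma torsion_form_frame:
  assumes p: "p \<in> U" and v: "v \<noteq> 0" and Y: "Y \<in> ctangent A p" and Z: "Z \<in> ctangent A p"
  shows "torsion_form A e' Gf Gfb i p v Y Z
    = (matrix_inv (ch p) *v fib.tor (ch p *v v) (coef e p Y) (coef e p Z)) $ i"
proof -
  note B = bases[OF p]
  have "torsion_form A e' Gf Gfb i p v Y Z
      = ((\<chi> i. ext_deriv A (coframe e' i) p Y Z) - omf p v Z (coef e' p Y) + omf p v Y (coef e' p Z)) $ i" for i
    unfolding torsion_form_def coframe_coef[of e'] conn_form_omf[OF p v Z] conn_form_omf[OF p v Y]
      sum_subtractf omf_basis by simp
  then have "(\<chi> i. torsion_form A e' Gf Gfb i p v Y Z)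
      = (\<chi> i. ext_deriv A (coframe e' i) p Y Z) - omf p v Z (coef e' p Y) + omf p v Y (coef e' p Z)"
    by (simp add: vec_eq_iff)
  then have "ch p *v (\<chi> i. torsion_form A e' Gf Gfb i p v Y Z)
      = ch p *v (\<chi> i. ext_deriv A (coframe e' i) p Y Z) - ch p *v omf p v Z (coef e' p Y) + ch p *v omf p v Y (coef e' p Z)"
    by (simp only: matrix_vector_right_distrib matrix_vector_mult_diff_distrib)
  also have "\<dots> = fib.tor (ch p *v v) (coef e p Y) (coef e p Z)"
    unfolding ext_deriv_frame[OF p Y Z] ch_omf[OF p] coef_change[OF B(1,2) Y] coef_change[OF B(1,2) Z]
      fib.om_def fib.tor_def fib.c_anti[of "coef e p Y" "coef e p Z"]
    by simp
  also have "\<dots> = ch p *v (matrix_inv (ch p) *v fib.tor (ch p *v v) (coef e p Y) (coef e p Z))"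
    by (simp only: ch_inverse[OF p])
  finally have "(\<chi> i. torsion_form A e' Gf Gfb i p v Y Z)
      = matrix_inv (ch p) *v fib.tor (ch p *v v) (coef e p Y) (coef e p Z)"
    by (rule ch_cancel[OF p])
  then show ?thesis by (simp add: vec_eq_iff)
qed

lemma torsion_coeffs_frame: "torsion_coeffs A U e' Gf Gfb Tf"
  unfolding torsion_coeffs_def
proof (intro ballI allI impI conjI)
  fix p and v :: "complex^'n" assume p: "p \<in> U" and v: "v \<noteq> 0"
  note B = bases[OF p]
  note v' = ch_nonzero[OF p v]
  have neg: "M *v (- x) = - (M *v x)" for M :: "complex^'n^'n" and x
    using matrix_vector_mult_diff_distrib[of M 0 x] by simp
  show anti: "Tf i j k p v = - Tf i k j p v" for i j k
    unfolding Tf_def fib.tor_anti[of _ "ch p *v axis j 1"] neg by simp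
  fix i Y Z assume Y: "Y \<in> ctangent A p" and Z: "Z \<in> ctangent A p"
  \<comment> \<open>The torsion as an alternating bilinear form in coordinates of the new frame; its
    expansion over basis vectors yields the coefficients \<open>Tf\<close>.\<close>
  define Q where "Q x y = (matrix_inv (ch p) *v fib.tor (ch p *v v) (ch p *v x) (ch p *v y)) $ i" for x y
  have Q1: "Q x y = (\<Sum>j\<in>UNIV. x $ j * Q (axis j 1) y)" for x y
    unfolding Q_def by (rule functional_basis)
      (simp_all add: matrix_vector_right_distrib matrix_scale fib.tor_add1[OF v'] fib.tor_scale1[OF v'])
  have Q2: "Q x y = (\<Sum>k\<in>UNIV. y $ k * Q x (axis k 1))" for x y
    unfolding Q_def by (rule functional_basis)
      (simp_all add: matrix_vector_right_distrib matrix_scale fib.tor_add2[OF v'] fib.tor_scale2[OF v'])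
  have Q12: "Q x y = (\<Sum>j\<in>UNIV. \<Sum>k\<in>UNIV. Q (axis j 1) (axis k 1) * (x $ j * y $ k))" for x y
  proof -
    have "Q x y = (\<Sum>j\<in>UNIV. x $ j * (\<Sum>k\<in>UNIV. y $ k * Q (axis j 1) (axis k 1)))"
      by (subst Q1, subst Q2) (rule refl)
    then show ?thesis by (simp add: sum_distrib_left mult_ac)
  qed
  have Qanti: "Q y x = - Q x y" for x y
    unfolding Q_def fib.tor_anti[of _ "ch p *v y"] neg by simp
  have Tq: "Tf i j k p v = Q (axis j 1) (axis k 1) / 2" for j k
    by (simp add: Tf_def Q_def)
  have QT: "Q x y = (\<Sum>j\<in>UNIV. \<Sum>k\<in>UNIV. Tf i j k p v * (x $ j * y $ k - y $ j * x $ k))" for x y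
  proof -
    have "Tf i j k p v * (x $ j * y $ k - y $ j * x $ k)
        = (Q (axis j 1) (axis k 1) * (x $ j * y $ k) - Q (axis j 1) (axis k 1) * (y $ j * x $ k)) / 2" for j k
      unfolding Tq by (simp add: algebra_simps)
    then have "(\<Sum>j\<in>UNIV. \<Sum>k\<in>UNIV. Tf i j k p v * (x $ j * y $ k - y $ j * x $ k)) = (Q x y - Q y x) / 2"
      unfolding Q12[of x y] Q12[of y x] by (simp only: sum_divide_distrib[symmetric] sum_subtractf)
    then show ?thesis unfolding Qanti[of y x] by simp
  qed
  show "torsion_form A e' Gf Gfb i p v Y Z = (\<Sum>j\<in>UNIV. \<Sum>k\<in>UNIV. Tf i j k p v *
             (coframe e' j p Y * coframe e' k p Z - coframe e' j p Z * coframe e' k p Y))"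
    unfolding torsion_form_frame[OF p v Y Z] coframe_coef
      coef_change[OF B(1,2) Y, symmetric] coef_change[OF B(1,2) Z, symmetric] Q_def[symmetric]
    by (rule QT)
qed

text \<open>With the new fibre coordinate \<open>v\<close> held fixed, the fibre point and both
  basis vectors still move with the base point through the change of frame; each motion contributes
  a \<open>dch\<close> term.\<close>

lemma total_diff_frame:
  assumes p: "p \<in> U" and v: "v \<noteq> 0" and Z: "Z \<in> ctangent A p"
  defines "M \<equiv> ch p"
  shows "total_diff A (g_mix F e' i j) p v Z W
    = cart fs (M *v v) (M *v axis i 1) (M *v axis j 1) (dch p Z *v v + M *v fst W)
    + cartb fs (M *v v) (M *v axis i 1) (M *v axis j 1) (dch p (tconj Z) *v v + M *v vcnj (snd W))
    + levi fs (M *v v) (dch p Z *v axis i 1) (M *v axis j 1)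
    + levi fs (M *v v) (M *v axis i 1) (dch p (tconj Z) *v axis j 1)"
proof -
  note B = bases[OF p]
  define c where "c = chart_at A p"
  define x0 where "x0 = snd c p"
  define al where "al x = ch (chart_inv c x)" for x
  let ?S = "snd c ` (U \<inter> fst c)"
  have c: "c \<in> charts_at A p" "c \<in> A" "p \<in> fst c" unfolding c_def using B(3) charts_atD by blast+
  have o: "open ?S" by (rule chart_image_open[OF c(2) local_frame_open[OF frame']])
  have x0: "x0 \<in> ?S" using p c(3) by (simp add: x0_def)
  have al0: "al x0 = M" unfolding al_def x0_def M_def by (simp add: chart_inv_chart[OF c(2,3)])
  have g: "g_mix F e' i j q u = levi fs (ch q *v u) (ch q *v axis i 1) (ch q *v axis j 1)"
    if q: "q \<in> U" and u: "u \<noteq> 0" for q u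
    unfolding g_mix_def fsq_frame[OF q]
    by (rule fib.wirt_change2(1), erule ch_nonzero[OF q], rule u)
  have d: "(\<lambda>x. al x $ l $ k) differentiable (at x0)" for l k
    unfolding al_def x0_def c_def by (rule differentiable_ch[OF p])
  have dv: "(\<lambda>x. (al x *v w) $ k) differentiable (at x0)" for w k
    unfolding matrix_vector_mult_def using d by (simp add: differentiable_sum' differentiable_mult)
  have dd: "(\<chi> k. dderiv (\<lambda>x. (al x *v w) $ k) x0 z) = dmatrix al x0 z *v w" for w z
    by (simp add: vec_eq_iff dderiv_matrix_const[of al x0, OF d])
  have dZ: "dmatrix al x0 (Z c) = dch p Z" "dmatrix al x0 (pcnj (Z c)) = dch p (tconj Z)"
    by (simp_all add: dch_def al_def[abs_def] x0_def c_def tconj_def)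
  have nz: "al x0 *v v \<noteq> 0" unfolding al0 M_def by (rule ch_nonzero[OF p v])
  have dl: "(\<lambda>x. levi fs (y x) (a x) (b x)) differentiable (at x)"
    if "\<And>k. (\<lambda>x. y x $ k) differentiable (at x)" "y x \<noteq> 0"
      "\<And>k. (\<lambda>x. a x $ k) differentiable (at x)" "\<And>k. (\<lambda>x. b x $ k) differentiable (at x)"
    for y a b :: "complex^'n \<Rightarrow> complex^'n" and x
  proof -
    have "(\<lambda>x. wirt i (wirtb j fs) (y x)) differentiable (at x)" for i j
      using differentiable_chain_at[OF differentiable_vec[of y, OF that(1)] fib.differentiable_w(4)[OF that(2)]]
      by (simp add: o_def)
    then show ?thesis
      unfolding levi_def using that differentiable_cnj[OF that(4)]
      by (intro differentiable_sum' differentiable_mult)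
  qed
  have "dderiv (\<lambda>x. g_mix F e' i j (chart_inv c x) v) x0 (Z c)
      = dderiv (\<lambda>x. levi fs (al x *v v) (al x *v axis i 1) (al x *v axis j 1)) x0 (Z c)"
    by (rule dderiv_cong_open[OF o x0, symmetric])
       (use chart_image_point(1)[OF c(2)] g v in \<open>simp add: al_def\<close>, rule dl[of "\<lambda>x. al x *v v", OF dv nz dv dv])
  also have "\<dots> = cart fs (M *v v) (M *v axis i 1) (M *v axis j 1) (dch p Z *v v)
    + cartb fs (M *v v) (M *v axis i 1) (M *v axis j 1) (dch p (tconj Z) *v v)
    + levi fs (M *v v) (dch p Z *v axis i 1) (M *v axis j 1)
    + levi fs (M *v v) (M *v axis i 1) (dch p (tconj Z) *v axis j 1)"
    unfolding fib.dderiv_levi_full[of "\<lambda>x. al x *v v", OF dv nz dv dv] dd dZ al0 ..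
  finally have 1: "dderiv (\<lambda>x. g_mix F e' i j (chart_inv c x) v) x0 (Z c)
    = cart fs (M *v v) (M *v axis i 1) (M *v axis j 1) (dch p Z *v v)
    + cartb fs (M *v v) (M *v axis i 1) (M *v axis j 1) (dch p (tconj Z) *v v)
    + levi fs (M *v v) (dch p Z *v axis i 1) (M *v axis j 1)
    + levi fs (M *v v) (M *v axis i 1) (dch p (tconj Z) *v axis j 1)" .
  have Mf: "(M *v (x + y)) $ k = (M *v x) $ k + (M *v y) $ k" "(M *v (a *s x)) $ k = a * (M *v x) $ k" for a x y k
    by (simp_all add: matrix_vector_right_distrib matrix_scale)
  note dM = differentiable_functional[of "\<lambda>x. (M *v x) $ k" for k, OF Mf]
  have dMd: "(\<chi> k. dderiv (\<lambda>x. (M *v x) $ k) v z) = M *v fst z" for z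
    by (simp add: vec_eq_iff dderiv_functional[of "\<lambda>x. (M *v x) $ k" for k, OF Mf])
  have nzM: "M *v v \<noteq> 0" unfolding M_def by (rule ch_nonzero[OF p v])
  have dcon: "(\<lambda>x. w $ k) differentiable (at v)" for w :: "complex^'n" and k by simp
  have "dderiv (g_mix F e' i j p) v W = dderiv (\<lambda>u. levi fs (M *v u) (M *v axis i 1) (M *v axis j 1)) v W"
    by (rule dderiv_cong_open[OF open_nonzero, symmetric])
       (use g[OF p] v in \<open>simp_all add: M_def[symmetric]\<close>, rule dl[of "\<lambda>x. M *v x", OF dM nzM dcon dcon])
  also have "\<dots> = cart fs (M *v v) (M *v axis i 1) (M *v axis j 1) (M *v fst W)
    + cartb fs (M *v v) (M *v axis i 1) (M *v axis j 1) (M *v vcnj (snd W))"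
  proof -
    have z: "(\<chi> k. 0) = (0 :: complex^'n)" by (simp add: vec_eq_iff)
    have l: "levi fs (M *v v) 0 b = 0" "levi fs (M *v v) b 0 = 0" for b by (simp_all add: levi_def)
    show ?thesis
      unfolding fib.dderiv_levi_full[of "\<lambda>x. M *v x", OF dM nzM dcon dcon] dMd by (simp add: z l pcnj_def)
  qed
  finally have 2: "dderiv (g_mix F e' i j p) v W
    = cart fs (M *v v) (M *v axis i 1) (M *v axis j 1) (M *v fst W)
    + cartb fs (M *v v) (M *v axis i 1) (M *v axis j 1) (M *v vcnj (snd W))" .
  show ?thesis
    unfolding total_diff_def Let_def c_def[symmetric] x0_def[symmetric] 1 2 cart_add3 cartb_add3 by simp
qed

text \<open>Both sides are expressed in the left-invariant frame. The \<open>dch\<close> and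
  vertical terms agree, and the difference is \<open>metric_compatible\<close> at the transported
  fibre point.\<close>

lemma chern_rund_frame: "chern_rund_connection A F U e' Gf Gfb"
  unfolding chern_rund_connection_def
proof (intro ballI allI impI conjI)
  fix p and v :: "complex^'n" assume p: "p \<in> U" and v: "v \<noteq> 0"
  note B = bases[OF p]
  note v' = ch_nonzero[OF p v]
  have z1: "fib.tor u 0 y = 0" "fib.tor u y 0 = 0" if "u \<noteq> 0" for u y
    using fib.tor_scale1[OF that, of 0 0 y] fib.tor_scale2[OF that, of y 0 0] by simp_all
  show "component11 (torsion_form A e' Gf Gfb i p v) Y Z = 0"
    if Y: "Y \<in> ctangent A p" and Z: "Z \<in> ctangent A p" for i Y Z
    unfolding component11_def
    by (simp add: torsion_form_frame[OF p v] ctangent_part Y Z coef_simps[OF B(1)] z1[OF v'])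
  fix i j Z W assume Z: "Z \<in> ctangent A p"
  let ?M = "ch p" and ?s = "coef e p Z" and ?t = "coef e p (tconj Z)"
  let ?a = "?M *v axis i 1" and ?b = "?M *v axis j 1" and ?v = "?M *v v"
  note tZ = ctangent_tconj[OF Z]
  have gm: "(\<Sum>l\<in>UNIV. g_mix F e' l j p v * y $ l) = levi fs ?v (?M *v y) ?b"
    "(\<Sum>l\<in>UNIV. g_mix F e' i l p v * cnj (y $ l)) = levi fs ?v ?a (?M *v y)"
    "(\<Sum>l\<in>UNIV. C_hol F e' i j l p v * y $ l) = cart fs ?v ?a ?b (?M *v y)"
    "(\<Sum>l\<in>UNIV. C_bar F e' i j l p v * cnj (y $ l)) = cartb fs ?v ?a ?b (?M *v y)" for y
  proof -
    have lc: "levi (\<lambda>y. fs (?M *v y)) v x y = levi fs ?v (?M *v x) (?M *v y)" for x y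
      by (rule fib.levi_change, erule ch_nonzero[OF p], rule v)
    show "(\<Sum>l\<in>UNIV. g_mix F e' l j p v * y $ l) = levi fs ?v (?M *v y) ?b"
      "(\<Sum>l\<in>UNIV. g_mix F e' i l p v * cnj (y $ l)) = levi fs ?v ?a (?M *v y)"
      unfolding g_mix_def fsq_frame[OF p] index_sums lc by (rule refl)+
    show "(\<Sum>l\<in>UNIV. C_hol F e' i j l p v * y $ l) = cart fs ?v ?a ?b (?M *v y)"
      unfolding C_hol_def fsq_frame[OF p]
      by (rule fib.cart_change_sum(1), erule ch_nonzero[OF p], rule v)
    show "(\<Sum>l\<in>UNIV. C_bar F e' i j l p v * cnj (y $ l)) = cartb fs ?v ?a ?b (?M *v y)"
      unfolding C_bar_def fsq_frame[OF p]
      by (rule fib.cart_change_sum(2), erule ch_nonzero[OF p], rule v)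
  qed
  have vf: "vert_form e' Gf Gfb l p v Y W = (fst W + omf p v Y v) $ l" if "Y \<in> ctangent A p" for l Y W
    unfolding vert_form_def conn_form_omf[OF p v that] omf_basis by simp
  have "(\<Sum>l\<in>UNIV. g_mix F e' l j p v * conn_form e' Gf Gfb l i p v Z
                   + g_mix F e' i l p v * cnj (conn_form e' Gf Gfb l j p v (tconj Z))
                   + C_hol F e' i j l p v * vert_form e' Gf Gfb l p v Z W
                   + C_bar F e' i j l p v * cnj (vert_form e' Gf Gfb l p v (tconj Z) (pcnj W)))
     = levi fs ?v (?M *v omf p v Z (axis i 1)) ?b + levi fs ?v ?a (?M *v omf p v (tconj Z) (axis j 1))
       + cart fs ?v ?a ?b (?M *v (fst W + omf p v Z v))
       + cartb fs ?v ?a ?b (?M *v (fst (pcnj W) + omf p v (tconj Z) v))"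
    unfolding conn_form_omf[OF p v Z] conn_form_omf[OF p v tZ] vf[OF Z] vf[OF tZ] sum.distrib gm ..
  also have "\<dots> = total_diff A (g_mix F e' i j) p v Z W"
    unfolding total_diff_frame[OF p v Z] matrix_vector_right_distrib ch_omf[OF p] tconj_tconj
      levi_add1 levi_add2 cart_add3 cartb_add3
    using fib.metric_compatible[OF v', of ?s ?t ?a ?b]
    by (simp add: pcnj_def algebra_simps)
  finally show "total_diff A (g_mix F e' i j) p v Z W =
          (\<Sum>l\<in>UNIV. g_mix F e' l j p v * conn_form e' Gf Gfb l i p v Z
                   + g_mix F e' i l p v * cnj (conn_form e' Gf Gfb l j p v (tconj Z))
                   + C_hol F e' i j l p v * vert_form e' Gf Gfb l p v Z W
                   + C_bar F e' i j l p v * cnj (vert_form e' Gf Gfb l p v (tconj Z) (pcnj W)))"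
    by (rule sym)
qed

text \<open>The contraction is independent of the frame: the vector argument of the torsion
  transforms with the change of frame, its value with the inverse, and g absorbs the latter.\<close>

lemma weak_torsion_frame:
  assumes p: "p \<in> U" and v: "v \<noteq> 0"
  shows "(\<Sum>i\<in>UNIV. \<Sum>j\<in>UNIV. \<Sum>l\<in>UNIV. g_mix F e' j l p v * Tf j i k p v * v $ i * cnj (v $ l))
    = levi fs (ch p *v v) (fib.tor (ch p *v v) (ch p *v v) (ch p *v axis k 1)) (ch p *v v) / 2"
proof -
  note v' = ch_nonzero[OF p v]
  let ?M = "ch p" and ?v = "ch p *v v"
  define t where "t x = (1/2) *s (matrix_inv ?M *v fib.tor ?v (?M *v x) (?M *v axis k 1))" for x
  have t: "t v = (\<Sum>i\<in>UNIV. v $ i *s t (axis i 1))"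
    by (rule linear_basis)
       (simp_all add: t_def matrix_vector_right_distrib matrix_scale fib.tor_add1[OF v'] fib.tor_scale1[OF v']
          vector_add_ldistrib mult.commute)
  have Tt: "Tf j i k p v = t (axis i 1) $ j" for i j
    by (simp add: Tf_def t_def)
  have "(\<Sum>i\<in>UNIV. \<Sum>j\<in>UNIV. \<Sum>l\<in>UNIV. g_mix F e' j l p v * Tf j i k p v * v $ i * cnj (v $ l))
     = (\<Sum>i\<in>UNIV. v $ i * levi (\<lambda>y. fs (?M *v y)) v (t (axis i 1)) v)"
    unfolding Tt g_mix_def fsq_frame[OF p] levi_def by (simp add: sum_distrib_left mult_ac)
  also have "\<dots> = levi (\<lambda>y. fs (?M *v y)) v (t v) v"
  proof -
    have "levi h v (\<Sum>i\<in>I. x i) w = (\<Sum>i\<in>I. levi h v (x i) w)" if "finite I"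
      for h and x :: "'n \<Rightarrow> complex^'n" and w :: "complex^'n" and I
      using that by (induction I rule: finite_induct) (simp_all add: levi_add1, simp add: levi_def)
    then show ?thesis unfolding t by (simp add: levi_scale1)
  qed
  also have "\<dots> = levi fs ?v (?M *v t v) ?v"
    by (rule fib.levi_change, erule ch_nonzero[OF p], rule v)
  also have "\<dots> = levi fs ?v (fib.tor ?v ?v (?M *v axis k 1)) ?v / 2"
    unfolding t_def matrix_scale ch_inverse[OF p] levi_scale1 by simp
  finally show ?thesis .
qed

end

section \<open>Uniqueness in the left-invariant frame\<close>

text \<open>Testing the (1,1)-condition on \<open>e j\<close> and a conjugate \<open>e k\<close>
  fixes the barred coefficients. The metric equation on \<open>e k\<close> with zero fibre component
  then becomes the equation of \<open>Gam_unique\<close>.\<close>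

lemma torsion_unique:
  assumes conn: "chern_rund_connection A F (topspace X) e \<Gamma> \<Gamma>b"
    and tors: "torsion_coeffs A (topspace X) e \<Gamma> \<Gamma>b T" and v: "v \<noteq> 0"
  shows "2 * T i j k \<one> v = fib.tor v (axis j 1) (axis k 1) $ i"
proof -
  let ?p = "\<one>"
  have pG: "?p \<in> carrier G" by (rule one_closed)
  have p: "?p \<in> topspace X" using carrier pG by simp
  note b = e_basis_at[OF pG]
  note E = basis_atD(1)[OF b] ctangent_tconj[OF basis_atD(1)[OF b]]
  have cf: "conn_form e \<Gamma> \<Gamma>b i j ?p v (e k ?p) = \<Gamma> i j k ?p v"
    "conn_form e \<Gamma> \<Gamma>b i j ?p v (tconj (e k ?p)) = \<Gamma>b i j k ?p v" for i j k
    unfolding conn_form_def coframe_coef tconj_tconj coef_simps(1,2)[OF b] by (simp_all add: axis_sum cnj_axis)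
  have ext: "ext_deriv A (coframe e i) ?p Y Z = (cst (coef e ?p Z) (coef e ?p Y)
      - Bst (coef e ?p Y) (coef e ?p (tconj Z)) + Bst (coef e ?p Z) (coef e ?p (tconj Y))) $ i"
    if "Y \<in> ctangent A ?p" "Z \<in> ctangent A ?p" for i Y Z
    using arg_cong[OF ext_deriv_e[OF pG that], of "\<lambda>x. x $ i"] by simp
  have z0: "Bst 0 y = 0" "Bst y 0 = 0" "cst 0 y = 0" "cst y 0 = 0" for y
    using fib.B_scale1[of 0 0 y] fib.B_scale2[of y 0 0] fib.c_scale[of 0 0 y] fib.c_scale2[of y 0 0] by simp_all
  have tau: "torsion_form A e \<Gamma> \<Gamma>b i ?p v Y Z = ext_deriv A (coframe e i) ?p Y Z
      - (\<Sum>j\<in>UNIV. coef e ?p Y $ j * conn_form e \<Gamma> \<Gamma>b i j ?p v Z)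
      + (\<Sum>j\<in>UNIV. coef e ?p Z $ j * conn_form e \<Gamma> \<Gamma>b i j ?p v Y)" for i Y Z
    unfolding torsion_form_def coframe_coef by (simp add: sum_subtractf)
  have Gb: "\<Gamma>b i j k ?p v = - Bst (axis j 1) (axis k 1) $ i" for i j k
  proof -
    have zero: "part01 (e j ?p) = (\<lambda>c. 0)" "part10 (tconj (e k ?p)) = (\<lambda>c. 0)"
      "part10 (e j ?p) = e j ?p" "part01 (tconj (e k ?p)) = tconj (e k ?p)"
      by (simp_all add: fun_eq_iff part01_def part10_def tconj_def pcnj_def basis_atD(3)[OF b] prod_eq_iff)
    have tz: "tconj (\<lambda>c. 0 :: 'n cvec) = (\<lambda>c. 0)"
      by (simp add: tconj_def pcnj_def zero_prod_def)
    have c: "coef e ?p (\<lambda>c. 0) = 0"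
      using coef_simps(4)[OF b E(1)[of j]] zero(1) by simp
    \<comment> \<open>The second term of \<open>component11\<close> is evaluated on zero vectors
      here, since \<open>e j\<close> has no (0,1)-part and the conjugate of \<open>e k\<close> no
      (1,0)-part.\<close>
    have "torsion_form A e \<Gamma> \<Gamma>b i ?p v (\<lambda>c. 0) (\<lambda>c. 0) = 0"
      unfolding tau ext[OF ctangent_zero ctangent_zero] tz c by (simp add: z0)
    moreover have "torsion_form A e \<Gamma> \<Gamma>b i ?p v (e j ?p) (tconj (e k ?p))
        = - Bst (axis j 1) (axis k 1) $ i - \<Gamma>b i j k ?p v"
      unfolding tau ext[OF E] tconj_tconj coef_simps(1,2)[OF b] cf by (simp add: z0 axis_sum)
    moreover have "component11 (torsion_form A e \<Gamma> \<Gamma>b i ?p v) (e j ?p) (tconj (e k ?p)) = 0"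
      using conn p v E unfolding chern_rund_connection_def by blast
    ultimately show ?thesis by (simp add: component11_def zero)
  qed
  define L where "L k x = (\<chi> l. \<Sum>m\<in>UNIV. x $ m * \<Gamma> l m k ?p v)" for k x
  have L_add: "L k (x + y) = L k x + L k y" and L_scale: "L k (a *s x) = a *s L k x" for k x y a
    by (simp_all add: L_def vec_eq_iff algebra_simps sum.distrib sum_distrib_left)
  have L_axis: "L k (axis i 1) $ l = \<Gamma> l i k ?p v" for i k l
    by (simp add: L_def axis_sum)
  have LG: "L k x = fib.Gam v x (axis k 1)" for k x
  proof (rule fib.Gam_unique[OF v])
    fix x u
    \<comment> \<open>The defect of the desired equation. The metric equation gives its vanishing on
      basis vectors, and P is linear in \<open>x\<close> and antilinear in \<open>u\<close>.\<close>
    define P where "P x u = levi fs v (L k x) u - levi fs v x (Bst u (axis k 1)) + cart fs v x u (L k v)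
      - cartb fs v x u (Bst v (axis k 1))" for x u
    have P0: "P (axis i 1) (axis j 1) = 0" for i j
    proof -
      \<comment> \<open>In the left-invariant frame g does not depend on the base point, and the
        chosen tangent vector has no fibre component.\<close>
      have "total_diff A (g_mix F e i j) ?p v (e k ?p) 0 = 0"
      proof -
        define c where "c = chart_at A ?p"
        have c: "c \<in> A" "?p \<in> fst c" unfolding c_def using chart_at_in[OF p] charts_atD by blast+
        have "dderiv (\<lambda>x. wirt i (wirtb j fs) v) (snd c ?p) z
            = dderiv (\<lambda>x. g_mix F e i j (chart_inv c x) v) (snd c ?p) z" for z
        proof (rule dderiv_cong_open)
          show "open (snd c ` (fst c \<inter> fst c))" by (rule chart_image_open[OF c(1) chart_open[OF c(1)]])
          show "snd c ?p \<in> snd c ` (fst c \<inter> fst c)" using c(2) by blast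
          fix x assume x: "x \<in> snd c ` (fst c \<inter> fst c)"
          have "chart_inv c x \<in> carrier G" by (rule chart_carrier[OF chart_image_point(2)[OF c(1) x]])
          then show "wirt i (wirtb j fs) v = g_mix F e i j (chart_inv c x) v"
            unfolding g_mix_def by (simp only: fsq_invariant)
        qed simp
        then show ?thesis by (simp add: total_diff_def Let_def c_def[symmetric])
      qed
      moreover have "total_diff A (g_mix F e i j) ?p v (e k ?p) 0 =
          (\<Sum>l\<in>UNIV. g_mix F e l j ?p v * conn_form e \<Gamma> \<Gamma>b l i ?p v (e k ?p)
                   + g_mix F e i l ?p v * cnj (conn_form e \<Gamma> \<Gamma>b l j ?p v (tconj (e k ?p)))
                   + C_hol F e i j l ?p v * vert_form e \<Gamma> \<Gamma>b l ?p v (e k ?p) 0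
                   + C_bar F e i j l ?p v * cnj (vert_form e \<Gamma> \<Gamma>b l ?p v (tconj (e k ?p)) (pcnj 0)))"
        using conn p v E(1) unfolding chern_rund_connection_def by blast
      moreover have vf: "vert_form e \<Gamma> \<Gamma>b l ?p v (e k ?p) 0 = L k v $ l"
        "vert_form e \<Gamma> \<Gamma>b l ?p v (tconj (e k ?p)) (pcnj 0) = - Bst v (axis k 1) $ l" for l
      proof -
        show "vert_form e \<Gamma> \<Gamma>b l ?p v (e k ?p) 0 = L k v $ l"
          by (simp add: vert_form_def cf L_def)
        have "Bst v (axis k 1) $ l = (\<Sum>m\<in>UNIV. v $ m * Bst (axis m 1) (axis k 1) $ l)"
          by (rule functional_basis) (simp_all add: fib.B_add1 fib.B_scale1)
        then show "vert_form e \<Gamma> \<Gamma>b l ?p v (tconj (e k ?p)) (pcnj 0) = - Bst v (axis k 1) $ l"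
          by (simp add: vert_form_def cf Gb pcnj_def sum_negf)
      qed
      ultimately have "0 = levi fs v (L k (axis i 1)) (axis j 1) + levi fs v (axis i 1) (- Bst (axis j 1) (axis k 1))
          + cart fs v (axis i 1) (axis j 1) (L k v) + cartb fs v (axis i 1) (axis j 1) (- Bst v (axis k 1))"
        unfolding cf vf L_axis[symmetric] Gb vector_uminus_component[symmetric] sum.distrib
          g_mix_def C_hol_def C_bar_def index_sums by simp
      then show ?thesis
        using cartb_diff3[of fs v "axis i 1" "axis j 1" 0 "Bst v (axis k 1)"]
          cartb_scale3[of fs v "axis i 1" "axis j 1" 0 0]
        by (simp add: P_def levi_minus2)
    qed
    have P1: "P x u = (\<Sum>i\<in>UNIV. x $ i * P (axis i 1) u)" for x u
      unfolding P_def by (rule functional_basis)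
        (simp_all add: L_add L_scale levi_add1 levi_scale1 cart_add1 cart_scale1 cartb_add1 cartb_scale1 algebra_simps)
    have P2: "P x u = (\<Sum>j\<in>UNIV. cnj (u $ j) * P x (axis j 1))" for x u
      unfolding P_def by (rule antifunctional_basis)
        (simp_all add: levi_add2 levi_scale2 fib.B_add1 fib.B_scale1 cart_add2 cart_scale2 cartb_add2 cartb_scale2 algebra_simps)
    have "P (axis i 1) u = 0" for i by (subst P2) (simp add: P0)
    then have "P x u = 0" by (subst P1) simp
    then show "levi fs v (L k x) u = levi fs v x (Bst u (axis k 1)) - cart fs v x u (L k v) + cartb fs v x u (Bst v (axis k 1))"
      by (simp add: P_def algebra_simps)
  qed
  have "torsion_form A e \<Gamma> \<Gamma>b i ?p v (e j ?p) (e k ?p)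
      = cst (axis k 1) (axis j 1) $ i - \<Gamma> i j k ?p v + \<Gamma> i k j ?p v"
    unfolding tau ext[OF E(1) E(1)] coef_simps(1,2)[OF b] cf by (simp add: z0 axis_sum)
  also have "\<dots> = fib.tor v (axis j 1) (axis k 1) $ i"
    unfolding L_axis[symmetric] LG fib.tor_def fib.c_anti[of "axis k 1"] by simp
  finally have t1: "torsion_form A e \<Gamma> \<Gamma>b i ?p v (e j ?p) (e k ?p) = fib.tor v (axis j 1) (axis k 1) $ i" .
  have "torsion_form A e \<Gamma> \<Gamma>b i ?p v (e j ?p) (e k ?p) = (\<Sum>m\<in>UNIV. \<Sum>l\<in>UNIV. T i m l ?p v *
      (axis j 1 $ m * axis k 1 $ l - axis k 1 $ m * axis j 1 $ l))"
  proof -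
    have "torsion_form A e \<Gamma> \<Gamma>b i ?p v (e j ?p) (e k ?p) = (\<Sum>m\<in>UNIV. \<Sum>l\<in>UNIV. T i m l ?p v *
        (coframe e m ?p (e j ?p) * coframe e l ?p (e k ?p) - coframe e m ?p (e k ?p) * coframe e l ?p (e j ?p)))"
      using tors p v E(1) unfolding torsion_coeffs_def by blast
    then show ?thesis unfolding coframe_coef coef_simps(1)[OF b] .
  qed
  also have "\<dots> = (\<Sum>m\<in>UNIV. (\<Sum>l\<in>UNIV. T i m l ?p v * axis k 1 $ l) * axis j 1 $ m)
      - (\<Sum>m\<in>UNIV. (\<Sum>l\<in>UNIV. T i m l ?p v * axis j 1 $ l) * axis k 1 $ m)"
    by (simp add: algebra_simps sum_subtractf sum_distrib_left sum_distrib_right)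
  also have "\<dots> = T i j k ?p v - T i k j ?p v" by (simp only: axis_sum)
  also have "T i k j ?p v = - T i j k ?p v"
    using tors p v unfolding torsion_coeffs_def by blast
  finally show ?thesis using t1 by simp
qed

section \<open>The two conditions\<close>

text \<open>Necessity uses the global left-invariant frame at the identity. Sufficiency upgrades the
  hypothesis by \<open>tor_zero\<close> to all pairs of vectors and transports it to every
  frame.\<close>

lemma kaehler_iff_tor: "kaehler_finsler X A F \<longleftrightarrow> (\<forall>v. v \<noteq> 0 \<longrightarrow> (\<forall>w. fib.tor v w v = 0))"
proof
  assume "kaehler_finsler X A F"
  then obtain \<Gamma> \<Gamma>b T where T: "chern_rund_connection A F (topspace X) e \<Gamma> \<Gamma>b"
    "torsion_coeffs A (topspace X) e \<Gamma> \<Gamma>b T"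
    "\<forall>p\<in>topspace X. \<forall>v. v \<noteq> 0 \<longrightarrow> (\<forall>i j k. T j i k p v = 0)"
    using e_local_frame unfolding kaehler_finsler_def by blast
  show "\<forall>v. v \<noteq> 0 \<longrightarrow> (\<forall>w. fib.tor v w v = 0)"
  proof (intro allI impI)
    fix v w :: "complex^'n" assume v: "v \<noteq> 0"
    have "\<one> \<in> topspace X" using carrier by auto
    then have "fib.tor v (axis j 1) (axis k 1) = 0" for j k
      using T(3) v torsion_unique[OF T(1,2) v, of _ j k] by (simp add: vec_eq_iff)
    then show "fib.tor v w v = 0" by (rule fib.tor_zero_axis[OF v])
  qed
next
  assume t: "\<forall>v. v \<noteq> 0 \<longrightarrow> (\<forall>w. fib.tor v w v = 0)"
  show "kaehler_finsler X A F"
    unfolding kaehler_finsler_def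
  proof (intro allI impI exI conjI)
    fix U e' assume f: "local_frame X A U e'"
    show "chern_rund_connection A F U e' (Gf e') (Gfb e')" by (rule chern_rund_frame[OF f])
    show "torsion_coeffs A U e' (Gf e') (Gfb e') (Tf e')" by (rule torsion_coeffs_frame[OF f])
    show "\<forall>p\<in>U. \<forall>v. v \<noteq> 0 \<longrightarrow> (\<forall>i j k. Tf e' j i k p v = 0)"
    proof (intro ballI allI impI)
      fix p and v :: "complex^'n" and i j k assume p: "p \<in> U" and v: "v \<noteq> 0"
      have "fib.tor (change e e' p *v v) x y = 0" for x y
        by (rule fib.tor_zero[OF _ ch_nonzero[OF f p v]]) (use t in blast)
      then show "Tf e' j i k p v = 0" by (simp add: Tf_def[OF f])
    qed
  qed
qed

lemma weakly_kaehler_iff_tor: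
  "weakly_kaehler_finsler X A F \<longleftrightarrow> (\<forall>v. v \<noteq> 0 \<longrightarrow> (\<forall>w. levi fs v (fib.tor v w v) v = 0))"
proof
  assume "weakly_kaehler_finsler X A F"
  then obtain \<Gamma> \<Gamma>b T where T: "chern_rund_connection A F (topspace X) e \<Gamma> \<Gamma>b"
    "torsion_coeffs A (topspace X) e \<Gamma> \<Gamma>b T"
    "\<forall>p\<in>topspace X. \<forall>v. v \<noteq> 0 \<longrightarrow> (\<forall>k. (\<Sum>i\<in>UNIV. \<Sum>j\<in>UNIV. \<Sum>l\<in>UNIV.
              g_mix F e j l p v * T j i k p v * v $ i * cnj (v $ l)) = 0)"
    using e_local_frame unfolding weakly_kaehler_finsler_def by blast
  show "\<forall>v. v \<noteq> 0 \<longrightarrow> (\<forall>w. levi fs v (fib.tor v w v) v = 0)"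
  proof (intro allI impI)
    fix v w :: "complex^'n" assume v: "v \<noteq> 0"
    have p: "\<one> \<in> topspace X" using carrier by auto
    have Tt: "T j i k \<one> v = fib.tor v (axis i 1) (axis k 1) $ j / 2" for i j k
      using torsion_unique[OF T(1,2) v, of j i k] by (simp add: field_simps)
    have L: "levi fs v (fib.tor v v (axis k 1)) v = 0" for k
    proof -
      have "levi fs v (fib.tor v v (axis k 1)) v = (\<Sum>i\<in>UNIV. v $ i * levi fs v (fib.tor v (axis i 1) (axis k 1)) v)"
        by (rule functional_basis[of "\<lambda>x. levi fs v (fib.tor v x (axis k 1)) v"])
           (simp_all add: fib.tor_add1[OF v] fib.tor_scale1[OF v] levi_add1 levi_scale1)
      \<comment> \<open>The factor compensates for \<open>T\<close> being half of
        \<open>tor\<close>.\<close>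
      also have "\<dots> = 2 * (\<Sum>i\<in>UNIV. \<Sum>j\<in>UNIV. \<Sum>l\<in>UNIV.
              g_mix F e j l \<one> v * T j i k \<one> v * v $ i * cnj (v $ l))"
        unfolding Tt g_mix_def levi_def by (simp add: sum_distrib_left mult_ac)
      also have "\<dots> = 0" using T(3) p v by simp
      finally show ?thesis .
    qed
    have "levi fs v (fib.tor v v w) v = (\<Sum>k\<in>UNIV. w $ k * levi fs v (fib.tor v v (axis k 1)) v)"
      by (rule functional_basis[of "\<lambda>x. levi fs v (fib.tor v v x) v"])
         (simp_all add: fib.tor_add2[OF v] fib.tor_scale2[OF v] levi_add1 levi_scale1)
    then have "levi fs v (fib.tor v v w) v = 0" by (simp add: L)
    then show "levi fs v (fib.tor v w v) v = 0"
      unfolding fib.tor_anti[of v w] by (simp add: levi_minus1)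
  qed
next
  assume t: "\<forall>v. v \<noteq> 0 \<longrightarrow> (\<forall>w. levi fs v (fib.tor v w v) v = 0)"
  show "weakly_kaehler_finsler X A F"
    unfolding weakly_kaehler_finsler_def
  proof (intro allI impI exI conjI)
    fix U e' assume f: "local_frame X A U e'"
    show "chern_rund_connection A F U e' (Gf e') (Gfb e')" by (rule chern_rund_frame[OF f])
    show "torsion_coeffs A U e' (Gf e') (Gfb e') (Tf e')" by (rule torsion_coeffs_frame[OF f])
    show "\<forall>p\<in>U. \<forall>v. v \<noteq> 0 \<longrightarrow> (\<forall>k. (\<Sum>i\<in>UNIV. \<Sum>j\<in>UNIV. \<Sum>l\<in>UNIV.
              g_mix F e' j l p v * Tf e' j i k p v * v $ i * cnj (v $ l)) = 0)"
    proof (intro ballI allI impI)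
      fix p and v :: "complex^'n" and k assume p: "p \<in> U" and v: "v \<noteq> 0"
      let ?v = "change e e' p *v v"
      have "levi fs ?v (fib.tor ?v (change e e' p *v axis k 1) ?v) ?v = 0"
        using t ch_nonzero[OF f p v] by blast
      then have "levi fs ?v (fib.tor ?v ?v (change e e' p *v axis k 1)) ?v = 0"
        unfolding fib.tor_anti[of ?v ?v] by (simp add: levi_minus1)
      then show "(\<Sum>i\<in>UNIV. \<Sum>j\<in>UNIV. \<Sum>l\<in>UNIV.
              g_mix F e' j l p v * Tf e' j i k p v * v $ i * cnj (v $ l)) = 0"
        unfolding weak_torsion_frame[OF f p v] by simp
    qed
  qed
qed

lemma forms_fld:
  "metric_g G F e (fld v) (fld u) (fld w) = levi fs v u w"
  "form_S G F e (fld v) (fld u) (fld w) = hess fs v u w"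
  "form_Sbar G F e (fld v) (fld u) (fld w) = cnj (hess fs v u w)"
  "cartan_plus G F e (fld v) (fld w) (fld u) (fld x) = cart fs v w u x"
  "cartan_minus G F e (fld v) (fld w) (fld u) (fld x) = cartb fs v w u x"
  by (simp_all add: metric_g_def form_S_def form_Sbar_def cartan_plus_def cartan_minus_def
      g_mix_def g_hol_def C_hol_def C_bar_def levi_def hess_def cart_def cartb_def)

text \<open>The definite description is justified by \<open>levi_N\<close> for existence and
  nondegeneracy of g for uniqueness.\<close>

lemma connection_op_fld:
  assumes "v \<noteq> 0"
  shows "connection_op G A F e (fld v) (fld w) = fld (fib.N v w)"
  unfolding connection_op_def
proof (rule the_equality)
  show "fld (fib.N v w) \<in> g10 G A \<and> (\<forall>u\<in>g10 G A. metric_g G F e (fld v) (fld (fib.N v w)) u =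
       metric_g G F e (fld v) (fld v) (mixed_bracket A u (fld w))
       + form_Sbar G F e (fld v) u (mixed_bracket A (fld v) (fld w)))"
    unfolding ball_g10 fpart10_bracket forms_fld by (simp add: fld_g10 fib.levi_N[OF assms] fib.rho_def)
  fix x assume x: "x \<in> g10 G A \<and> (\<forall>u\<in>g10 G A. metric_g G F e (fld v) x u =
       metric_g G F e (fld v) (fld v) (mixed_bracket A u (fld w))
       + form_Sbar G F e (fld v) u (mixed_bracket A (fld v) (fld w)))"
  define \<xi> where "\<xi> = fcoord e x"
  have \<xi>: "x = fld \<xi>" unfolding \<xi>_def using x fld_fcoord by simp
  have "levi fs v \<xi> u = levi fs v (fib.N v w) u" for u
    using x unfolding \<xi> ball_g10 fpart10_bracket forms_fld by (simp add: fib.levi_N[OF assms] fib.rho_def)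
  then have "\<xi> = fib.N v w" by (rule fib.levi_ext[OF assms])
  then show "x = fld (fib.N v w)" by (simp add: \<xi>)
qed

lemma kaehler_iff:
  "kaehler_finsler X A F \<longleftrightarrow>
           (\<forall>v\<in>g10 G A - {zero_field}. \<forall>u\<in>g10 G A. \<forall>w\<in>g10 G A.
              metric_g G F e v w (mixed_bracket A u v)
              - metric_g G F e v (fpart10 (bracket A v w)) u
              - metric_g G F e v v (mixed_bracket A u w)
              - form_Sbar G F e v u (mixed_bracket A v w)
              - cartan_plus G F e v w u (connection_op G A F e v v)
              + cartan_minus G F e v w u (mixed_bracket A v v) = 0)"
proof -
  \<comment> \<open>Nondegeneracy of g trades the vanishing of a vector for the vanishing of its
    products with all \<open>u\<close>; the sign matches
    \<open>kaehler_condition_tor\<close>.\<close>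
  have "(\<forall>v. v \<noteq> 0 \<longrightarrow> (\<forall>w. fib.tor v w v = 0))
      \<longleftrightarrow> (\<forall>v. v \<noteq> 0 \<longrightarrow> (\<forall>u w. - levi fs v (fib.tor v w v) u = 0))"
    using fib.levi_nondegenerate by (auto simp: levi_def)
  then show ?thesis
    unfolding ball_g10_nonzero ball_g10 fpart10_bracket forms_fld kaehler_iff_tor
    by (simp add: connection_op_fld forms_fld fib.kaehler_condition_tor)
qed

lemma weakly_kaehler_iff:
  "weakly_kaehler_finsler X A F \<longleftrightarrow>
           (\<forall>v\<in>g10 G A - {zero_field}. \<forall>w\<in>g10 G A.
              metric_g G F e v w (mixed_bracket A v v)
              - metric_g G F e v (fpart10 (bracket A v w)) v
              - metric_g G F e v v (mixed_bracket A v w)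
              - form_S G F e v (connection_op G A F e v v) w = 0)"
  unfolding ball_g10_nonzero ball_g10 fpart10_bracket forms_fld weakly_kaehler_iff_tor
  by (simp add: connection_op_fld forms_fld fib.weak_condition_tor)

end

theorem theorem1p2:
  fixes G :: "('a, 'm) monoid_scheme"
    and X :: "'a topology"
    and A :: "('a, 'n::finite) chart set"
    and F :: "'a \<Rightarrow> ('a, 'n) tvec \<Rightarrow> real"
    and e :: "'n \<Rightarrow> ('a, 'n) field"
  assumes "lie_group G X A"
    and "connected_space X"
    and "left_invariant_structure G A"
    and "complex_finsler_metric X A F"
    and "strongly_pseudoconvex A F"
    and "left_invariant_metric G A F"
    and "g10_basis G A e"
  shows "(kaehler_finsler X A F \<longleftrightarrow>
           (\<forall>v\<in>g10 G A - {zero_field}. \<forall>u\<in>g10 G A. \<forall>w\<in>g10 G A.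
              metric_g G F e v w (mixed_bracket A u v)
              - metric_g G F e v (fpart10 (bracket A v w)) u
              - metric_g G F e v v (mixed_bracket A u w)
              - form_Sbar G F e v u (mixed_bracket A v w)
              - cartan_plus G F e v w u (connection_op G A F e v v)
              + cartan_minus G F e v w u (mixed_bracket A v v) = 0)) \<and>
         (weakly_kaehler_finsler X A F \<longleftrightarrow>
           (\<forall>v\<in>g10 G A - {zero_field}. \<forall>w\<in>g10 G A.
              metric_g G F e v w (mixed_bracket A v v)
              - metric_g G F e v (fpart10 (bracket A v w)) v
              - metric_g G F e v v (mixed_bracket A v w)
              - form_S G F e v (connection_op G A F e v v) w = 0))"
proof -
  interpret lie_setting G X A F e
    by (rule lie_setting.intro) (rule assms)+
  show ?thesis by (rule conjI[OF kaehler_iff weakly_kaehler_iff])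
qed

end
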